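(* Let $n\geq d$ be positive integers and let $\lambda,\mu,\nu\in\mathcal{P}_{d,n}$. Let $\Phi:\mathcal{LP}_{\lambda,\mu}^{\nu\,+}\to\mathcal{LR}_{\lambda,\mu}^{\nu\,+}$ be the weight-preserving bijection from puzzles to positive equivariant Littlewood-Richardson skew tableaux described in the context (reading the rows of the tableau off the segments of the paths of the puzzle). Then $\Phi$ extends to a weight-preserving bijection $\Phi:\mathcal{LP}_{\lambda,\mu}^{\nu}\to\mathcal{LR}_{\lambda,\mu}^{\nu}$ from trapezoid puzzles to equivariant Littlewood-Richardson skew tableaux (where $\mathcal{LP}_{\lambda,\mu}^{\nu\,+}$ is viewed as a subset of $\mathcal{LP}_{\lambda,\mu}^{\nu}$). Here weight-preserving means that for every $P$ in the domain, $c_P$ and $c_{\Phi(P)}$ are equal and moreover are identical expressions (the same factors $y_i-y_j$ occur with the same multiplicities), and similarly for $C_P$ and $C_{\Phi(P)}$.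
   Context: Fix positive integers $n\geq d$. $\mathbb{N}$ is the set of nonnegative integers; for an integer $m$, $m':=d+1-m$. $\mathcal{P}_{d,n}$ is the set of partitions $\lambda=(\lambda_1\geq\cdots\geq\lambda_d)\in\mathbb{N}^d$ with $\lambda_1\leq n-d$. For a finite sequence with terms in $\{1,\ldots,d\}$, its content is $\omega\in\mathbb{N}^d$, where $\omega_k$ is the number of $k$'s in the sequence. $(y_i)_{i\ge1}$ and $Y_1,\ldots,Y_n$ are variables. Tableaux. The reverse Young diagram of $\mu$ is the right- and bottom-justified array of boxes whose bottom row has length $\mu_1$, next-to-bottom row length $\mu_2$, etc. Rows are numbered $1,2,\ldots$ from bottom to top and columns $1,2,\ldots$ from right to left; $r(a)$ and $c(a)$ are the row and column numbers of an entry $a$ in $\mu$. The skew diagram $\lambda*\mu$ is obtained by placing the ordinary (top-left justified) Young diagram $\lambda$ above and to the right of the reverse Young diagram $\mu$ (no box of $\lambda$ shares a row or column with a box of $\mu$). A skew barred tableau $L$ of shape $\lambda*\mu$ fills each box of $\lambda$ with an element of $\{1,\ldots,d\}$ and each box of $\mu$ with an element of $\{1,\ldots,d\}\cup\{\bar1,\ldots,\bar d\}$ so that the values, disregarding bars, weakly increase along rows from left to right and strictly increase down columns. $|a|$ is the integer value of an entry $a$ (bar disregarded). The unbarred column word $L^u$ is the sequence of unbarred entries read column by column, from the rightmost column to the leftmost, each column from top to bottom, barred entries being skipped. It is Yamanouchi if every initial segment contains at least as many $k$'s as $(k+1)$'s, $k=1,\ldots,d-1$. $\mathcal{LR}_{\lambda,\mu}^{\nu}$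 (the equivariant Littlewood-Richardson skew tableaux) is the set of skew barred tableaux of shape $\lambda*\mu$ whose unbarred column word is Yamanouchi with $\omega(L^u)=\nu$; this forces the $i$-th row of $\lambda$ to consist of $\lambda_i$ unbarred $i$'s. For $a\in L$, $L^u_{<a}$ is the portion of the unbarred column word that comes before reaching $a$. Set $$c_L=\prod_{a\text{ barred}}\left(y_{|a|'+\omega(L^u_{<a})_{|a|}}-y_{|a|'+c(a)-r(a)}\right),\quad C_L=\prod_{a\text{ barred}}\left(Y_{(n-d)+|a|-(c(a)-r(a))}-Y_{(n-d)+|a|-\omega(L^u_{<a})_{|a|}}\right),$$ products over barred entries $a$ of $L$ (empty product $=1$). $\mathcal{LR}_{\lambda,\mu}^{\nu\,+}$ is the set of $L\in\mathcal{LR}_{\lambda,\mu}^{\nu}$ such that each factor of $c_L$ is of the form $y_i-y_j$ with $i>j$. Puzzle pieces. Use the unit triangular lattice, whose edges are horizontal, of direction "/" (slope $+\sqrt3$), or of direction "\" (slope $-\sqrt3$). The eight puzzle pieces (with fixed orientation, unit edge lengths, edges labelled $0$ or $1$) are: the upward and downward unit triangles with all edges labelled $0$ (0-triangles); the upward and downward unit triangles with all edges labelled $1$ (1-triangles); the rhombus with two horizontal edges labelled $0$ and two "\" edges labelled $1$; the rhombus with two horizontal edges labelled $1$ and two "/" edges labelled $0$; the rhombus with two "/" edges labelled $1$ and two "\" edges labelled $0$; and the equivariant puzzle piece, the rhombus with two "/" edges labelled $0$ and two "\" edges labelled $1$. A binary word $w$ of length $n$ with $d$ ones corresponds to $(\eta_1,\ldots,\eta_d)\in\mathcal{P}_{d,n}$,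 where $\eta_j$ is the number of zeros of $w$ to the right of the $j$-th one from the left. Puzzles. A puzzle is a partition of an equilateral triangle of side length $n$ (with horizontal bottom side) into puzzle pieces, pieces sharing an edge having the same label on it. $\mathcal{LP}_{\lambda,\mu}^{\nu\,+}$ is the set of puzzles whose words read off the NE side (top to bottom), the NW side (bottom to top) and the S side (left to right) correspond to $\lambda,\mu,\nu$ respectively. For an equivariant puzzle piece of a puzzle, draw the lines through its center: $L_1$ parallel to the NW side and $L_2$ parallel to the NE side; they cross the S side at the centers of its $e$-th and $f$-th unit edges, numbered $1,\ldots,n$ from right to left, where $e>f$. The factorial weight of the piece is $y_e-y_f$ and its equivariant weight is $Y_{n+1-f}-Y_{n+1-e}$. $c_P$ (resp. $C_P$) is the product of the factorial (resp. equivariant) weights of all equivariant puzzle pieces of $P$. The bijection $\Phi$ on puzzles. Let $P\in\mathcal{LP}_{\lambda,\mu}^{\nu\,+}$. For $i\in\{1,\ldots,d\}$ let $P_i$ be the path of 1-triangles and rhombi which begins at the $i$-th edge from the top labelled $1$ on the NE side, moves only west or southwest, and ends on the S side: it passes through each rhombus with "\" edges labelled $1$ from its right "\" edge to its left "\" edge, through each upward 1-triangle from its "\" edge to its horizontal edge, through each rhombus with horizontal edges labelled $1$ from its top to its bottom edge, and through each downward 1-triangle from its horizontal edge to its "\" edge. The path $P_i$ contains $d+1-i$ upward 1-triangles and $d-i$ downward 1-triangles, alternating and starting and ending with an upward one. For $1\le j\le d+1-i$, the segment $P_{i,j}$ is the (possibly empty) sequence of rhombi of $P_i$ met just before its $j$-th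 upward 1-triangle and after its $(j-1)$-st downward 1-triangle (or after the NE side if $j=1$); each such rhombus is either an equivariant puzzle piece or a rhombus with horizontal edges labelled $0$. $\Phi(P)$ is the skew barred tableau of shape $\lambda*\mu$ whose $i$-th row of $\lambda$ consists of $\lambda_i$ unbarred $i$'s, and in which, for each $r$, the entries of value $i$ (barred or unbarred) in row $r$ of $\mu$, read from right to left, are given by the rhombi of $P_{i,\,d+2-i-r}$ in the order in which the path meets them starting from the NE side: an equivariant puzzle piece gives $\bar i$, and a rhombus with horizontal edges labelled $0$ gives an unbarred $i$ (there are no entries of value $i$ in row $r$ if $i+r>d+1$). This $\Phi$ is a weight-preserving bijection $\mathcal{LP}_{\lambda,\mu}^{\nu\,+}\to\mathcal{LR}_{\lambda,\mu}^{\nu\,+}$. Trapezoid puzzles. Let $T$ be the isosceles trapezoid formed by placing an equilateral triangle of side $n$ (apex up) on top of a rhombus of side $n$ with horizontal top and bottom sides and "/" left and right sides; let $D$ be the common horizontal side. The NE and NW boundaries of $T$ are those of the triangle; the E, W, S boundaries are the right, left and bottom sides of the rhombus. A trapezoid puzzle is a partition of $T$ into puzzle pieces (pieces sharing an edge having the same label on it) such that all labels on the E and W boundaries are $0$. $\mathcal{LP}_{\lambda,\mu}^{\nu}$ is the set of trapezoid puzzles whose words read off the NE (top to bottom), NW (bottom to top) and S (left to right) boundaries correspond to $\lambda,\mu,\nu$ respectively. For an equivariant puzzle piece of a trapezoid puzzle, draw the lines through its center: $L_1$ parallel to the NW boundary and $L_2$ parallel to the NE boundary; they cross $D$ (extended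 if necessary) at $e-\frac12$ and $f-\frac12$ units from its right endpoint, respectively ($e,f$ integers). The factorial weight of the piece is $y_e-y_f$ and its equivariant weight is $Y_{n+1-f}-Y_{n+1-e}$. $c_P$ (resp. $C_P$) is the product of the factorial (resp. equivariant) weights of all equivariant puzzle pieces of $P$. A puzzle is viewed as a trapezoid puzzle all of whose 1-triangles lie above $D$: one fills, in the rhombus below $D$, the width-one strip in "/" direction below each edge of $D$ labelled $1$ with $n$ rhombi having horizontal edges $1$ and "/" edges $0$, and the strip below each edge labelled $0$ with 0-triangles. In this way $\mathcal{LP}_{\lambda,\mu}^{\nu\,+}\subset\mathcal{LP}_{\lambda,\mu}^{\nu}$, with weights preserved. *)

theory Defs
  imports "HOL-Library.Multiset"
begin

text \<open>
  Partitions are lists of length d, so the part with number \<open>i \<ge> 1\<close> is \<open>lam ! (i - 1)\<close>.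
\<close>

definition partitions :: "nat \<Rightarrow> nat \<Rightarrow> nat list set" where
  "partitions d n = {lam. length lam = d \<and> sorted_wrt (\<ge>) lam \<and> lam ! 0 \<le> n - d}"

definition content :: "nat \<Rightarrow> nat list \<Rightarrow> nat list" where
  "content d w = map (count_list w) [1..<d + 1]"

definition yamanouchi :: "nat \<Rightarrow> nat list \<Rightarrow> bool" where
  "yamanouchi d w \<longleftrightarrow>
     (\<forall>m \<le> length w. \<forall>k \<in> {1..<d}. count_list (take m w) (k + 1) \<le> count_list (take m w) k)"

text \<open>
  A product of differences of variables, as an expression, is the multiset of the index pairs
  \<open>(i, j)\<close> of its factors \<open>y\<^sub>i - y\<^sub>j\<close>. Indices are integers only so that index arithmetic
  does not truncate.
\<close>

type_synonym expr = "(int \<times> int) multiset"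

definition expr_value :: "(int \<Rightarrow> 'a::comm_ring_1) \<Rightarrow> expr \<Rightarrow> 'a" where
  "expr_value y F = (\<Prod>p\<in>#F. y (fst p) - y (snd p))"


section \<open>Skew barred tableaux\<close>

text \<open>
  An entry is a pair of its value and a flag that is true iff the entry is barred.
  A filling of \<open>\<lambda> * \<mu>\<close> is a pair \<open>(A, B)\<close>: \<open>A\<close> lists the rows of the
  part \<open>\<lambda>\<close> from top to bottom, each read from left to right (its entries are all unbarred);
  \<open>B\<close> lists the rows of the part \<open>\<mu>\<close> from bottom to top, each read from right to left.
  Hence \<open>B ! r ! c\<close> is the entry in row \<open>r + 1\<close> and column \<open>c + 1\<close> of \<open>\<mu>\<close>.
\<close>

type_synonym entry = "nat \<times> bool"
type_synonym filling = "nat list list \<times> entry list list"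

definition skew_barred_tableau :: "nat \<Rightarrow> nat list \<Rightarrow> nat list \<Rightarrow> filling \<Rightarrow> bool" where
  "skew_barred_tableau d lam mu L = (case L of (A, B) \<Rightarrow>
     map length A = lam \<and> map length B = mu \<and>
     (\<forall>row \<in> set A. \<forall>v \<in> set row. v \<in> {1..d}) \<and>
     (\<forall>row \<in> set B. \<forall>a \<in> set row. fst a \<in> {1..d}) \<and>
     (\<forall>i j. i < length A \<and> j + 1 < length (A ! i) \<longrightarrow> A ! i ! j \<le> A ! i ! (j + 1)) \<and>
     (\<forall>i j. i + 1 < length A \<and> j < length (A ! (i + 1)) \<longrightarrow> A ! i ! j < A ! (i + 1) ! j) \<and>
     (\<forall>r c. r < length B \<and> c + 1 < length (B ! r)
        \<longrightarrow> fst (B ! r ! (c + 1)) \<le> fst (B ! r ! c)) \<and>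
     (\<forall>r c. r + 1 < length B \<and> c < length (B ! (r + 1))
        \<longrightarrow> fst (B ! (r + 1) ! c) < fst (B ! r ! c)))"

text \<open>
  The part \<open>\<lambda>\<close> lies to the right of the part \<open>\<mu>\<close>, so all its columns are read first.
\<close>

definition lam_word :: "nat list list \<Rightarrow> nat list" where
  "lam_word A =
     [A ! i ! j. j \<leftarrow> rev [0..<length (hd A)], i \<leftarrow> [0..<length A], j < length (A ! i)]"

definition mu_boxes :: "entry list list \<Rightarrow> (nat \<times> nat) list" where
  "mu_boxes B =
     [(r, c). c \<leftarrow> [0..<length (hd B)], r \<leftarrow> rev [0..<length B], c < length (B ! r)]"

definition val_at :: "entry list list \<Rightarrow> nat \<times> nat \<Rightarrow> nat" where
  "val_at B b = fst (B ! fst b ! snd b)"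

definition barred_at :: "entry list list \<Rightarrow> nat \<times> nat \<Rightarrow> bool" where
  "barred_at B b = snd (B ! fst b ! snd b)"

definition unbarred_values :: "entry list list \<Rightarrow> (nat \<times> nat) list \<Rightarrow> nat list" where
  "unbarred_values B bs = map (val_at B) (filter (\<lambda>b. \<not> barred_at B b) bs)"

definition unbarred_word :: "filling \<Rightarrow> nat list" where
  "unbarred_word L = lam_word (fst L) @ unbarred_values (snd L) (mu_boxes (snd L))"

definition unbarred_word_before :: "filling \<Rightarrow> nat \<times> nat \<Rightarrow> nat list" where
  "unbarred_word_before L b =
     lam_word (fst L) @ unbarred_values (snd L) (takeWhile (\<lambda>x. x \<noteq> b) (mu_boxes (snd L)))"

definition LR :: "nat \<Rightarrow> nat list \<Rightarrow> nat list \<Rightarrow> nat list \<Rightarrow> filling set" where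
  "LR d lam mu nu = {L. skew_barred_tableau d lam mu L \<and>
     yamanouchi d (unbarred_word L) \<and> content d (unbarred_word L) = nu}"

definition barred_boxes :: "filling \<Rightarrow> (nat \<times> nat) multiset" where
  "barred_boxes L = mset (filter (barred_at (snd L)) (mu_boxes (snd L)))"

definition omega_before :: "filling \<Rightarrow> nat \<times> nat \<Rightarrow> int" where
  "omega_before L b = int (count_list (unbarred_word_before L b) (val_at (snd L) b))"

definition col_minus_row :: "nat \<times> nat \<Rightarrow> int" where
  "col_minus_row b = (int (snd b) + 1) - (int (fst b) + 1)"

definition tableau_c :: "nat \<Rightarrow> filling \<Rightarrow> expr" where
  "tableau_c d L = image_mset (\<lambda>b. let v = int (val_at (snd L) b); v' = int d + 1 - v in
     (v' + omega_before L b, v' + col_minus_row b)) (barred_boxes L)"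

definition tableau_C :: "nat \<Rightarrow> nat \<Rightarrow> filling \<Rightarrow> expr" where
  "tableau_C d n L = image_mset (\<lambda>b. let v = int (val_at (snd L) b) in
     (int n - int d + v - col_minus_row b, int n - int d + v - omega_before L b))
     (barred_boxes L)"


section \<open>Puzzles\<close>

text \<open>
  The integer pair \<open>(a, b)\<close> stands for the lattice point \<open>a e\<^sub>1 + b e\<^sub>2\<close>, where \<open>e\<^sub>1\<close> is
  the horizontal unit vector pointing right and \<open>e\<^sub>2\<close> is the unit vector of slope
  \<open>+\<surd>3\<close> pointing up. The edges are
    \<^item> \<open>Hor a b\<close>: horizontal, from \<open>(a, b)\<close> to \<open>(a + 1, b)\<close>;
    \<^item> \<open>Rise a b\<close>: of slope \<open>+\<surd>3\<close>, from \<open>(a, b)\<close> to \<open>(a, b + 1)\<close>;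
    \<^item> \<open>Fall a b\<close>: of slope \<open>-\<surd>3\<close>, from \<open>(a, b + 1)\<close> to \<open>(a + 1, b)\<close>.
  The unit triangles are \<open>Upw a b\<close> with vertices \<open>(a, b)\<close>, \<open>(a + 1, b)\<close>, \<open>(a, b + 1)\<close> and
  \<open>Dnw a b\<close> with vertices \<open>(a + 1, b)\<close>, \<open>(a + 1, b + 1)\<close>, \<open>(a, b + 1)\<close>.
\<close>

datatype edge = Hor int int | Rise int int | Fall int int

datatype cell = Upw int int | Dnw int int

text \<open>
  \<open>RhHF\<close>: horizontal edges 0, falling edges 1. \<open>RhHR\<close>: horizontal edges 1, rising edges 0.
  \<open>RhRF\<close>: rising edges 1, falling edges 0. \<open>Equiv\<close>: the equivariant piece, with rising edges 0
  and falling edges 1. The position of a rhombus is that of the upward unit triangle in it.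
\<close>

datatype piece = Up0 | Up1 | Dn0 | Dn1 | RhHF | RhHR | RhRF | Equiv

type_synonym placed = "piece \<times> int \<times> int"

fun cells :: "placed \<Rightarrow> cell set" where
  "cells (Up0, a, b) = {Upw a b}"
| "cells (Up1, a, b) = {Upw a b}"
| "cells (Dn0, a, b) = {Dnw a b}"
| "cells (Dn1, a, b) = {Dnw a b}"
| "cells (RhHF, a, b) = {Upw a b, Dnw (a - 1) b}"
| "cells (RhHR, a, b) = {Upw a b, Dnw a b}"
| "cells (RhRF, a, b) = {Upw a b, Dnw a (b - 1)}"
| "cells (Equiv, a, b) = {Upw a b, Dnw a (b - 1)}"

fun labelled_edges :: "placed \<Rightarrow> (edge \<times> nat) set" where
  "labelled_edges (Up0, a, b) = {(Hor a b, 0), (Rise a b, 0), (Fall a b, 0)}"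
| "labelled_edges (Up1, a, b) = {(Hor a b, 1), (Rise a b, 1), (Fall a b, 1)}"
| "labelled_edges (Dn0, a, b) = {(Hor a (b + 1), 0), (Rise (a + 1) b, 0), (Fall a b, 0)}"
| "labelled_edges (Dn1, a, b) = {(Hor a (b + 1), 1), (Rise (a + 1) b, 1), (Fall a b, 1)}"
| "labelled_edges (RhHF, a, b) =
     {(Hor a b, 0), (Hor (a - 1) (b + 1), 0), (Fall a b, 1), (Fall (a - 1) b, 1)}"
| "labelled_edges (RhHR, a, b) =
     {(Hor a b, 1), (Hor a (b + 1), 1), (Rise a b, 0), (Rise (a + 1) b, 0)}"
| "labelled_edges (RhRF, a, b) =
     {(Rise a b, 1), (Rise (a + 1) (b - 1), 1), (Fall a b, 0), (Fall a (b - 1), 0)}"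
| "labelled_edges (Equiv, a, b) =
     {(Rise a b, 0), (Rise (a + 1) (b - 1), 0), (Fall a b, 1), (Fall a (b - 1), 1)}"

definition tiling :: "cell set \<Rightarrow> placed set \<Rightarrow> bool" where
  "tiling R P \<longleftrightarrow>
     (\<forall>x \<in> P. cells x \<subseteq> R) \<and>
     (\<forall>t \<in> R. \<exists>!x. x \<in> P \<and> t \<in> cells x) \<and>
     (\<forall>x \<in> P. \<forall>y \<in> P. \<forall>e k l.
        (e, k) \<in> labelled_edges x \<and> (e, l) \<in> labelled_edges y \<longrightarrow> k = l)"

definition edge_label :: "placed set \<Rightarrow> edge \<Rightarrow> nat" where
  "edge_label P e = (THE l. \<exists>x \<in> P. (e, l) \<in> labelled_edges x)"

text \<open>
  The triangle has vertices \<open>(0, 0)\<close>, \<open>(n, 0)\<close>, \<open>(0, n)\<close>. The rhombus below it has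
  vertices \<open>(0, 0)\<close>, \<open>(n, 0)\<close>, \<open>(n, -n)\<close>, \<open>(0, -n)\<close>.
\<close>

definition triangle :: "nat \<Rightarrow> cell set" where
  "triangle n = {Upw a b | a b. 0 \<le> a \<and> 0 \<le> b \<and> a + b \<le> int n - 1}
     \<union> {Dnw a b | a b. 0 \<le> a \<and> 0 \<le> b \<and> a + b \<le> int n - 2}"

definition rhombus :: "nat \<Rightarrow> cell set" where
  "rhombus n = {Upw a b | a b. 0 \<le> a \<and> a < int n \<and> - int n \<le> b \<and> b < 0}
     \<union> {Dnw a b | a b. 0 \<le> a \<and> a < int n \<and> - int n \<le> b \<and> b < 0}"

definition trapezoid :: "nat \<Rightarrow> cell set" where
  "trapezoid n = triangle n \<union> rhombus n"

text \<open>
  Boundary sides in the order in which their words are read: NE from top to bottom, NW from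
  bottom to top, horizontal sides (at height \<open>h\<close>) from left to right.
\<close>

definition NE_side :: "nat \<Rightarrow> edge list" where
  "NE_side n = map (\<lambda>a. Fall a (int n - 1 - a)) [0..int n - 1]"

definition NW_side :: "nat \<Rightarrow> edge list" where
  "NW_side n = map (\<lambda>b. Rise 0 b) [0..int n - 1]"

definition horizontal_side :: "nat \<Rightarrow> int \<Rightarrow> edge list" where
  "horizontal_side n h = map (\<lambda>a. Hor a h) [0..int n - 1]"

text \<open>
  For each 1 of the word, from left to right, the number of zeros to the right of it.
\<close>

definition word_partition :: "nat list \<Rightarrow> nat list" where
  "word_partition w =
     map (\<lambda>p. count_list (drop (p + 1) w) 0) (filter (\<lambda>p. w ! p = 1) [0..<length w])"

definition side_partition :: "placed set \<Rightarrow> edge list \<Rightarrow> nat list" where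
  "side_partition P es = word_partition (map (edge_label P) es)"

definition LP_plus :: "nat \<Rightarrow> nat list \<Rightarrow> nat list \<Rightarrow> nat list \<Rightarrow> placed set set" where
  "LP_plus n lam mu nu = {P. tiling (triangle n) P \<and>
     side_partition P (NE_side n) = lam \<and>
     side_partition P (NW_side n) = mu \<and>
     side_partition P (horizontal_side n 0) = nu}"

definition LP :: "nat \<Rightarrow> nat list \<Rightarrow> nat list \<Rightarrow> nat list \<Rightarrow> placed set set" where
  "LP n lam mu nu = {P. tiling (trapezoid n) P \<and>
     (\<forall>b \<in> {- int n..- 1}. edge_label P (Rise 0 b) = 0 \<and> edge_label P (Rise (int n) b) = 0) \<and>
     side_partition P (NE_side n) = lam \<and>
     side_partition P (NW_side n) = mu \<and>
     side_partition P (horizontal_side n (- int n)) = nu}"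

text \<open>
  An equivariant piece at position \<open>(a, b)\<close> has its center at \<open>(a + 1/2, b)\<close>. The line through
  it in direction \<open>e\<^sub>2\<close> meets the line \<open>b = 0\<close> at \<open>a + 1/2\<close>, and the line through it parallel
  to the NE side does so at \<open>a + b + 1/2\<close>; the right endpoint of D is at \<open>n\<close>.
\<close>

definition line_e :: "nat \<Rightarrow> placed \<Rightarrow> int" where
  "line_e n x = (case x of (p, a, b) \<Rightarrow> int n - a)"

definition line_f :: "nat \<Rightarrow> placed \<Rightarrow> int" where
  "line_f n x = (case x of (p, a, b) \<Rightarrow> int n - (a + b))"

definition equivariant_pieces :: "placed set \<Rightarrow> placed multiset" where
  "equivariant_pieces P = mset_set {x \<in> P. fst x = Equiv}"

definition puzzle_c :: "nat \<Rightarrow> placed set \<Rightarrow> expr" where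
  "puzzle_c n P = image_mset (\<lambda>x. (line_e n x, line_f n x)) (equivariant_pieces P)"

definition puzzle_C :: "nat \<Rightarrow> placed set \<Rightarrow> expr" where
  "puzzle_C n P = image_mset (\<lambda>x. (int n + 1 - line_f n x, int n + 1 - line_e n x))
     (equivariant_pieces P)"

text \<open>
  The inclusion of puzzles into trapezoid puzzles; D is the row of edges \<open>Hor a 0\<close>.
\<close>

definition strip_embed :: "nat \<Rightarrow> placed set \<Rightarrow> placed set" where
  "strip_embed n P = P
     \<union> {(RhHR, a, b) | a b. 0 \<le> a \<and> a < int n \<and> - int n \<le> b \<and> b < 0 \<and>
          edge_label P (Hor a 0) = 1}
     \<union> {(q, a, b) | q a b. q \<in> {Up0, Dn0} \<and> 0 \<le> a \<and> a < int n \<and> - int n \<le> b \<and> b < 0 \<and>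
          edge_label P (Hor a 0) = 0}"


section \<open>The map on puzzles\<close>

text \<open>
  The edges through which a path enters and leaves a piece (paths cannot pass through the
  remaining three pieces).
\<close>

fun entry_edge :: "placed \<Rightarrow> edge option" where
  "entry_edge (RhHF, a, b) = Some (Fall a b)"
| "entry_edge (Equiv, a, b) = Some (Fall a b)"
| "entry_edge (Up1, a, b) = Some (Fall a b)"
| "entry_edge (RhHR, a, b) = Some (Hor a (b + 1))"
| "entry_edge (Dn1, a, b) = Some (Hor a (b + 1))"
| "entry_edge _ = None"

fun exit_edge :: "placed \<Rightarrow> edge option" where
  "exit_edge (RhHF, a, b) = Some (Fall (a - 1) b)"
| "exit_edge (Equiv, a, b) = Some (Fall a (b - 1))"
| "exit_edge (Up1, a, b) = Some (Hor a b)"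
| "exit_edge (RhHR, a, b) = Some (Hor a b)"
| "exit_edge (Dn1, a, b) = Some (Fall a b)"
| "exit_edge _ = None"

fun path_from_to :: "placed set \<Rightarrow> edge \<Rightarrow> placed list \<Rightarrow> edge \<Rightarrow> bool" where
  "path_from_to P e [] f \<longleftrightarrow> e = f"
| "path_from_to P e (x # xs) f \<longleftrightarrow>
     x \<in> P \<and> entry_edge x = Some e \<and> (\<exists>g. exit_edge x = Some g \<and> path_from_to P g xs f)"

definition path :: "nat \<Rightarrow> placed set \<Rightarrow> nat \<Rightarrow> placed list" where
  "path n P i = (THE xs. \<exists>f \<in> set (horizontal_side n 0).
     path_from_to P (filter (\<lambda>e. edge_label P e = 1) (NE_side n) ! (i - 1)) xs f)"

text \<open>
  The part of a path after its \<open>(j - 1)\<close>-st downward 1-triangle (the whole path if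
  \<open>j = 1\<close>) and before the next upward 1-triangle, where \<open>j \<ge> 1\<close>.
\<close>

definition segment :: "placed list \<Rightarrow> nat \<Rightarrow> placed list" where
  "segment xs j = takeWhile (\<lambda>x. fst x \<noteq> Up1)
     (((\<lambda>ys. tl (dropWhile (\<lambda>x. fst x \<noteq> Dn1) ys)) ^^ (j - 1)) xs)"

text \<open>
  Read from right to left, the values in a row of \<open>\<mu>\<close> weakly decrease, so the entries of
  value \<open>i\<close> are listed for \<open>i\<close> from \<open>d + 1 - r\<close> down to 1.
\<close>

definition mu_row :: "nat \<Rightarrow> nat \<Rightarrow> placed set \<Rightarrow> nat \<Rightarrow> entry list" where
  "mu_row d n P r = concat (map
     (\<lambda>i. map (\<lambda>x. (i, fst x = Equiv)) (segment (path n P i) (d + 2 - i - r)))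
     (rev [1..<d + 2 - r]))"

definition Phi :: "nat \<Rightarrow> nat \<Rightarrow> nat list \<Rightarrow> placed set \<Rightarrow> filling" where
  "Phi d n lam P =
     (map (\<lambda>i. replicate (lam ! (i - 1)) i) [1..<d + 1], map (mu_row d n P) [1..<d + 1])"

end

theory Submission
  imports Defs
begin

text \<open>
  Label also the edges in the interior of the rhombi; then a tiling is the same as a labelling that
  satisfies a local condition at every unit triangle. Cut the trapezoid into strips parallel to its
  NE side. The nonzero labels on a line between two strips are the positions of the \<open>d\<close> paths, and a
  strip is determined by the labels on its two sides. Hence a trapezoid puzzle amounts to its path
  positions \<open>x i t\<close> together with the numbers \<open>u i t\<close> of upward 1-triangles that path \<open>i\<close> has met
  before line \<open>t\<close>; below the strips of full length everything is forced. The array \<open>u\<close> is an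
  interlacing pattern of the same kind as the one given by the entries at least \<open>i\<close> in the rows of a
  tableau, a path moves left exactly at the unbarred entries, and the condition that paths do not
  cross is the Yamanouchi condition, because for entries of equal or consecutive values the order of
  the strips is the reading order.
\<close>

section \<open>Tilings as labellings\<close>

text \<open>The labels 2 and 3 are kept apart because \<open>RhRF\<close> and \<open>Equiv\<close>
  have the same diagonal, so that with one common label the halves of different rhombi could be
  glued; the diagonals of \<open>RhHF\<close> and \<open>RhHR\<close> have other directions. Row
  \<open>r\<close> of the tableau (counted from 0) is spread over the paths \<open>d - r\<close>,
  ..., 1. Path \<open>d - r\<close> begins it in strip 0. When path \<open>i + 1\<close> meets the
  upward 1-triangle that ends its share, path \<open>i\<close> meets in the same strip the downward
  1-triangle that begins its own share, and this strip yields no box. Hence an entry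
  \<open>i\<close> in row \<open>r\<close> and column \<open>c\<close> follows
  \<open>d - i - r\<close> handovers and comes from strip \<open>c + (d - i - r)\<close>. The row
  ends at an upward 1-triangle of path 1, that is, at an edge labelled 1 on the NW side; this is how
  \<open>mu\<close> enters. In a trapezoid puzzle shares may continue below D, where the paths of
  \<open>Phi\<close> have already ended. The bijection is therefore not built by following paths:
  puzzle and tableau are related through a common pattern, and the agreement with \<open>Phi\<close>
  is a separate computation.\<close>

text \<open>
  Edges in the interior of a rhombus get the label 2, or 3 for the equivariant piece; \<open>legal h r f\<close>
  is the condition on the horizontal, rising and falling edge of a unit triangle of either kind.
\<close>

definition legal :: "nat \<Rightarrow> nat \<Rightarrow> nat \<Rightarrow> bool" where
  "legal h r f \<longleftrightarrow>
     (h, r, f) \<in> {(0, 0, 0), (1, 1, 1), (0, 2, 1), (1, 0, 2), (2, 1, 0), (3, 0, 1)}"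

text \<open>Opposite sides of a rhombus have equal labels, so its two halves carry the same triple
  (horizontal, rising, falling) and one triple per piece suffices.\<close>

fun code :: "piece \<Rightarrow> nat \<times> nat \<times> nat" where
  "code Up0 = (0, 0, 0)"
| "code Up1 = (1, 1, 1)"
| "code Dn0 = (0, 0, 0)"
| "code Dn1 = (1, 1, 1)"
| "code RhHF = (0, 2, 1)"
| "code RhHR = (1, 0, 2)"
| "code RhRF = (2, 1, 0)"
| "code Equiv = (3, 0, 1)"

definition up_labels :: "(edge \<Rightarrow> nat) \<Rightarrow> int \<Rightarrow> int \<Rightarrow> nat \<times> nat \<times> nat" where
  "up_labels l a b = (l (Hor a b), l (Rise a b), l (Fall a b))"

definition dn_labels :: "(edge \<Rightarrow> nat) \<Rightarrow> int \<Rightarrow> int \<Rightarrow> nat \<times> nat \<times> nat" where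
  "dn_labels l a b = (l (Hor a (b + 1)), l (Rise (a + 1) b), l (Fall a b))"

text \<open>The last three clauses concern edges with only one side in \<open>R\<close>: a label of
  2 or more there would be the diagonal of a rhombus that sticks out of the region.\<close>

definition proper :: "cell set \<Rightarrow> (edge \<Rightarrow> nat) \<Rightarrow> bool" where
  "proper R l \<longleftrightarrow>
     (\<forall>a b. Upw a b \<in> R \<longrightarrow> legal (l (Hor a b)) (l (Rise a b)) (l (Fall a b))) \<and>
     (\<forall>a b. Dnw a b \<in> R \<longrightarrow> legal (l (Hor a (b + 1))) (l (Rise (a + 1) b)) (l (Fall a b))) \<and>
     (\<forall>a b. (Upw a b \<in> R) \<noteq> (Dnw a (b - 1) \<in> R) \<longrightarrow> l (Hor a b) \<le> 1) \<and>
     (\<forall>a b. (Upw a b \<in> R) \<noteq> (Dnw (a - 1) b \<in> R) \<longrightarrow> l (Rise a b) \<le> 1) \<and>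
     (\<forall>a b. (Upw a b \<in> R) \<noteq> (Dnw a b \<in> R) \<longrightarrow> l (Fall a b) \<le> 1)"

text \<open>A rhombus is recorded at its upward triangle only, in accordance with the convention for
  positions; that its downward half fits is a consequence of \<open>proper\<close>.\<close>

definition pieces :: "cell set \<Rightarrow> (edge \<Rightarrow> nat) \<Rightarrow> placed set" where
  "pieces R l = {(p, a, b) | p a b.
     if p \<in> {Dn0, Dn1} then Dnw a b \<in> R \<and> dn_labels l a b = code p
     else Upw a b \<in> R \<and> up_labels l a b = code p}"

lemma pieces_simps:
  "(Up0, a, b) \<in> pieces R l \<longleftrightarrow> Upw a b \<in> R \<and> l (Hor a b) = 0 \<and> l (Rise a b) = 0 \<and> l (Fall a b) = 0"
  "(Up1, a, b) \<in> pieces R l \<longleftrightarrow> Upw a b \<in> R \<and> l (Hor a b) = 1 \<and> l (Rise a b) = 1 \<and> l (Fall a b) = 1"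
  "(RhHF, a, b) \<in> pieces R l \<longleftrightarrow> Upw a b \<in> R \<and> l (Hor a b) = 0 \<and> l (Rise a b) = 2 \<and> l (Fall a b) = 1"
  "(RhHR, a, b) \<in> pieces R l \<longleftrightarrow> Upw a b \<in> R \<and> l (Hor a b) = 1 \<and> l (Rise a b) = 0 \<and> l (Fall a b) = 2"
  "(RhRF, a, b) \<in> pieces R l \<longleftrightarrow> Upw a b \<in> R \<and> l (Hor a b) = 2 \<and> l (Rise a b) = 1 \<and> l (Fall a b) = 0"
  "(Equiv, a, b) \<in> pieces R l \<longleftrightarrow> Upw a b \<in> R \<and> l (Hor a b) = 3 \<and> l (Rise a b) = 0 \<and> l (Fall a b) = 1"
  "(Dn0, a, b) \<in> pieces R l \<longleftrightarrow>
     Dnw a b \<in> R \<and> l (Hor a (b + 1)) = 0 \<and> l (Rise (a + 1) b) = 0 \<and> l (Fall a b) = 0"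
  "(Dn1, a, b) \<in> pieces R l \<longleftrightarrow>
     Dnw a b \<in> R \<and> l (Hor a (b + 1)) = 1 \<and> l (Rise (a + 1) b) = 1 \<and> l (Fall a b) = 1"
  by (auto simp: pieces_def up_labels_def dn_labels_def)

lemma properD:
  assumes "proper R l"
  shows "Upw a b \<in> R \<Longrightarrow> legal (l (Hor a b)) (l (Rise a b)) (l (Fall a b))"
    and "Dnw a b \<in> R \<Longrightarrow> legal (l (Hor a (b + 1))) (l (Rise (a + 1) b)) (l (Fall a b))"
    and "(Upw a b \<in> R) \<noteq> (Dnw a (b - 1) \<in> R) \<Longrightarrow> l (Hor a b) \<le> 1"
    and "(Upw a b \<in> R) \<noteq> (Dnw (a - 1) b \<in> R) \<Longrightarrow> l (Rise a b) \<le> 1"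
    and "(Upw a b \<in> R) \<noteq> (Dnw a b \<in> R) \<Longrightarrow> l (Fall a b) \<le> 1"
  using assms unfolding proper_def by blast+

lemma legal_cases:
  assumes "legal h r f"
  obtains "h = 0" "r = 0" "f = 0" | "h = 1" "r = 1" "f = 1" | "h = 0" "r = 2" "f = 1"
    | "h = 1" "r = 0" "f = 2" | "h = 2" "r = 1" "f = 0" | "h = 3" "r = 0" "f = 1"
  using assms unfolding legal_def by fastforce

text \<open>Only the downward half of a rhombus needs an argument. The diagonal has label at least
  2, so it is not a boundary edge; the triangle across it lies in \<open>R\<close> and is legal, and
  the label of the diagonal leaves only one legal triple.\<close>

lemma pieces_labels:
  assumes "proper R l" "x \<in> pieces R l" "(e, k) \<in> labelled_edges x"
  shows "k = l e"
proof -
  obtain p a b where x: "x = (p, a, b)" by (cases x)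
  note L = properD[OF assms(1)]
  show ?thesis
  proof (cases p)
    case RhHF
    then have u: "Upw a b \<in> R" "l (Rise a b) = 2" using assms(2) x by (auto simp: pieces_simps)
    then have "Dnw (a - 1) b \<in> R" using L(4)[of a b] by auto
    from L(2)[OF this] u show ?thesis
      using assms(2,3) x RhHF by (auto simp: pieces_simps elim!: legal_cases)
  next
    case RhHR
    then have u: "Upw a b \<in> R" "l (Fall a b) = 2" using assms(2) x by (auto simp: pieces_simps)
    then have "Dnw a b \<in> R" using L(5)[of a b] by auto
    from L(2)[OF this] u show ?thesis
      using assms(2,3) x RhHR by (auto simp: pieces_simps elim!: legal_cases)
  next
    case RhRF
    then have u: "Upw a b \<in> R" "l (Hor a b) = 2" using assms(2) x by (auto simp: pieces_simps)
    then have "Dnw a (b - 1) \<in> R" using L(3)[of a b] by auto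
    from L(2)[OF this] u show ?thesis
      using assms(2,3) x RhRF by (auto simp: pieces_simps elim!: legal_cases)
  next
    case Equiv
    then have u: "Upw a b \<in> R" "l (Hor a b) = 3" using assms(2) x by (auto simp: pieces_simps)
    then have "Dnw a (b - 1) \<in> R" using L(3)[of a b] by auto
    from L(2)[OF this] u show ?thesis
      using assms(2,3) x Equiv by (auto simp: pieces_simps elim!: legal_cases)
  qed (use assms(2,3) x in \<open>auto simp: pieces_simps\<close>)
qed

lemma cells_pieces:
  assumes "proper R l" "x \<in> pieces R l"
  shows "cells x \<subseteq> R"
proof -
  obtain p a b where x: "x = (p, a, b)" by (cases x)
  note L = properD[OF assms(1)]
  show ?thesis
    using assms(2) x L(3)[of a b] L(4)[of a b] L(5)[of a b]
    by (cases p) (auto simp: pieces_simps)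
qed

lemma Upw_in_cells:
  "Upw a b \<in> cells x \<longleftrightarrow> x \<in> {(Up0, a, b), (Up1, a, b), (RhHF, a, b), (RhHR, a, b), (RhRF, a, b), (Equiv, a, b)}"
proof -
  obtain p a' b' where x: "x = (p, a', b')" by (cases x)
  show ?thesis unfolding x by (cases p) auto
qed

lemma Dnw_in_cells:
  "Dnw a b \<in> cells x \<longleftrightarrow>
     x \<in> {(Dn0, a, b), (Dn1, a, b), (RhHF, a + 1, b), (RhHR, a, b), (RhRF, a, b + 1), (Equiv, a, b + 1)}"
proof -
  obtain p a' b' where x: "x = (p, a', b')" by (cases x)
  show ?thesis unfolding x by (cases p) auto
qed

lemma tiling_pieces:
  assumes "proper R l"
  shows "tiling R (pieces R l)"
proof -
  note L = properD[OF assms]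
  have "\<exists>!x. x \<in> pieces R l \<and> t \<in> cells x" if t: "t \<in> R" for t
  proof (cases t)
    case (Upw a b)
    with t have "Upw a b \<in> R" by simp
    note u = this
    from L(1)[OF u] show ?thesis
    proof (cases rule: legal_cases)
      case 1 then show ?thesis using u
        by (intro ex1I[of _ "(Up0, a, b)"]) (auto simp: pieces_simps Upw Upw_in_cells)
    next
      case 2 then show ?thesis using u
        by (intro ex1I[of _ "(Up1, a, b)"]) (auto simp: pieces_simps Upw Upw_in_cells)
    next
      case 3 then show ?thesis using u
        by (intro ex1I[of _ "(RhHF, a, b)"]) (auto simp: pieces_simps Upw Upw_in_cells)
    next
      case 4 then show ?thesis using u
        by (intro ex1I[of _ "(RhHR, a, b)"]) (auto simp: pieces_simps Upw Upw_in_cells)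
    next
      case 5 then show ?thesis using u
        by (intro ex1I[of _ "(RhRF, a, b)"]) (auto simp: pieces_simps Upw Upw_in_cells)
    next
      case 6 then show ?thesis using u
        by (intro ex1I[of _ "(Equiv, a, b)"]) (auto simp: pieces_simps Upw Upw_in_cells)
    qed
  next
    case (Dnw a b)
    with t have D: "Dnw a b \<in> R" by simp
    \<comment> \<open>A downward triangle with a diagonal among its edges is the second half of a
      rhombus; these three facts supply the first half, on which the piece is recorded.\<close>
    have r: "Upw (a + 1) b \<in> R \<and> legal (l (Hor (a + 1) b)) (l (Rise (a + 1) b)) (l (Fall (a + 1) b))"
      if "l (Rise (a + 1) b) = 2"
      using L(4)[of "a + 1" b] L(1)[of "a + 1" b] that D by auto
    have h: "Upw a (b + 1) \<in> R \<and> legal (l (Hor a (b + 1))) (l (Rise a (b + 1))) (l (Fall a (b + 1)))"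
      if "l (Hor a (b + 1)) \<ge> 2"
      using L(3)[of a "b + 1"] L(1)[of a "b + 1"] that D by auto
    have f: "Upw a b \<in> R \<and> legal (l (Hor a b)) (l (Rise a b)) (l (Fall a b))"
      if "l (Fall a b) = 2"
      using L(5)[of a b] L(1)[of a b] that D by auto
    from L(2)[OF D] show ?thesis
    proof (cases rule: legal_cases)
      case 1 then show ?thesis using D
        by (intro ex1I[of _ "(Dn0, a, b)"]) (auto simp: pieces_simps Dnw Dnw_in_cells elim!: legal_cases)
    next
      case 2 then show ?thesis using D
        by (intro ex1I[of _ "(Dn1, a, b)"]) (auto simp: pieces_simps Dnw Dnw_in_cells elim!: legal_cases)
    next
      case 3 then show ?thesis using r
        by (intro ex1I[of _ "(RhHF, a + 1, b)"]) (auto simp: pieces_simps Dnw Dnw_in_cells elim!: legal_cases)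
    next
      case 4 then show ?thesis using f
        by (intro ex1I[of _ "(RhHR, a, b)"]) (auto simp: pieces_simps Dnw Dnw_in_cells elim!: legal_cases)
    next
      case 5 then show ?thesis using h
        by (intro ex1I[of _ "(RhRF, a, b + 1)"]) (auto simp: pieces_simps Dnw Dnw_in_cells elim!: legal_cases)
    next
      case 6 then show ?thesis using h
        by (intro ex1I[of _ "(Equiv, a, b + 1)"]) (auto simp: pieces_simps Dnw Dnw_in_cells elim!: legal_cases)
    qed
  qed
  moreover have "cells x \<subseteq> R" if "x \<in> pieces R l" for x
    using cells_pieces[OF assms that] .
  moreover have "k = m" if "x \<in> pieces R l" "y \<in> pieces R l" "(e, k) \<in> labelled_edges x" "(e, m) \<in> labelled_edges y" for x y e k m
    using pieces_labels[OF assms] that by metis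
  ultimately show ?thesis unfolding tiling_def by blast
qed

text \<open>A diagonal is not an edge of any piece, so \<open>edge_label\<close> gives no
  information there and the label is read off the rhombus around it.\<close>

fun labelling :: "placed set \<Rightarrow> edge \<Rightarrow> nat" where
  "labelling P (Hor a b) =
     (if (RhRF, a, b) \<in> P then 2 else if (Equiv, a, b) \<in> P then 3 else edge_label P (Hor a b))"
| "labelling P (Rise a b) = (if (RhHF, a, b) \<in> P then 2 else edge_label P (Rise a b))"
| "labelling P (Fall a b) = (if (RhHR, a, b) \<in> P then 2 else edge_label P (Fall a b))"

lemma edge_label_labelling: "labelling P e \<le> 1 \<Longrightarrow> edge_label P e = labelling P e"
  by (cases e) (auto split: if_splits)

lemma tiling_unique:
  assumes "tiling R P" "x \<in> P" "y \<in> P" "c \<in> cells x" "c \<in> cells y"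
  shows "x = y"
proof -
  have "c \<in> R" using assms unfolding tiling_def by blast
  then show ?thesis using assms unfolding tiling_def by blast
qed

lemma edge_label_eq:
  assumes "tiling R P" "x \<in> P" "(e, k) \<in> labelled_edges x"
  shows "edge_label P e = k"
  unfolding edge_label_def
proof (rule the_equality)
  fix l assume "\<exists>x\<in>P. (e, l) \<in> labelled_edges x"
  then show "l = k" using assms unfolding tiling_def by metis
qed (use assms in blast)

text \<open>An edge of a piece is not a diagonal of a rhombus in the tiling: that rhombus contains
  the triangles on both sides of the edge, so it would share a triangle with the piece and coincide
  with it, but a diagonal is not among the labelled edges.\<close>

lemma labelling_eq:
  assumes "tiling R P" "x \<in> P" "(e, k) \<in> labelled_edges x"
  shows "labelling P e = k"
proof -
  obtain p a b where x: "x = (p, a, b)" by (cases x)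
  note U = tiling_unique[OF assms(1,2)]
  note E = edge_label_eq[OF assms]
  show ?thesis
  proof (cases e)
    case (Hor c d)
    have "Upw c d \<in> cells x \<or> Dnw c (d - 1) \<in> cells x"
      using assms(3) x Hor by (cases p) auto
    then have "(RhRF, c, d) \<in> P \<Longrightarrow> x = (RhRF, c, d)" "(Equiv, c, d) \<in> P \<Longrightarrow> x = (Equiv, c, d)"
      using U[of "(RhRF, c, d)"] U[of "(Equiv, c, d)"] by auto
    then show ?thesis using E Hor assms(3) by auto
  next
    case (Rise c d)
    have "Upw c d \<in> cells x \<or> Dnw (c - 1) d \<in> cells x"
      using assms(3) x Rise by (cases p) auto
    then have "(RhHF, c, d) \<in> P \<Longrightarrow> x = (RhHF, c, d)"
      using U[of "(RhHF, c, d)"] by auto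
    then show ?thesis using E Rise assms(3) by auto
  next
    case (Fall c d)
    have "Upw c d \<in> cells x \<or> Dnw c d \<in> cells x"
      using assms(3) x Fall by (cases p) auto
    then have "(RhHR, c, d) \<in> P \<Longrightarrow> x = (RhHR, c, d)"
      using U[of "(RhHR, c, d)"] by auto
    then show ?thesis using E Fall assms(3) by auto
  qed
qed

lemma tiling_Upw:
  assumes "tiling R P" "Upw a b \<in> R"
  obtains p where "p \<in> {Up0, Up1, RhHF, RhHR, RhRF, Equiv}" "(p, a, b) \<in> P"
    "up_labels (labelling P) a b = code p"
proof -
  obtain x where x: "x \<in> P" "Upw a b \<in> cells x" using assms unfolding tiling_def by blast
  note U = tiling_unique[OF assms(1) _ x(1) _ x(2)]
  from x(2) obtain p where p: "p \<in> {Up0, Up1, RhHF, RhHR, RhRF, Equiv}" "x = (p, a, b)"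
    unfolding Upw_in_cells by auto
  have E: "labelling P e = k" if "(e, k) \<in> labelled_edges x" for e k
    by (rule labelling_eq[OF assms(1) x(1) that])
  \<comment> \<open>\<open>labelling\<close> tests for \<open>RhRF\<close> before
    \<open>Equiv\<close>, so it must be excluded that both sit at this position.\<close>
  have N: "(RhRF, a, b) \<in> P \<Longrightarrow> p = RhRF" "(Equiv, a, b) \<in> P \<Longrightarrow> p = Equiv"
    using U[of "(RhRF, a, b)"] U[of "(Equiv, a, b)"] p by auto
  have "up_labels (labelling P) a b = code p"
    using p(1) E[unfolded p(2)] x(1)[unfolded p(2)] N
    by (auto simp: up_labels_def simp del: labelling.simps) auto
  with that p x show ?thesis by blast
qed

lemma tiling_Dnw:
  assumes "tiling R P" "Dnw a b \<in> R"
  obtains (Dn0) "(Dn0, a, b) \<in> P" "dn_labels (labelling P) a b = code Dn0"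
    | (Dn1) "(Dn1, a, b) \<in> P" "dn_labels (labelling P) a b = code Dn1"
    | (RhHF) "(RhHF, a + 1, b) \<in> P" "dn_labels (labelling P) a b = code RhHF"
    | (RhHR) "(RhHR, a, b) \<in> P" "dn_labels (labelling P) a b = code RhHR"
    | (RhRF) "(RhRF, a, b + 1) \<in> P" "dn_labels (labelling P) a b = code RhRF"
    | (Equiv) "(Equiv, a, b + 1) \<in> P" "dn_labels (labelling P) a b = code Equiv"
proof -
  obtain x where x: "x \<in> P" "Dnw a b \<in> cells x" using assms unfolding tiling_def by blast
  have E: "labelling P e = k" if "(e, k) \<in> labelled_edges x" for e k
    by (rule labelling_eq[OF assms(1) x(1) that])
  have N: "(Equiv, a, b + 1) \<in> P \<Longrightarrow> (RhRF, a, b + 1) \<notin> P"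
    using tiling_unique[OF assms(1), of "(Equiv, a, b + 1)" "(RhRF, a, b + 1)" "Upw a (b + 1)"] by auto
  from x(2) show ?thesis unfolding Dnw_in_cells
    using x(1) E that N by (auto simp: dn_labels_def simp del: labelling.simps) auto
qed

text \<open>Both halves of a rhombus of a tiling lie in \<open>R\<close>, so a boundary edge is
  never a diagonal and carries the label 0 or 1 of a genuine edge of a piece.\<close>

lemma labelling_proper:
  assumes "tiling R P"
  shows "proper R (labelling P)"
proof -
  let ?l = "labelling P"
  have up: "legal (?l (Hor a b)) (?l (Rise a b)) (?l (Fall a b))" if "Upw a b \<in> R" for a b
    by (rule tiling_Upw[OF assms that]) (auto simp: legal_def up_labels_def simp del: labelling.simps)
  have dn: "legal (?l (Hor a (b + 1))) (?l (Rise (a + 1) b)) (?l (Fall a b))" if "Dnw a b \<in> R" for a b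
    by (rule tiling_Dnw[OF assms that]) (auto simp: legal_def dn_labels_def simp del: labelling.simps)
  have sub: "cells x \<subseteq> R" if "x \<in> P" for x using assms that unfolding tiling_def by blast
  have "?l (Hor a b) \<le> 1" if "(Upw a b \<in> R) \<noteq> (Dnw a (b - 1) \<in> R)" for a b
  proof -
    have "legal (?l (Hor a b)) (?l (Rise a b)) (?l (Fall a b)) \<or>
          legal (?l (Hor a b)) (?l (Rise (a + 1) (b - 1))) (?l (Fall a (b - 1)))"
      using that up[of a b] dn[of a "b - 1"] by auto
    moreover have "(RhRF, a, b) \<notin> P" "(Equiv, a, b) \<notin> P"
      using that sub[of "(RhRF, a, b)"] sub[of "(Equiv, a, b)"] by auto
    then have "?l (Hor a b) = edge_label P (Hor a b)" by simp
    moreover have "edge_label P (Hor a b) \<le> 1"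
    proof -
      from that have "\<exists>x \<in> P. Upw a b \<in> cells x \<or> Dnw a (b - 1) \<in> cells x"
        using assms unfolding tiling_def by blast
      then obtain x where "x \<in> P" "Upw a b \<in> cells x \<or> Dnw a (b - 1) \<in> cells x" by blast
      then have "\<exists>k \<le> 1. (Hor a b, k) \<in> labelled_edges x"
        using \<open>(RhRF, a, b) \<notin> P\<close> \<open>(Equiv, a, b) \<notin> P\<close>
        unfolding Upw_in_cells Dnw_in_cells by auto
      then show ?thesis using edge_label_eq[OF assms \<open>x \<in> P\<close>] by auto
    qed
    ultimately show ?thesis by simp
  qed
  moreover have "?l (Rise a b) \<le> 1" if "(Upw a b \<in> R) \<noteq> (Dnw (a - 1) b \<in> R)" for a b
  proof -
    have "(RhHF, a, b) \<notin> P" using that sub[of "(RhHF, a, b)"] by auto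
    moreover have "legal (?l (Hor a b)) (?l (Rise a b)) (?l (Fall a b)) \<or>
          legal (?l (Hor (a - 1) (b + 1))) (?l (Rise a b)) (?l (Fall (a - 1) b))"
      using that up[of a b] dn[of "a - 1" b] by auto
    moreover have "edge_label P (Rise a b) \<le> 1"
    proof -
      from that have "\<exists>x \<in> P. Upw a b \<in> cells x \<or> Dnw (a - 1) b \<in> cells x"
        using assms unfolding tiling_def by blast
      then obtain x where "x \<in> P" "Upw a b \<in> cells x \<or> Dnw (a - 1) b \<in> cells x" by blast
      then have "\<exists>k \<le> 1. (Rise a b, k) \<in> labelled_edges x"
        using \<open>(RhHF, a, b) \<notin> P\<close>
        unfolding Upw_in_cells Dnw_in_cells by auto
      then show ?thesis using edge_label_eq[OF assms \<open>x \<in> P\<close>] by auto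
    qed
    ultimately show ?thesis by simp
  qed
  moreover have "?l (Fall a b) \<le> 1" if "(Upw a b \<in> R) \<noteq> (Dnw a b \<in> R)" for a b
  proof -
    have "(RhHR, a, b) \<notin> P" using that sub[of "(RhHR, a, b)"] by auto
    moreover have "edge_label P (Fall a b) \<le> 1"
    proof -
      from that have "\<exists>x \<in> P. Upw a b \<in> cells x \<or> Dnw a b \<in> cells x"
        using assms unfolding tiling_def by blast
      then obtain x where "x \<in> P" "Upw a b \<in> cells x \<or> Dnw a b \<in> cells x" by blast
      then have "\<exists>k \<le> 1. (Fall a b, k) \<in> labelled_edges x"
        using \<open>(RhHR, a, b) \<notin> P\<close>
        unfolding Upw_in_cells Dnw_in_cells by auto
      then show ?thesis using edge_label_eq[OF assms \<open>x \<in> P\<close>] by auto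
    qed
    ultimately show ?thesis by simp
  qed
  ultimately show ?thesis unfolding proper_def using up dn by blast
qed

text \<open>\<open>Dn0\<close> and \<open>Dn1\<close> share their codes with \<open>Up0\<close> and
  \<open>Up1\<close> and have to be excluded.\<close>

lemma code_inj:
  "p \<notin> {Dn0, Dn1} \<Longrightarrow> q \<notin> {Dn0, Dn1} \<Longrightarrow> code p = code q \<Longrightarrow> p = q"
  by (cases p; cases q) auto

lemma pieces_labelling:
  assumes "tiling R P"
  shows "pieces R (labelling P) = P"
proof -
  have sub: "cells x \<subseteq> R" if "x \<in> P" for x using assms that unfolding tiling_def by blast
  have "(p, a, b) \<in> pieces R (labelling P) \<longleftrightarrow> (p, a, b) \<in> P" for p a b
  proof (cases "p \<in> {Dn0, Dn1}")
    case True
    have 1: "(p, a, b) \<in> pieces R (labelling P) \<longleftrightarrow> Dnw a b \<in> R \<and> dn_labels (labelling P) a b = code p"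
      using True by (auto simp: pieces_def)
    have 2: "cells (p, a, b) = {Dnw a b}" using True by auto
    have U: "x = (p, a, b)" if "x \<in> P" "(p, a, b) \<in> P" "Dnw a b \<in> cells x" for x
      using tiling_unique[OF assms that(1,2,3)] 2 by simp
    show ?thesis
    proof
      assume "(p, a, b) \<in> pieces R (labelling P)"
      then have "Dnw a b \<in> R" "dn_labels (labelling P) a b = code p" using 1 by auto
      from tiling_Dnw[OF assms this(1)] this(2) True show "(p, a, b) \<in> P"
        by cases auto
    next
      assume P: "(p, a, b) \<in> P"
      then have D: "Dnw a b \<in> R" using sub 2 by blast
      from assms D have "dn_labels (labelling P) a b = code p"
        by (cases rule: tiling_Dnw) (use True U[OF _ P] in fastforce)+
      with D 1 show "(p, a, b) \<in> pieces R (labelling P)" by simp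
    qed
  next
    case False
    have 1: "(p, a, b) \<in> pieces R (labelling P) \<longleftrightarrow> Upw a b \<in> R \<and> up_labels (labelling P) a b = code p"
      using False by (auto simp: pieces_def)
    have 2: "Upw a b \<in> cells (q, a, b)" if "q \<notin> {Dn0, Dn1}" for q using that by (cases q) auto
    show ?thesis
    proof
      assume "(p, a, b) \<in> pieces R (labelling P)"
      then have "Upw a b \<in> R" "up_labels (labelling P) a b = code p" using 1 by auto
      then obtain q where q: "q \<in> {Up0, Up1, RhHF, RhHR, RhRF, Equiv}" "(q, a, b) \<in> P" "code p = code q"
        using tiling_Upw[OF assms] by metis
      then have "p = q" using False by (intro code_inj) auto
      then show "(p, a, b) \<in> P" using q by simp
    next
      assume P: "(p, a, b) \<in> P"
      then have D: "Upw a b \<in> R" using sub 2[OF False] by blast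
      then obtain q where q: "q \<in> {Up0, Up1, RhHF, RhHR, RhRF, Equiv}" "(q, a, b) \<in> P"
        "up_labels (labelling P) a b = code q" by (rule tiling_Upw[OF assms])
      then have "q \<notin> {Dn0, Dn1}" by auto
      from tiling_unique[OF assms q(2) P 2[OF this] 2[OF False]] q(3) D 1
      show "(p, a, b) \<in> pieces R (labelling P)" by simp
    qed
  qed
  then show ?thesis by (auto simp: set_eq_iff)
qed

text \<open>A labelling can be recovered from its pieces only on the edges of triangles of
  \<open>R\<close>; its values elsewhere are arbitrary. Hence the claim is made triangle by
  triangle.\<close>

lemma up_labels_labelling:
  assumes "proper R l" "Upw a b \<in> R"
  shows "up_labels (labelling (pieces R l)) a b = up_labels l a b"
proof -
  obtain p where p: "p \<in> {Up0, Up1, RhHF, RhHR, RhRF, Equiv}" "(p, a, b) \<in> pieces R l"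
    "up_labels (labelling (pieces R l)) a b = code p"
    using tiling_Upw[OF tiling_pieces[OF assms(1)] assms(2)] .
  then show ?thesis by (auto simp: pieces_def)
qed

section \<open>Words and partitions\<close>

text \<open>The position, counted from 0, of the \<open>i\<close>-th one in the word of length
  \<open>n\<close> for \<open>eta\<close>: it is followed by \<open>length eta - i\<close> ones and
  \<open>eta ! (i - 1)\<close> zeros.\<close>

definition pos :: "nat \<Rightarrow> nat list \<Rightarrow> nat \<Rightarrow> int" where
  "pos n eta i = int n - 1 - int (length eta) + int i - int (eta ! (i - 1))"

lemma partitions_nth_mono:
  assumes "eta \<in> partitions d n" "i \<le> j" "j < d"
  shows "eta ! j \<le> eta ! i"
proof (cases "i = j")
  case False
  then show ?thesis using assms unfolding partitions_def
    by (auto simp: sorted_wrt_iff_nth_less)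
qed simp

lemma partitions_nth_le:
  assumes "eta \<in> partitions d n" "j < d"
  shows "eta ! j \<le> n - d"
  using partitions_nth_mono[OF assms(1), of 0 j] assms unfolding partitions_def by auto

lemma pos_less:
  assumes "eta \<in> partitions d n" "1 \<le> i" "i < j" "j \<le> d"
  shows "pos n eta i < pos n eta j"
proof -
  have "eta ! (j - 1) \<le> eta ! (i - 1)"
    using partitions_nth_mono[OF assms(1), of "i - 1" "j - 1"] assms by linarith
  then show ?thesis using assms(3) unfolding pos_def by linarith
qed

lemma pos_bounds:
  assumes "eta \<in> partitions d n" "d \<le> n" "1 \<le> i" "i \<le> d"
  shows "0 \<le> pos n eta i" "pos n eta i < int n"
proof -
  have "eta ! (i - 1) \<le> n - d" "length eta = d"
    using partitions_nth_le[OF assms(1), of "i - 1"] assms unfolding partitions_def by auto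
  then show "0 \<le> pos n eta i" "pos n eta i < int n" using assms(2-4) unfolding pos_def by linarith+
qed

lemma count_list_eq_card: "count_list w v = card {q. q < length w \<and> w ! q = v}"
  by (simp add: count_list_eq_length_filter length_filter_conv_card eq_commute)

lemma count_drop_zero:
  assumes "set w \<subseteq> {0, 1 :: nat}" "m \<le> length w"
  shows "count_list (drop m w) 0 + card {q. m \<le> q \<and> q < length w \<and> w ! q = 1} = length w - m"
proof -
  have "count_list (drop m w) 1 = card {q. m \<le> q \<and> q < length w \<and> w ! q = 1}"
    unfolding count_list_eq_card
    by (rule bij_betw_same_card[of "\<lambda>q. q + m"], rule bij_betw_byWitness[of _ "\<lambda>q. q - m"])
      (use assms(2) in \<open>auto simp: add.commute\<close>)
  moreover have "count_list (drop m w) 0 + count_list (drop m w) 1 = length (drop m w)"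
  proof -
    have "set u \<subseteq> {0, 1 :: nat} \<Longrightarrow> count_list u 0 + count_list u 1 = length u" for u
      by (induction u) auto
    moreover have "set (drop m w) \<subseteq> {0, 1}" using assms(1) set_drop_subset[of m w] by blast
    ultimately show ?thesis by blast
  qed
  ultimately show ?thesis by simp
qed

text \<open>After the one with index \<open>k\<close> the word has
  \<open>word_partition w ! k\<close> zeros and \<open>length ps - 1 - k\<close> ones.\<close>

lemma word_partition_nth:
  assumes "set w \<subseteq> {0, 1}" "ps = filter (\<lambda>p. w ! p = 1) [0..<length w]" "k < length ps"
  shows "word_partition w ! k + (length ps - 1 - k) = length w - 1 - ps ! k"
    and "ps ! k < length w"
proof -
  have sps: "set ps = {p. p < length w \<and> w ! p = 1}" using assms(2) by auto
  have srt: "sorted_wrt (<) ps" using assms(2) by (simp add: sorted_wrt_filter)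
  have "ps ! k \<in> set ps" using assms(3) by simp
  then show lt: "ps ! k < length w" using sps by simp
  have "{q. ps ! k + 1 \<le> q \<and> q < length w \<and> w ! q = 1} = (!) ps ` {k + 1..<length ps}"
  proof -
    have "{q. ps ! k + 1 \<le> q \<and> q < length w \<and> w ! q = 1} = {q \<in> set ps. ps ! k < q}"
      unfolding sps by (auto simp: Suc_le_eq)
    also have "\<dots> = (!) ps ` {k + 1..<length ps}"
    proof safe
      fix q assume "q \<in> set ps" "ps ! k < q"
      then obtain j where j: "j < length ps" "q = ps ! j" by (auto simp: in_set_conv_nth)
      have "k < j"
      proof (rule ccontr)
        assume "\<not> k < j"
        then have "j = k \<or> j < k" by linarith
        then have "j = k \<or> ps ! j < ps ! k" using srt assms(3) by (auto simp: sorted_wrt_iff_nth_less)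
        then show False using j \<open>ps ! k < q\<close> by auto
      qed
      then show "q \<in> (!) ps ` {k + 1..<length ps}" using j by auto
    next
      fix j assume "j \<in> {k + 1..<length ps}"
      then show "ps ! j \<in> set ps" "ps ! k < ps ! j" using srt by (auto simp: sorted_wrt_iff_nth_less)
    qed
    finally show ?thesis .
  qed
  moreover have "inj_on ((!) ps) {k + 1..<length ps}"
    using assms(2) by (auto intro!: inj_on_nth)
  ultimately have "card {q. ps ! k + 1 \<le> q \<and> q < length w \<and> w ! q = 1} = length ps - (k + 1)"
    by (simp add: card_image)
  moreover have "count_list (drop (ps ! k + 1) w) 0 + card {q. ps ! k + 1 \<le> q \<and> q < length w \<and> w ! q = 1}
      = length w - (ps ! k + 1)"
    using lt by (intro count_drop_zero assms) auto
  moreover have "word_partition w ! k = count_list (drop (ps ! k + 1) w) 0"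
    using assms(2,3) unfolding word_partition_def by simp
  ultimately show "word_partition w ! k + (length ps - 1 - k) = length w - 1 - ps ! k" by simp
qed

text \<open>A word is known from the increasing list of positions of its ones, and by
  \<open>word_partition_nth\<close> a partition with \<open>d\<close> parts amounts to such a list
  of \<open>d\<close> positions.\<close>

lemma word_partition_eq_iff:
  assumes "length w = n" "set w \<subseteq> {0, 1}" "eta \<in> partitions d n" "d \<le> n"
  shows "word_partition w = eta \<longleftrightarrow> (\<forall>p<n. w ! p = 1 \<longleftrightarrow> (\<exists>i\<in>{1..d}. int p = pos n eta i))"
proof -
  define ps where "ps = filter (\<lambda>p. w ! p = 1) [0..<length w]"
  have sps: "set ps = {p. p < n \<and> w ! p = 1}" using assms(1) ps_def by auto
  have len: "length (word_partition w) = length ps" by (simp add: word_partition_def ps_def)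
  have leneta: "length eta = d" using assms(3) by (simp add: partitions_def)
  note nth = word_partition_nth[OF assms(2) ps_def, unfolded assms(1)]
  show ?thesis
  proof
    assume "word_partition w = eta"
    then have lps: "length ps = d" and P: "\<And>k. k < d \<Longrightarrow> int (ps ! k) = pos n eta (k + 1)"
      using len leneta nth unfolding pos_def by fastforce+
    have "p \<in> set ps \<longleftrightarrow> (\<exists>i\<in>{1..d}. int p = pos n eta i)" for p
    proof
      assume "p \<in> set ps"
      then obtain k where "k < d" "p = ps ! k" using lps by (auto simp: in_set_conv_nth)
      then show "\<exists>i\<in>{1..d}. int p = pos n eta i" using P[of k] by (intro bexI[of _ "k + 1"]) auto
    next
      assume "\<exists>i\<in>{1..d}. int p = pos n eta i"
      then obtain i where i: "i \<in> {1..d}" "int p = pos n eta i" by blast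
      then have "int p = int (ps ! (i - 1))" using P[of "i - 1"] by auto
      then show "p \<in> set ps" using i lps by auto
    qed
    then show "\<forall>p<n. w ! p = 1 \<longleftrightarrow> (\<exists>i\<in>{1..d}. int p = pos n eta i)" using sps by auto
  next
    assume R: "\<forall>p<n. w ! p = 1 \<longleftrightarrow> (\<exists>i\<in>{1..d}. int p = pos n eta i)"
    define qs where "qs = map (\<lambda>i. nat (pos n eta i)) [1..<d + 1]"
    have lqs: "length qs = d" by (simp add: qs_def)
    have nqs: "int (qs ! k) = pos n eta (k + 1)" if "k < d" for k
      using that pos_bounds[OF assms(3,4), of "k + 1"]
      by (simp add: qs_def nth_upt del: upt_Suc)
    have srt: "sorted_wrt (<) qs" unfolding sorted_wrt_iff_nth_less
    proof (intro allI impI)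
      fix i j assume "i < j" "j < length qs"
      then have "int (qs ! i) < int (qs ! j)"
        using pos_less[OF assms(3), of "i + 1" "j + 1"] nqs lqs by simp
      then show "qs ! i < qs ! j" by simp
    qed
    have "set qs = set ps"
    proof -
      have "p \<in> set qs \<longleftrightarrow> p < n \<and> (\<exists>i\<in>{1..d}. int p = pos n eta i)" for p
      proof
        assume "p \<in> set qs"
        then obtain i where "i \<in> {1..<d + 1}" "p = nat (pos n eta i)"
          unfolding qs_def set_map set_upt by blast
        then show "p < n \<and> (\<exists>i\<in>{1..d}. int p = pos n eta i)"
          using pos_bounds[OF assms(3,4), of i] by auto
      next
        assume "p < n \<and> (\<exists>i\<in>{1..d}. int p = pos n eta i)"
        then obtain i where "i \<in> {1..d}" "p = nat (pos n eta i)" by fastforce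
        then show "p \<in> set qs" by (auto simp: qs_def simp del: upt_Suc)
      qed
      then show ?thesis using R sps by auto
    qed
    moreover have "sorted_wrt (<) ps" using ps_def by (simp add: sorted_wrt_filter)
    ultimately have eq: "ps = qs" using srt
      by (metis strict_sorted_equal)
    show "word_partition w = eta"
    proof (rule nth_equalityI)
      show l: "length (word_partition w) = length eta" using len eq leneta by (simp add: qs_def)
      fix k assume k: "k < length (word_partition w)"
      then have "int (ps ! k) = pos n eta (k + 1)" using eq l leneta nqs by simp
      then show "word_partition w ! k = eta ! k"
        using nth[of k] k len l leneta unfolding pos_def by auto
    qed
  qed
qed

lemma side_partition_iff:
  assumes "\<And>p. p \<in> {0..int n - 1} \<Longrightarrow> edge_label P (e p) \<le> 1" "eta \<in> partitions d n" "d \<le> n"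
  shows "side_partition P (map e [0..int n - 1]) = eta \<longleftrightarrow>
    (\<forall>p\<in>{0..int n - 1}. edge_label P (e p) = 1 \<longleftrightarrow> (\<exists>i\<in>{1..d}. p = pos n eta i))"
proof -
  let ?w = "map (edge_label P) (map e [0..int n - 1])"
  have n: "?w ! p = edge_label P (e (int p))" if "p < n" for p using that by simp
  have "side_partition P (map e [0..int n - 1]) = eta \<longleftrightarrow>
     (\<forall>p<n. edge_label P (e (int p)) = 1 \<longleftrightarrow> (\<exists>i\<in>{1..d}. int p = pos n eta i))"
    unfolding side_partition_def
    by (subst word_partition_eq_iff[OF _ _ assms(2,3)]) (use assms(1) n in \<open>force simp: le_Suc_eq\<close>)+
  also have "\<dots> \<longleftrightarrow> (\<forall>p\<in>{0..int n - 1}. edge_label P (e p) = 1 \<longleftrightarrow> (\<exists>i\<in>{1..d}. p = pos n eta i))"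
    (is "?L = ?R")
  proof
    assume L: ?L
    show ?R
    proof
      fix p assume "p \<in> {0..int n - 1}"
      then have "nat p < n" "int (nat p) = p" by auto
      with L show "edge_label P (e p) = 1 \<longleftrightarrow> (\<exists>i\<in>{1..d}. p = pos n eta i)" by metis
    qed
  qed auto
  finally show ?thesis .
qed

section \<open>Strips of a trapezoid puzzle\<close>

lemma Upw_trapezoid:
  "Upw a b \<in> trapezoid n \<longleftrightarrow> 0 \<le> a \<and> a < int n \<and> - int n \<le> b \<and> a + b \<le> int n - 1"
  by (auto simp: trapezoid_def triangle_def rhombus_def)

lemma Dnw_trapezoid:
  "Dnw a b \<in> trapezoid n \<longleftrightarrow> 0 \<le> a \<and> a < int n \<and> - int n \<le> b \<and> a + b \<le> int n - 2"
  by (auto simp: trapezoid_def triangle_def rhombus_def)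

lemma dn_labels_labelling:
  assumes "proper R l" "Dnw a b \<in> R"
  shows "dn_labels (labelling (pieces R l)) a b = dn_labels l a b"
  using properD(2)[OF assms]
  by (cases rule: tiling_Dnw[OF tiling_pieces[OF assms(1)] assms(2)])
    (auto simp: pieces_simps dn_labels_def elim!: legal_cases simp del: labelling.simps)

text \<open>The words are given by the positions of their ones; that the other labels on these sides
  are 0 follows from \<open>proper\<close>, which bounds boundary labels by 1.\<close>

definition boundary_labels ::
    "nat \<Rightarrow> nat \<Rightarrow> nat list \<Rightarrow> nat list \<Rightarrow> nat list \<Rightarrow> (edge \<Rightarrow> nat) \<Rightarrow> bool" where
  "boundary_labels n d lam mu nu l \<longleftrightarrow>
     (\<forall>b\<in>{- int n..- 1}. l (Rise 0 b) = 0 \<and> l (Rise (int n) b) = 0) \<and>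
     (\<forall>p\<in>{0..int n - 1}. l (Fall p (int n - 1 - p)) = 1 \<longleftrightarrow> (\<exists>i\<in>{1..d}. p = pos n lam i)) \<and>
     (\<forall>p\<in>{0..int n - 1}. l (Rise 0 p) = 1 \<longleftrightarrow> (\<exists>i\<in>{1..d}. p = pos n mu i)) \<and>
     (\<forall>p\<in>{0..int n - 1}. l (Hor p (- int n)) = 1 \<longleftrightarrow> (\<exists>i\<in>{1..d}. p = pos n nu i))"

lemma side_partition_labelling:
  assumes "\<And>p. p \<in> {0..int n - 1} \<Longrightarrow> labelling P (e p) \<le> 1" "eta \<in> partitions d n" "d \<le> n"
  shows "side_partition P (map e [0..int n - 1]) = eta \<longleftrightarrow>
    (\<forall>p\<in>{0..int n - 1}. labelling P (e p) = 1 \<longleftrightarrow> (\<exists>i\<in>{1..d}. p = pos n eta i))"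
proof -
  have eq: "edge_label P (e p) = labelling P (e p)" if "p \<in> {0..int n - 1}" for p
    using assms(1)[OF that] by (rule edge_label_labelling)
  show ?thesis
    by (subst side_partition_iff[OF _ assms(2,3)]) (use assms(1) eq in auto)
qed

lemma LP_iff:
  assumes "d \<le> n" "lam \<in> partitions d n" "mu \<in> partitions d n" "nu \<in> partitions d n"
  shows "P \<in> LP n lam mu nu \<longleftrightarrow>
    tiling (trapezoid n) P \<and> boundary_labels n d lam mu nu (labelling P)"
proof (cases "tiling (trapezoid n) P")
  case True
  let ?l = "labelling P"
  note L = properD[OF labelling_proper[OF True]]
  have w: "?l (Rise 0 b) \<le> 1" if "b \<in> {- int n..int n - 1}" for b
    by (rule L(4)) (use that in \<open>auto simp: Upw_trapezoid Dnw_trapezoid\<close>)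
  have e: "?l (Rise (int n) b) \<le> 1" if "b \<in> {- int n..- 1}" for b
    by (rule L(4)) (use that in \<open>auto simp: Upw_trapezoid Dnw_trapezoid\<close>)
  have s: "?l (Hor p (- int n)) \<le> 1" if "p \<in> {0..int n - 1}" for p
    by (rule L(3)) (use that in \<open>auto simp: Upw_trapezoid Dnw_trapezoid\<close>)
  have ne: "?l (Fall p (int n - 1 - p)) \<le> 1" if "p \<in> {0..int n - 1}" for p
    by (rule L(5)) (use that in \<open>auto simp: Upw_trapezoid Dnw_trapezoid\<close>)
  note E = edge_label_labelling
  note [simp del] = labelling.simps
  have sides: "side_partition P (NE_side n) = lam \<longleftrightarrow>
      (\<forall>p\<in>{0..int n - 1}. ?l (Fall p (int n - 1 - p)) = 1 \<longleftrightarrow> (\<exists>i\<in>{1..d}. p = pos n lam i))"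
    "side_partition P (NW_side n) = mu \<longleftrightarrow>
      (\<forall>p\<in>{0..int n - 1}. ?l (Rise 0 p) = 1 \<longleftrightarrow> (\<exists>i\<in>{1..d}. p = pos n mu i))"
    "side_partition P (horizontal_side n (- int n)) = nu \<longleftrightarrow>
      (\<forall>p\<in>{0..int n - 1}. ?l (Hor p (- int n)) = 1 \<longleftrightarrow> (\<exists>i\<in>{1..d}. p = pos n nu i))"
    unfolding NE_side_def NW_side_def horizontal_side_def
    by (rule side_partition_labelling; use assms w ne s in force)+
  have "edge_label P (Rise 0 b) = ?l (Rise 0 b)" "edge_label P (Rise (int n) b) = ?l (Rise (int n) b)"
    if "b \<in> {- int n..- 1}" for b
    using E[OF w, of b] E[OF e, of b] that by auto
  then show ?thesis
    unfolding LP_def boundary_labels_def mem_Collect_eq sides using True by auto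
qed (simp add: LP_def)

lemma pieces_in_LP:
  assumes "d \<le> n" "lam \<in> partitions d n" "mu \<in> partitions d n" "nu \<in> partitions d n"
    "proper (trapezoid n) l" "boundary_labels n d lam mu nu l"
  shows "pieces (trapezoid n) l \<in> LP n lam mu nu"
proof -
  let ?m = "labelling (pieces (trapezoid n) l)"
  have up: "up_labels ?m a b = up_labels l a b" if "Upw a b \<in> trapezoid n" for a b
    by (rule up_labels_labelling[OF assms(5) that])
  have dn: "dn_labels ?m a b = dn_labels l a b" if "Dnw a b \<in> trapezoid n" for a b
    by (rule dn_labels_labelling[OF assms(5) that])
  have "?m (Rise 0 b) = l (Rise 0 b)" if "b \<in> {- int n..int n - 1}" "0 < n" for b
    using up[of 0 b] that by (simp add: Upw_trapezoid up_labels_def del: labelling.simps)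
  moreover have "?m (Rise (int n) b) = l (Rise (int n) b)" if "b \<in> {- int n..- 1}" for b
    using dn[of "int n - 1" b] that by (simp add: Dnw_trapezoid dn_labels_def del: labelling.simps)
  moreover have "?m (Hor p (- int n)) = l (Hor p (- int n))" if "p \<in> {0..int n - 1}" for p
    using up[of p "- int n"] that by (simp add: Upw_trapezoid up_labels_def del: labelling.simps)
  moreover have "?m (Fall p (int n - 1 - p)) = l (Fall p (int n - 1 - p))" if "p \<in> {0..int n - 1}" for p
    using up[of p "int n - 1 - p"] that by (simp add: Upw_trapezoid up_labels_def del: labelling.simps)
  ultimately have "boundary_labels n d lam mu nu ?m"
    using assms(6) unfolding boundary_labels_def by (auto simp del: labelling.simps)
  then show ?thesis using LP_iff assms tiling_pieces by blast
qed

text \<open>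
  A trapezoid is cut into strips parallel to its NE side: strip \<open>t\<close> lies between the lines
  \<open>a + b = n - t\<close> and \<open>a + b = n - 1 - t\<close>, and its edges are indexed by their first coordinate.
\<close>

definition fall_at :: "nat \<Rightarrow> (edge \<Rightarrow> nat) \<Rightarrow> nat \<Rightarrow> int \<Rightarrow> nat" where
  "fall_at n l t a = l (Fall a (int n - 1 - int t - a))"

definition rise_at :: "nat \<Rightarrow> (edge \<Rightarrow> nat) \<Rightarrow> nat \<Rightarrow> int \<Rightarrow> nat" where
  "rise_at n l t a = l (Rise a (int n - 1 - int t - a))"

definition hor_at :: "nat \<Rightarrow> (edge \<Rightarrow> nat) \<Rightarrow> nat \<Rightarrow> int \<Rightarrow> nat" where
  "hor_at n l t a = l (Hor a (int n - 1 - int t - a))"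

text \<open>The bounds on \<open>a + int t\<close> say that the triangle does not lie below the S
  side. They hold throughout a strip with \<open>t < n\<close>, while longer strips are cut off by
  that side.\<close>

lemma strip_legal:
  assumes "proper (trapezoid n) l" "0 \<le> a" "a < int n" "a + int t \<le> 2 * int n - 1"
  shows "legal (hor_at n l t a) (rise_at n l t a) (fall_at n l t a)"
    and "a + int t \<le> 2 * int n - 2 \<Longrightarrow>
      legal (hor_at n l t a) (rise_at n l t (a + 1)) (fall_at n l (t + 1) a)"
proof -
  let ?b = "int n - 1 - int t - a"
  have "Upw a ?b \<in> trapezoid n" using assms by (simp add: Upw_trapezoid)
  from properD(1)[OF assms(1) this]
  show "legal (hor_at n l t a) (rise_at n l t a) (fall_at n l t a)"
    unfolding hor_at_def rise_at_def fall_at_def .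
  assume "a + int t \<le> 2 * int n - 2"
  then have "Dnw a (?b - 1) \<in> trapezoid n" using assms by (simp add: Dnw_trapezoid)
  from properD(2)[OF assms(1) this]
  show "legal (hor_at n l t a) (rise_at n l t (a + 1)) (fall_at n l (t + 1) a)"
    unfolding hor_at_def rise_at_def fall_at_def by (simp add: algebra_simps)
qed

text \<open>An upward triangle with falling label 0 has horizontal label 2 if its rising label is 1,
  and 0 otherwise; the downward triangle below it turns this back into a rising label. Starting from
  0 that label may also be 2, so only being 1 is preserved.\<close>

lemma strip_zeros:
  assumes "proper (trapezoid n) l" "t < n" "0 \<le> a" "a \<le> b" "b \<le> int n"
    "\<And>c. a \<le> c \<Longrightarrow> c < b \<Longrightarrow> fall_at n l t c = 0"
  shows "rise_at n l t a = 1 \<longleftrightarrow> rise_at n l t b = 1"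
  using assms(4-6)
proof (induction b rule: int_ge_induct)
  case (step b)
  from step have "legal (hor_at n l t b) (rise_at n l t b) (fall_at n l t b)"
    "legal (hor_at n l t b) (rise_at n l t (b + 1)) (fall_at n l (t + 1) b)"
    using strip_legal[OF assms(1), of b t] assms(2,3) by auto
  moreover have "fall_at n l t b = 0" using step.hyps step.prems by auto
  ultimately have "rise_at n l t b = 1 \<longleftrightarrow> rise_at n l t (b + 1) = 1"
    by (auto simp: legal_def)
  then show ?case using step by auto
qed simp

text \<open>
  The strips below those of full length end in a bottom edge with label at most 1, and they are forced
  from this end if no falling label on line \<open>n\<close> is 1.
\<close>

lemma lower_forced:
  assumes l: "proper (trapezoid n) l"
    and f: "\<And>a. 0 \<le> a \<Longrightarrow> a < int n \<Longrightarrow> fall_at n l n a \<in> {0, 2}"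
    and t: "n \<le> t" and a: "0 \<le> a" "a + int t \<le> 2 * int n - 1"
  shows "fall_at n l t a = fall_at n l n a \<and> rise_at n l t a = 0 \<and>
    hor_at n l t a = (if fall_at n l n a = 0 then 0 else 1)"
  using t a
proof (induction t arbitrary: a rule: dec_induct)
  have key: "rise_at n l t a = 0 \<and> hor_at n l t a = (if fall_at n l n a = 0 then 0 else 1) \<and>
      (a + int t \<le> 2 * int n - 2 \<longrightarrow> fall_at n l (t + 1) a = fall_at n l n a)"
    if F: "\<And>c. 0 \<le> c \<Longrightarrow> c + int t \<le> 2 * int n - 1 \<Longrightarrow> fall_at n l t c = fall_at n l n c"
      and t: "n \<le> t" and "a \<le> 2 * int n - 1 - int t" "0 \<le> a" for t a
    using that(3,4)
  proof (induction a rule: int_le_induct)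
    case base
    \<comment> \<open>The last upward triangle of the strip, whose horizontal edge lies on the S
      side. From there the strip is traversed to the left.\<close>
    let ?a = "2 * int n - 1 - int t"
    have "l (Hor ?a (- int n)) \<le> 1"
      by (rule properD(3)[OF l]) (use base t in \<open>auto simp: Upw_trapezoid Dnw_trapezoid\<close>)
    then have "hor_at n l t ?a \<le> 1" by (simp add: hor_at_def)
    moreover have "legal (hor_at n l t ?a) (rise_at n l t ?a) (fall_at n l t ?a)"
      using base t by (intro strip_legal[OF l]) auto
    moreover have "fall_at n l t ?a = fall_at n l n ?a" using base by (intro F) auto
    moreover have "fall_at n l n ?a \<in> {0, 2}" using base t by (intro f) auto
    ultimately show ?case by (auto simp: legal_def)
  next
    case (step a)
    let ?a = "a - 1"
    have "rise_at n l t (?a + 1) = 0" using step by auto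
    moreover have "legal (hor_at n l t ?a) (rise_at n l t ?a) (fall_at n l t ?a)"
      using step t by (intro strip_legal[OF l]) auto
    moreover have "legal (hor_at n l t ?a) (rise_at n l t (?a + 1)) (fall_at n l (t + 1) ?a)"
      using step t by (intro strip_legal[OF l]) auto
    moreover have "fall_at n l t ?a = fall_at n l n ?a" using step by (intro F) auto
    moreover have "fall_at n l n ?a \<in> {0, 2}" using step t by (intro f) auto
    ultimately show ?case by (auto simp: legal_def)
  qed
  { case base
    then show ?case using key[of n a] by auto }
  { case (step t)
    have "fall_at n l (Suc t) c = fall_at n l n c" if "0 \<le> c" "c + int (Suc t) \<le> 2 * int n - 1" for c
      using key[of t c] step.IH step.hyps that by auto
    then show ?case using key[of "Suc t" a] step.prems step.hyps by auto }
qed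

section \<open>Strictly increasing sequences of positions\<close>

lemma less_chain:
  fixes x :: "nat \<Rightarrow> int"
  assumes "\<And>i. i \<in> {1..<d} \<Longrightarrow> x i < x (i + 1)" "1 \<le> i" "i < j" "j \<le> d"
  shows "x i < x j"
  using assms(3,4)
proof (induction j)
  case (Suc j)
  show ?case
  proof (cases "i = j")
    case False
    then have "x i < x j" using Suc by auto
    also have "x j < x (j + 1)" using Suc assms(2) False by (intro assms(1)) auto
    finally show ?thesis by simp
  qed (use Suc assms(1)[of j] assms(2) in auto)
qed simp

lemma le_chain:
  fixes x :: "nat \<Rightarrow> int"
  assumes "\<And>i. i \<in> {1..<d} \<Longrightarrow> x i < x (i + 1)" "1 \<le> i" "i \<le> j" "j \<le> d"
  shows "x i \<le> x j"
  using less_chain[of d x i j] assms by (cases "i = j") auto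

lemma increasing_unique:
  fixes x y :: "nat \<Rightarrow> int"
  assumes "\<And>i. i \<in> {1..<d} \<Longrightarrow> x i < x (i + 1)" "\<And>i. i \<in> {1..<d} \<Longrightarrow> y i < y (i + 1)"
    "x ` {1..d} = y ` {1..d}" "i \<in> {1..d}"
  shows "x i = y i"
proof -
  have "sorted_wrt (<) (map z [1..<Suc d])" if "\<And>i. i \<in> {1..<d} \<Longrightarrow> z i < z (i + 1)" for z :: "nat \<Rightarrow> int"
    unfolding sorted_wrt_map using less_chain[of d z, OF that]
    by (auto intro!: sorted_wrt_mono_rel[OF _ sorted_wrt_upt, of _ _ "\<lambda>a b. z a < z b"] simp del: upt_Suc)
  then have "map x [1..<Suc d] = map y [1..<Suc d]"
    using assms(1-3) by (intro strict_sorted_equal) (auto simp: atLeastLessThanSuc_atLeastAtMost simp del: upt_Suc)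
  then show ?thesis using assms(4) by (auto simp: map_eq_conv simp del: upt_Suc)
qed

section \<open>Paths of a trapezoid puzzle\<close>

text \<open>
  \<open>x i t\<close> is the first coordinate at which path \<open>i\<close> crosses line \<open>t\<close>, and \<open>u i t\<close> is the
  number of upward 1-triangles that it has met in the strips \<open>0, \<dots>, t - 1\<close>. Upward 1-triangles of
  path \<open>i + 1\<close> correspond to downward 1-triangles of path \<open>i\<close> in the same strip, and those of
  path 1 to the edges labelled 1 on the NW side.
\<close>

definition pattern ::
    "nat \<Rightarrow> nat \<Rightarrow> nat list \<Rightarrow> nat list \<Rightarrow> nat list \<Rightarrow> (nat \<Rightarrow> nat \<Rightarrow> nat) \<Rightarrow> (nat \<Rightarrow> nat \<Rightarrow> int) \<Rightarrow> bool"
  where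
  "pattern n d lam mu nu u x \<longleftrightarrow>
     (\<forall>t\<le>n. u (d + 1) t = 0) \<and>
     (\<forall>t\<le>n. u 1 t = card {j \<in> {1..d}. mu ! (d - j) + j \<le> t}) \<and>
     (\<forall>t\<le>n. \<forall>i\<in>{1..d}. u (i + 1) t \<le> u i t) \<and>
     (\<forall>t<n. \<forall>i\<in>{1..d}. u i t \<le> u i (t + 1) \<and> u i (t + 1) \<le> u (i + 1) t + 1) \<and>
     (\<forall>i\<in>{1..d}. x i 0 = pos n lam i \<and> x i n = pos n nu i) \<and>
     (\<forall>t\<le>n. \<forall>i\<in>{1..<d}. x i t < x (i + 1) t) \<and>
     (\<forall>t<n. \<forall>i\<in>{1..d}. x i (t + 1) = x i t \<or> x i (t + 1) = x i t - 1 \<and> u i (t + 1) = u (i + 1) t)"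

text \<open>Path \<open>i\<close> has met \<open>u i t\<close> upward and \<open>u (i + 1) t\<close>
  downward 1-triangles. The difference is 1 exactly while the path is between an upward and the next
  downward one; it then runs through \<open>RhHR\<close> pieces and crosses the line at a diagonal,
  which has label 2.\<close>

definition realizes ::
    "nat \<Rightarrow> nat \<Rightarrow> (edge \<Rightarrow> nat) \<Rightarrow> (nat \<Rightarrow> nat \<Rightarrow> nat) \<Rightarrow> (nat \<Rightarrow> nat \<Rightarrow> int) \<Rightarrow> bool" where
  "realizes n d l u x \<longleftrightarrow> (\<forall>t\<le>n.
     (\<forall>i\<in>{1..d}. fall_at n l t (x i t) = 1 + (u i t - u (i + 1) t)) \<and>
     (\<forall>a\<in>{0..int n - 1}. fall_at n l t a \<noteq> 0 \<longrightarrow> (\<exists>i\<in>{1..d}. a = x i t)))"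

text \<open>A rising label 2 at the position of a path is the diagonal of an \<open>RhHF\<close>,
  the only piece that lowers the first coordinate of a path.\<close>

primrec track :: "(nat \<Rightarrow> int \<Rightarrow> nat) \<Rightarrow> int \<Rightarrow> nat \<Rightarrow> int" where
  "track r p 0 = p"
| "track r p (Suc t) = (if r t (track r p t) = 2 then track r p t - 1 else track r p t)"

lemma card_less_Suc_if:
  "card {s. s < Suc t \<and> P s} = card {s. s < t \<and> P s} + (if P t then 1 else 0)"
proof -
  have "{s. s < Suc t \<and> P s} = (if P t then insert t {s. s < t \<and> P s} else {s. s < t \<and> P s})"
    by (auto simp: less_Suc_eq)
  then show ?thesis by simp
qed

text \<open>The \<open>j\<close>-th one from the top of the NW side has \<open>j - 1\<close> ones
  and \<open>mu ! (d - j)\<close> zeros above it, so it bounds strip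
  \<open>mu ! (d - j) + j - 1\<close>.\<close>

lemma pos_mu_count:
  assumes "mu \<in> partitions d n" "d \<le> n" "t \<le> n"
  shows "card {s. s < t \<and> (\<exists>i\<in>{1..d}. int n - 1 - int s = pos n mu i)} = card {j \<in> {1..d}. mu ! (d - j) + j \<le> t}"
proof (rule bij_betw_same_card[symmetric], rule bij_betw_imageI)
  let ?g = "\<lambda>j. mu ! (d - j) + j - 1"
  show "inj_on ?g {j \<in> {1..d}. mu ! (d - j) + j \<le> t}"
  proof (rule inj_onI, rule ccontr)
    fix i j assume ij: "i \<in> {j \<in> {1..d}. mu ! (d - j) + j \<le> t}" "j \<in> {j \<in> {1..d}. mu ! (d - j) + j \<le> t}"
      "?g i = ?g j" "i \<noteq> j"
    have "mu ! (d - i) \<le> mu ! (d - j)" if "i < j" "j \<le> d" "1 \<le> i" for i j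
      using that by (intro partitions_nth_mono[OF assms(1)]) auto
    from this[of i j] this[of j i] ij show False by auto linarith+
  qed
  have len: "length mu = d" using assms(1) by (simp add: partitions_def)
  show "?g ` {j \<in> {1..d}. mu ! (d - j) + j \<le> t} = {s. s < t \<and> (\<exists>i\<in>{1..d}. int n - 1 - int s = pos n mu i)}"
  proof (intro equalityI subsetI)
    fix s assume "s \<in> ?g ` {j \<in> {1..d}. mu ! (d - j) + j \<le> t}"
    then obtain j where j: "j \<in> {1..d}" "mu ! (d - j) + j \<le> t" "s = ?g j" by blast
    then have "int n - 1 - int s = pos n mu (d + 1 - j)" using len by (auto simp: pos_def)
    moreover have "d + 1 - j \<in> {1..d}" using j by auto
    ultimately show "s \<in> {s. s < t \<and> (\<exists>i\<in>{1..d}. int n - 1 - int s = pos n mu i)}" using j by auto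
  next
    fix s assume "s \<in> {s. s < t \<and> (\<exists>i\<in>{1..d}. int n - 1 - int s = pos n mu i)}"
    then obtain i where i: "s < t" "i \<in> {1..d}" "int n - 1 - int s = pos n mu i" by auto
    then have "s = ?g (d + 1 - i)" "mu ! (d - (d + 1 - i)) + (d + 1 - i) \<le> t" using len by (auto simp: pos_def)
    moreover have "d + 1 - i \<in> {1..d}" using i by auto
    ultimately show "s \<in> ?g ` {j \<in> {1..d}. mu ! (d - j) + j \<le> t}" by blast
  qed
qed

text \<open>A total drop of \<open>d\<close> in \<open>d\<close> steps of at most 1 makes every step
  equal to 1.\<close>

lemma unit_steps:
  fixes v :: "nat \<Rightarrow> nat"
  assumes "v 1 = d" "v (d + 1) = 0" "\<And>i. i \<in> {1..d} \<Longrightarrow> v i \<le> v (i + 1) + 1" "i \<in> {1..d + 1}"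
  shows "v i + i = d + 1"
proof -
  have "1 \<le> i" using assms(4) by auto
  then have "d + 1 \<le> v i + i" using assms(4)
  proof (induction i rule: dec_induct)
    case (step i)
    then show ?case using assms(3)[of i] by auto
  qed (use assms(1) in auto)
  moreover have "i \<le> d + 1" using assms(4) by auto
  then have "v i + i \<le> d + 1" using assms(4)
  proof (induction i rule: inc_induct)
    case (step i)
    then show ?case using assms(3)[of i] by auto
  qed (use assms(2) in auto)
  ultimately show ?thesis by simp
qed

text \<open>Both arrays are read off the rising labels at the path positions. The invariant
  \<open>Inv\<close> says that on each line these positions are exactly the places of nonzero
  falling labels, and that the labels have the values demanded by \<open>realizes\<close>; it passes
  from line to line by inspecting the two triangles at each position.\<close>

lemma puzzle_pattern:
  assumes d: "1 \<le> d" "d \<le> n" and lam: "lam \<in> partitions d n" and mu: "mu \<in> partitions d n"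
    and nu: "nu \<in> partitions d n" and l: "proper (trapezoid n) l"
    and bd: "boundary_labels n d lam mu nu l"
  obtains u x where "pattern n d lam mu nu u x" "realizes n d l u x"
    "\<And>t i. t < n \<Longrightarrow> i \<in> {1..d} \<Longrightarrow> rise_at n l t (x i t) = 1 \<longleftrightarrow> u i (t + 1) = u i t + 1"
    "\<And>t i. t < n \<Longrightarrow> i \<in> {1..d} \<Longrightarrow> rise_at n l t (x i t) = 2 \<longleftrightarrow> x i (t + 1) = x i t - 1"
proof -
  let ?f = "fall_at n l" and ?r = "rise_at n l" and ?h = "hor_at n l"
  define x where "x i = track ?r (pos n lam i)" for i
  define u where "u i t = (if i \<le> d then card {s. s < t \<and> ?r s (x i s) = 1} else 0)" for i t
  have x0: "x i 0 = pos n lam i" for i by (simp add: x_def)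
  have xS: "x i (Suc t) = (if ?r t (x i t) = 2 then x i t - 1 else x i t)" for i t
    by (simp add: x_def)
  have uS: "u i (Suc t) = u i t + (if i \<le> d \<and> ?r t (x i t) = 1 then 1 else 0)" for i t
    by (simp add: u_def card_less_Suc_if)
  have u0: "u i 0 = 0" for i by (simp add: u_def)
  have S: "legal (?h t a) (?r t a) (?f t a)" "legal (?h t a) (?r t (a + 1)) (?f (Suc t) a)"
    if "t < n" "0 \<le> a" "a < int n" for t a
    using strip_legal[OF l, of a t] that by auto
  have rn: "?r t (int n) = 0" if "t < n" for t
    using bd that unfolding boundary_labels_def rise_at_def by auto
  have r0: "?r t 0 \<le> 1" if "t < n" for t
    unfolding rise_at_def
    by (rule properD(4)[OF l]) (use that in \<open>auto simp: Upw_trapezoid Dnw_trapezoid\<close>)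
  define Inv where "Inv t \<longleftrightarrow>
    (\<forall>i\<in>{1..d}. 0 \<le> x i t \<and> x i t < int n \<and> ?f t (x i t) \<noteq> 0 \<and>
        int (?f t (x i t)) = 1 + int (u i t) - int (u (i + 1) t)) \<and>
    (\<forall>i\<in>{1..<d}. x i t < x (i + 1) t) \<and>
    (\<forall>a. 0 \<le> a \<longrightarrow> a < int n \<longrightarrow> ?f t a \<noteq> 0 \<longrightarrow> (\<exists>i\<in>{1..d}. a = x i t))" for t
  have gap: "?f t c = 0" if I: "Inv t" and c: "0 \<le> c" "c < int n"
      and i: "i \<le> d" "i = 0 \<or> x i t < c" "i = d \<or> c < x (i + 1) t" for t c i
  proof (rule ccontr)
    assume "?f t c \<noteq> 0"
    then obtain k where k: "k \<in> {1..d}" "c = x k t" using I c unfolding Inv_def by blast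
    have ch: "x a t \<le> x b t" if "1 \<le> a" "a \<le> b" "b \<le> d" for a b
      using I that unfolding Inv_def by (intro le_chain[of d "\<lambda>i. x i t"]) auto
    show False using k i ch[of k i] ch[of "i + 1" k] by (cases "k \<le> i") auto
  qed
  \<comment> \<open>Between neighbouring paths the falling labels are 0, so
    \<open>strip_zeros\<close> transports the rising label: a downward 1-triangle of path
    \<open>i\<close> faces an upward 1-triangle of path \<open>i + 1\<close>. To the right of the
    last path the E side, labelled 0, plays this part.\<close>
  have pass: "?r t (x i t + 1) = 1 \<longleftrightarrow> i < d \<and> ?r t (x (i + 1) t) = 1"
    if I: "Inv t" and t: "t < n" and i: "i \<in> {1..d}" for t i
  proof (cases "i = d")
    case True
    have nn: "0 \<le> x i t" "x i t < int n" using I i unfolding Inv_def by blast+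
    have "?r t (x i t + 1) = 1 \<longleftrightarrow> ?r t (int n) = 1"
    proof (rule strip_zeros[OF l t])
      show "?f t c = 0" if "x i t + 1 \<le> c" "c < int n" for c
        using nn that i True by (intro gap[OF I, of _ i]) auto
    qed (use nn in auto)
    then show ?thesis using True rn[OF t] by simp
  next
    case False
    then have i': "i \<in> {1..<d}" "i + 1 \<in> {1..d}" using i by auto
    have b: "0 \<le> x i t" "x i t < x (i + 1) t" "x (i + 1) t < int n" using I i i' unfolding Inv_def by blast+
    have "?r t (x i t + 1) = 1 \<longleftrightarrow> ?r t (x (i + 1) t) = 1"
    proof (rule strip_zeros[OF l t])
      show "?f t c = 0" if "x i t + 1 \<le> c" "c < x (i + 1) t" for c
        using that b i by (intro gap[OF I, of _ i]) auto
    qed (use b in auto)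
    then show ?thesis using i' by simp
  qed
  have first: "?r t 0 = 1 \<longleftrightarrow> ?r t (x 1 t) = 1" if I: "Inv t" and t: "t < n" for t
  proof (rule strip_zeros[OF l t])
    have "1 \<in> {1..d}" using d by simp
    then have nn: "0 \<le> x 1 t" "x 1 t < int n" using I unfolding Inv_def by blast+
    then show "0 \<le> x 1 t" "x 1 t \<le> int n" by auto
    show "?f t c = 0" if "0 \<le> c" "c < x 1 t" for c
      using that nn by (intro gap[OF I, of _ 0]) auto
  qed simp
  have inv: "Inv t" if "t \<le> n" for t
    using that
  proof (induction t)
    case 0
    have ne: "?f 0 a \<le> 1" if "0 \<le> a" "a < int n" for a
      unfolding fall_at_def
      by (rule properD(5)[OF l]) (use that in \<open>auto simp: Upw_trapezoid Dnw_trapezoid\<close>)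
    have ne1: "?f 0 a = 1 \<longleftrightarrow> (\<exists>i\<in>{1..d}. a = pos n lam i)" if "0 \<le> a" "a < int n" for a
      using bd that unfolding boundary_labels_def fall_at_def by simp
    show ?case unfolding Inv_def x0 u0
    proof (intro conjI ballI allI impI)
      fix i assume i: "i \<in> {1..d}"
      show b: "0 \<le> pos n lam i" "pos n lam i < int n" using pos_bounds[OF lam d(2)] i by auto
      have "?f 0 (pos n lam i) = 1" using ne1[OF b] i by blast
      then show "?f 0 (pos n lam i) \<noteq> 0" "int (?f 0 (pos n lam i)) = 1 + int 0 - int 0" by auto
    next
      fix i assume "i \<in> {1..<d}"
      then show "pos n lam i < pos n lam (i + 1)" by (intro pos_less[OF lam]) auto
    next
      fix a assume "0 \<le> a" "a < int n" "?f 0 a \<noteq> 0"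
      then have "?f 0 a = 1" using ne[of a] by linarith
      then show "\<exists>i\<in>{1..d}. a = pos n lam i" using ne1 \<open>0 \<le> a\<close> \<open>a < int n\<close> by blast
    qed
  next
    case (Suc t)
    then have I: "Inv t" and t: "t < n" by auto
    note pass = pass[OF I t]
    show ?case unfolding Inv_def
    proof (intro conjI ballI allI impI)
      fix i assume i: "i \<in> {1..d}"
      have b: "0 \<le> x i t" "x i t < int n" and fx: "?f t (x i t) \<noteq> 0"
        "int (?f t (x i t)) = 1 + int (u i t) - int (u (i + 1) t)" using I i unfolding Inv_def by blast+
      note S1 = S[OF t b]
      have uS': "u (i + 1) (Suc t) = u (i + 1) t + (if ?r t (x i t + 1) = 1 then 1 else 0)"
        using pass[OF i] i by (auto simp: uS)
      have uSi: "u i (Suc t) = u i t + (if ?r t (x i t) = 1 then 1 else 0)" using i by (simp add: uS)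
      have *: "0 \<le> x i (Suc t) \<and> x i (Suc t) < int n \<and> ?f (Suc t) (x i (Suc t)) \<noteq> 0 \<and>
        int (?f (Suc t) (x i (Suc t))) = 1 + int (u i (Suc t)) - int (u (i + 1) (Suc t))"
      proof (cases "?r t (x i t) = 2")
        case True
        \<comment> \<open>A path cannot move out through the NW side, whose labels are at most
          1.\<close>
        have "x i t \<noteq> 0" using True r0[OF t] by auto
        then have b': "0 \<le> x i t - 1" "x i t - 1 < int n" using b by auto
        from S(2)[OF t b'] True have "?f (Suc t) (x i t - 1) = 1" by (auto simp: legal_def)
        moreover have "?r t (x i t + 1) \<noteq> 1" "?f t (x i t) = 1" using S1 True by (auto simp: legal_def)
        ultimately show ?thesis using True fx uSi uS' b' by (simp add: xS)
      next
        case False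
        have "?r t (x i t) = 1 \<and> ?f t (x i t) = 1 \<and> ?h t (x i t) = 1 \<or>
          ?r t (x i t) = 0 \<and> ?f t (x i t) = 2 \<and> ?h t (x i t) = 1 \<or>
          ?r t (x i t) = 0 \<and> ?f t (x i t) = 1 \<and> ?h t (x i t) = 3"
          using S1(1) False fx(1) by (auto simp: legal_def)
        then show ?thesis
        proof (elim disjE conjE)
          assume "?r t (x i t) = 0" "?f t (x i t) = 1" "?h t (x i t) = 3"
          then show ?thesis using S1(2) fx uSi uS' b False by (auto simp: legal_def xS)
        next
          assume "?r t (x i t) = 0" "?f t (x i t) = 2" "?h t (x i t) = 1"
          then show ?thesis using S1(2) fx uSi uS' b False by (auto simp: legal_def xS)
        next
          assume "?r t (x i t) = 1" "?f t (x i t) = 1" "?h t (x i t) = 1"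
          then show ?thesis using S1(2) fx uSi uS' b False by (auto simp: legal_def xS)
        qed
      qed
      then show "0 \<le> x i (Suc t)" "x i (Suc t) < int n" "?f (Suc t) (x i (Suc t)) \<noteq> 0"
        "int (?f (Suc t) (x i (Suc t))) = 1 + int (u i (Suc t)) - int (u (i + 1) (Suc t))" by auto
    next
      fix i assume i: "i \<in> {1..<d}"
      then have "i \<in> {1..d}" by auto
      then have b: "0 \<le> x i t" "x i t < int n" "?f t (x i t) \<noteq> 0" "x i t < x (i + 1) t"
        using I i unfolding Inv_def by blast+
      \<comment> \<open>Adjacent paths could only collide if the right one moved and the left one
        stayed. But the move puts the label 0 on the horizontal edge below the left path, and with a
        nonzero falling label this forces the left path to move too.\<close>
      have "\<not> (x (i + 1) t = x i t + 1 \<and> ?r t (x i t + 1) = 2 \<and> ?r t (x i t) \<noteq> 2)"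
        using S[OF t b(1,2)] b(3) by (auto simp: legal_def)
      moreover from b(4) have "x (i + 1) t = x i t + 1 \<or> x i t + 1 < x (i + 1) t" by linarith
      ultimately show "x i (Suc t) < x (i + 1) (Suc t)" by (elim disjE) (simp_all add: xS)
    next
      fix a assume a: "0 \<le> a" "a < int n" "?f (Suc t) a \<noteq> 0"
      show "\<exists>i\<in>{1..d}. a = x i (Suc t)"
      proof (cases "?r t (a + 1) = 2")
        case True
        then have "a + 1 \<noteq> int n" using rn[OF t] by auto
        then have a1: "0 \<le> a + 1" "a + 1 < int n" using a by auto
        from S(1)[OF t this] True have "?f t (a + 1) \<noteq> 0" by (auto simp: legal_def)
        then obtain i where "i \<in> {1..d}" "a + 1 = x i t" using I a1 unfolding Inv_def by blast
        then show ?thesis using True by (intro bexI[of _ i]) (auto simp: xS dest!: sym[of "a + 1"])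
      next
        case False
        then have "?f t a \<noteq> 0" "?r t a \<noteq> 2" using S[OF t a(1,2)] a(3) by (auto simp: legal_def)
        then obtain i where "i \<in> {1..d}" "a = x i t" using I a unfolding Inv_def by blast
        then show ?thesis using \<open>?r t a \<noteq> 2\<close> by (intro bexI[of _ i]) (auto simp: xS)
      qed
    qed
  qed
  have cov: "\<exists>i\<in>{1..d}. a = x i t" if "t \<le> n" "0 \<le> a" "a < int n" "?f t a \<noteq> 0" for t a
    using inv[OF that(1), unfolded Inv_def, THEN conjunct2, THEN conjunct2] that(2-4) by simp
  have f12: "?f t (x i t) \<in> {1, 2}" if "t \<le> n" "i \<in> {1..d}" for t i
  proof -
    have b: "0 \<le> x i t" "x i t < int n" "?f t (x i t) \<noteq> 0" using inv[OF that(1)] that(2) unfolding Inv_def by blast+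
    have "legal (?h t (x i t)) (?r t (x i t)) (?f t (x i t))"
      using b that by (intro strip_legal(1)[OF l]) auto
    then show ?thesis using b by (auto simp: legal_def)
  qed
  have fu: "int (?f t (x i t)) = 1 + int (u i t) - int (u (i + 1) t)" if "t \<le> n" "i \<in> {1..d}" for t i
    using inv[OF that(1)] that(2) unfolding Inv_def by blast
  have u1: "u 1 t = card {j \<in> {1..d}. mu ! (d - j) + j \<le> t}" if "t \<le> n" for t
  proof -
    have "?r s (x 1 s) = 1 \<longleftrightarrow> (\<exists>i\<in>{1..d}. int n - 1 - int s = pos n mu i)" if "s < t" for s
    proof -
      have "?r s (x 1 s) = 1 \<longleftrightarrow> ?r s 0 = 1"
        using first[of s] inv[of s] that \<open>t \<le> n\<close> by auto
      then show ?thesis using bd that \<open>t \<le> n\<close> unfolding boundary_labels_def rise_at_def by auto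
    qed
    then have "u 1 t = card {s. s < t \<and> (\<exists>i\<in>{1..d}. int n - 1 - int s = pos n mu i)}"
      using d(1) unfolding u_def by (auto intro!: arg_cong[where f = card])
    then show ?thesis using pos_mu_count[OF mu d(2) that] by simp
  qed
  \<comment> \<open>Line \<open>n\<close> passes through the lower end of the NW side, so path 1 has
    met all \<open>d\<close> of its upward 1-triangles; the falling labels 1 and 2 allow a drop of
    at most 1 from one path to the next.\<close>
  have fin: "u i n + i = d + 1" if "i \<in> {1..d + 1}" for i
  proof -
    have "mu ! (d - j) + j \<le> n" if "j \<in> {1..d}" for j
      using partitions_nth_le[OF mu, of "d - j"] that d by auto
    then have "{j \<in> {1..d}. mu ! (d - j) + j \<le> n} = {1..d}" by auto
    then have 1: "u 1 n = d" using u1[of n] by simp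
    have step: "u i n \<le> u (i + 1) n + 1" if "i \<in> {1..d}" for i
      using fu[of n i] f12[of n i] that by auto
    have "u (d + 1) n = 0" by (simp add: u_def)
    from unit_steps[of "\<lambda>i. u i n", OF 1 this step that] show ?thesis .
  qed
  have fn: "?f n (x i n) = 2" if "i \<in> {1..d}" for i
    using fu[of n i] fin[of i] fin[of "i + 1"] that by auto
  have fn02: "?f n a \<in> {0, 2}" if a: "0 \<le> a" "a < int n" for a
  proof (cases "?f n a = 0")
    case False
    then obtain i where "i \<in> {1..d}" "a = x i n" using cov[of n a] a by auto
    then show ?thesis using fn by auto
  qed auto
  \<comment> \<open>By now all falling labels on line \<open>n\<close> are 0 or 2, so the strips
    below it merely copy the path positions down to the S side, where \<open>nu\<close> is
    read.\<close>
  have bottom: "(\<exists>i\<in>{1..d}. a = pos n nu i) \<longleftrightarrow> ?f n a \<noteq> 0" if a: "0 \<le> a" "a < int n" for a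
  proof -
    have "hor_at n l (nat (2 * int n - 1 - a)) a = (if ?f n a = 0 then 0 else 1)"
      using lower_forced[OF l fn02, of "nat (2 * int n - 1 - a)" a] a by auto
    moreover have "hor_at n l (nat (2 * int n - 1 - a)) a = l (Hor a (- int n))"
      using a by (simp add: hor_at_def)
    moreover have "l (Hor a (- int n)) = 1 \<longleftrightarrow> (\<exists>i\<in>{1..d}. a = pos n nu i)"
      using bd a unfolding boundary_labels_def by simp
    ultimately show ?thesis by (metis zero_neq_one)
  qed
  have xn: "x i n = pos n nu i" if "i \<in> {1..d}" for i
  proof (rule increasing_unique[of d _ _ i, OF _ _ _ that])
    show "x i n < x (i + 1) n" if "i \<in> {1..<d}" for i using inv[of n] that unfolding Inv_def by blast
    show "pos n nu i < pos n nu (i + 1)" if "i \<in> {1..<d}" for i using that by (intro pos_less[OF nu]) auto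
    show "(\<lambda>i. x i n) ` {1..d} = pos n nu ` {1..d}"
    proof (intro equalityI subsetI)
      fix a assume "a \<in> (\<lambda>i. x i n) ` {1..d}"
      then obtain i where i: "i \<in> {1..d}" "a = x i n" by auto
      then have "0 \<le> a" "a < int n" "?f n a \<noteq> 0" using inv[of n] unfolding Inv_def by blast+
      then show "a \<in> pos n nu ` {1..d}" using bottom by blast
    next
      fix a assume "a \<in> pos n nu ` {1..d}"
      then obtain i where i: "i \<in> {1..d}" "a = pos n nu i" by auto
      then have a: "0 \<le> a" "a < int n" using pos_bounds[OF nu d(2)] by auto
      then have "?f n a \<noteq> 0" using bottom i by blast
      then show "a \<in> (\<lambda>i. x i n) ` {1..d}" using a cov[of n a] by auto
    qed
  qed
  have "pattern n d lam mu nu u x"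
    unfolding pattern_def
  proof (intro conjI allI ballI impI)
    show "u (d + 1) t = 0" for t by (simp add: u_def)
    show "u 1 t = card {j \<in> {1..d}. mu ! (d - j) + j \<le> t}" if "t \<le> n" for t by (rule u1[OF that])
    show "u (i + 1) t \<le> u i t" if "t \<le> n" "i \<in> {1..d}" for t i using fu[OF that] f12[OF that] by auto
    show "u i t \<le> u i (t + 1)" for t i by (simp add: uS)
    fix t i assume t: "t < n" and i: "i \<in> {1..d}"
    from t have "Inv t" by (intro inv) simp
    then have b: "0 \<le> x i t" "x i t < int n" using i unfolding Inv_def by blast+
    have f: "int (?f t (x i t)) = 1 + int (u i t) - int (u (i + 1) t)" "?f t (x i t) \<in> {1, 2}"
      using fu[of t i] f12[of t i] t i by auto
    show "u i (t + 1) \<le> u (i + 1) t + 1"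
      using f S(1)[OF t b] by (auto simp: uS legal_def)
    show "x i (t + 1) = x i t \<or> x i (t + 1) = x i t - 1 \<and> u i (t + 1) = u (i + 1) t"
      using f S(1)[OF t b] by (auto simp: uS xS legal_def)
  next
    show "x i t < x (i + 1) t" if "t \<le> n" "i \<in> {1..<d}" for t i
      using inv[OF that(1)] that(2) unfolding Inv_def by blast
  qed (use x0 xn in auto)
  moreover have "realizes n d l u x"
    unfolding realizes_def
  proof (intro conjI allI ballI impI)
    show "?f t (x i t) = 1 + (u i t - u (i + 1) t)" if "t \<le> n" "i \<in> {1..d}" for t i
      using fu[OF that] f12[OF that] by auto
    show "\<exists>i\<in>{1..d}. a = x i t" if "t \<le> n" "a \<in> {0..int n - 1}" "?f t a \<noteq> 0" for t a
      using cov[of t a] that by simp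
  qed
  ultimately show ?thesis
    by (rule that) (auto simp: uS xS)
qed

section \<open>Consequences of the pattern conditions\<close>

lemma patternD:
  assumes "pattern n d lam mu nu u x"
  shows "t \<le> n \<Longrightarrow> u (d + 1) t = 0"
    and "t \<le> n \<Longrightarrow> u 1 t = card {j \<in> {1..d}. mu ! (d - j) + j \<le> t}"
    and "t \<le> n \<Longrightarrow> i \<in> {1..d} \<Longrightarrow> u (i + 1) t \<le> u i t"
    and "t < n \<Longrightarrow> i \<in> {1..d} \<Longrightarrow> u i t \<le> u i (t + 1)"
    and "t < n \<Longrightarrow> i \<in> {1..d} \<Longrightarrow> u i (t + 1) \<le> u (i + 1) t + 1"
    and "i \<in> {1..d} \<Longrightarrow> x i 0 = pos n lam i"
    and "i \<in> {1..d} \<Longrightarrow> x i n = pos n nu i"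
    and "t \<le> n \<Longrightarrow> i \<in> {1..<d} \<Longrightarrow> x i t < x (i + 1) t"
    and "t < n \<Longrightarrow> i \<in> {1..d} \<Longrightarrow> x i (t + 1) = x i t \<or> x i (t + 1) = x i t - 1 \<and> u i (t + 1) = u (i + 1) t"
  using assms unfolding pattern_def by simp_all

lemma realizesD:
  assumes "realizes n d l u x" "t \<le> n"
  shows "i \<in> {1..d} \<Longrightarrow> fall_at n l t (x i t) = 1 + (u i t - u (i + 1) t)"
    and "0 \<le> a \<Longrightarrow> a < int n \<Longrightarrow> fall_at n l t a \<noteq> 0 \<Longrightarrow> \<exists>i\<in>{1..d}. a = x i t"
  using assms unfolding realizes_def by simp_all

lemma pattern_mono:
  assumes p: "pattern n d lam mu nu u x" and "i \<in> {1..d + 1}" "s \<le> t" "t \<le> n"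
  shows "u i s \<le> u i t"
  using assms(3,4)
proof (induction t rule: dec_induct)
  case (step t)
  then show ?case using patternD(4)[OF p, of t i] patternD(1)[OF p, of t] patternD(1)[OF p, of "t + 1"] assms(2)
    by (cases "i = d + 1") auto
qed simp

lemma pattern_antimono_x:
  assumes p: "pattern n d lam mu nu u x" and i: "i \<in> {1..d}" and "s \<le> t" "t \<le> n"
  shows "x i t \<le> x i s"
  using assms(3,4)
proof (induction t rule: dec_induct)
  case (step t)
  then show ?case using patternD(9)[OF p, of t i] i by auto
qed simp

lemma pattern_bounds:
  assumes p: "pattern n d lam mu nu u x" and "d \<le> n" "lam \<in> partitions d n" "nu \<in> partitions d n"
    "i \<in> {1..d}" "t \<le> n"
  shows "0 \<le> x i t" "x i t < int n"
proof -
  have "x i n \<le> x i t" "x i t \<le> x i 0" using pattern_antimono_x[OF p] assms by auto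
  then show "0 \<le> x i t" "x i t < int n"
    using patternD(6,7)[OF p, of i] pos_bounds[OF assms(3,2), of i] pos_bounds[OF assms(4,2), of i] assms(5)
    by auto
qed

lemma pattern_zero:
  assumes p: "pattern n d lam mu nu u x" and "i \<in> {1..d + 1}"
  shows "u i 0 = 0"
proof -
  have "1 \<le> i" using assms(2) by simp
  then show ?thesis using assms(2)
  proof (induction i rule: dec_induct)
    case base
    then show ?case using patternD(2)[OF p, of 0] by auto
  next
    case (step i)
    then show ?case using patternD(3)[OF p, of 0 i] by auto
  qed
qed

lemma pattern_drop:
  assumes p: "pattern n d lam mu nu u x" and "i \<in> {1..d}" "t \<le> n"
  shows "u i t \<le> u (i + 1) t + 1"
proof (cases "t = 0")
  case True
  then show ?thesis using pattern_zero[OF p, of i] assms(2) by auto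
next
  case False
  then obtain s where s: "t = s + 1" by (metis add.commute not0_implies_Suc plus_1_eq_Suc)
  have "u i t \<le> u (i + 1) s + 1" using patternD(5)[OF p, of s i] s assms by auto
  also have "u (i + 1) s \<le> u (i + 1) t" using pattern_mono[OF p, of "i + 1" s t] s assms by auto
  finally show ?thesis by simp
qed

lemma pattern_final:
  assumes p: "pattern n d lam mu nu u x" and mu: "mu \<in> partitions d n" and "d \<le> n" and i: "i \<in> {1..d + 1}"
  shows "u i n + i = d + 1"
proof -
  have "mu ! (d - j) + j \<le> n" if "j \<in> {1..d}" for j
    using partitions_nth_le[OF mu, of "d - j"] that assms(3) by auto
  then have "{j \<in> {1..d}. mu ! (d - j) + j \<le> n} = {1..d}" by auto
  then have "u 1 n = d" using patternD(2)[OF p, of n] by simp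
  then show ?thesis
    using unit_steps[of "\<lambda>i. u i n" d i] patternD(1)[OF p, of n] pattern_drop[OF p, of _ n] i by auto
qed

text \<open>The positions are the nonzero places of a line in increasing order. The labels there
  give the differences \<open>u i t - u (i + 1) t\<close>, which are summed up starting from
  \<open>u (d + 1) t = 0\<close>.\<close>

lemma realizes_unique:
  assumes p: "pattern n d lam mu nu u x" and p': "pattern n d lam mu nu u' x'"
    and r: "realizes n d l u x" and r': "realizes n d l u' x'"
    and d: "d \<le> n" "lam \<in> partitions d n" "nu \<in> partitions d n" and t: "t \<le> n"
  shows "\<forall>i\<in>{1..d}. x i t = x' i t" and "\<forall>i\<in>{1..d + 1}. u i t = u' i t"
proof -
  have im: "(\<lambda>i. x i t) ` {1..d} = {a. 0 \<le> a \<and> a < int n \<and> fall_at n l t a \<noteq> 0}"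
    if "pattern n d lam mu nu u x" "realizes n d l u x" for u x
  proof (intro equalityI subsetI)
    fix a assume "a \<in> (\<lambda>i. x i t) ` {1..d}"
    then obtain i where i: "i \<in> {1..d}" "a = x i t" by blast
    then have "fall_at n l t a = 1 + (u i t - u (i + 1) t)" using realizesD(1)[OF that(2) t] by blast
    then show "a \<in> {a. 0 \<le> a \<and> a < int n \<and> fall_at n l t a \<noteq> 0}"
      using pattern_bounds[OF that(1) d i(1) t] i by simp
  next
    fix a assume a: "a \<in> {a. 0 \<le> a \<and> a < int n \<and> fall_at n l t a \<noteq> 0}"
    then have "\<exists>i\<in>{1..d}. a = x i t" using realizesD(2)[OF that(2) t] by blast
    then show "a \<in> (\<lambda>i. x i t) ` {1..d}" by blast
  qed
  show x: "\<forall>i\<in>{1..d}. x i t = x' i t"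
  proof
    fix i assume i: "i \<in> {1..d}"
    show "x i t = x' i t"
      using patternD(8)[OF p t] patternD(8)[OF p' t] im[OF p r] im[OF p' r'] i
      by (intro increasing_unique[of d "\<lambda>i. x i t" "\<lambda>i. x' i t" i]) auto
  qed
  show "\<forall>i\<in>{1..d + 1}. u i t = u' i t"
  proof
    fix i assume i: "i \<in> {1..d + 1}"
    then have "i \<le> d + 1" by auto
    then show "u i t = u' i t" using i
    proof (induction i rule: inc_induct)
      case base
      show ?case using patternD(1)[OF p t] patternD(1)[OF p' t] by simp
    next
      case (step i)
      then have i: "i \<in> {1..d}" by auto
      then have "1 + (u i t - u (i + 1) t) = 1 + (u' i t - u' (i + 1) t)"
        using realizesD(1)[OF r t i] realizesD(1)[OF r' t i] x by simp
      then show ?case using patternD(3)[OF p t i] patternD(3)[OF p' t i] step by auto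
    qed
  qed
qed

lemma realizes_final:
  assumes p: "pattern n d lam mu nu u x" and r: "realizes n d l u x" and mu: "mu \<in> partitions d n" "d \<le> n"
    and a: "0 \<le> a" "a < int n"
  shows "fall_at n l n a \<in> {0, 2}"
proof (cases "fall_at n l n a = 0")
  case False
  then obtain i where i: "i \<in> {1..d}" "a = x i n" using realizesD(2)[OF r order_refl] a by blast
  then have "fall_at n l n a = 1 + (u i n - u (i + 1) n)" using realizesD(1)[OF r order_refl] by blast
  then show ?thesis using pattern_final[OF p mu, of i] pattern_final[OF p mu, of "i + 1"] i by auto
qed simp

section \<open>A pattern determines its puzzle\<close>

lemma pieces_cong:
  assumes "\<And>a b. Upw a b \<in> R \<Longrightarrow> up_labels l a b = up_labels l' a b"
    "\<And>a b. Dnw a b \<in> R \<Longrightarrow> dn_labels l a b = dn_labels l' a b"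
  shows "pieces R l = pieces R l'"
proof -
  have "(p, a, b) \<in> pieces R l \<longleftrightarrow> (p, a, b) \<in> pieces R l'" for p a b
    using assms[of a b] by (cases "p \<in> {Dn0, Dn1}") (auto simp: pieces_def)
  then show ?thesis by (auto simp: set_eq_iff)
qed

lemma strip_legal_full:
  assumes "proper (trapezoid n) l" "t < n" "0 \<le> a" "a < int n"
  shows "legal (hor_at n l t a) (rise_at n l t a) (fall_at n l t a)"
    and "legal (hor_at n l t a) (rise_at n l t (a + 1)) (fall_at n l (t + 1) a)"
  using strip_legal[OF assms(1,3,4), of t] assms(2,4) by auto

lemma legal_unique:
  "legal h r f \<Longrightarrow> legal h' r f \<Longrightarrow> h = h'"
  "legal h r f \<Longrightarrow> legal h r' f \<Longrightarrow> r = r'"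
  by (auto simp: legal_def)

text \<open>The pattern prescribes all falling labels on the lines up to \<open>n\<close>. Within a
  strip, the rising and falling label of a triangle fix its horizontal label, and this with the
  falling label on the next line fixes the next rising label; the start is the NW side. Below line
  \<open>n\<close>, \<open>lower_forced\<close> takes over.\<close>

lemma pattern_puzzle_unique:
  assumes p: "pattern n d lam mu nu u x"
    and l: "proper (trapezoid n) l" "boundary_labels n d lam mu nu l" "realizes n d l u x"
    and l': "proper (trapezoid n) l'" "boundary_labels n d lam mu nu l'" "realizes n d l' u x"
    and d: "d \<le> n" "mu \<in> partitions d n"
  shows "pieces (trapezoid n) l = pieces (trapezoid n) l'"
proof -
  have F: "fall_at n l t a = fall_at n l' t a" if "t \<le> n" "0 \<le> a" "a < int n" for t a
  proof -
    show ?thesis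
    proof (cases "\<exists>i\<in>{1..d}. a = x i t")
      case True
      then show ?thesis using realizesD(1)[OF l(3) that(1)] realizesD(1)[OF l'(3) that(1)] by auto
    next
      case False
      then have "fall_at n l t a = 0" "fall_at n l' t a = 0"
        using realizesD(2)[OF l(3) that] realizesD(2)[OF l'(3) that] by blast+
      then show ?thesis by simp
    qed
  qed
  have R: "rise_at n l t a = rise_at n l' t a" if "t < n" "0 \<le> a" "a \<le> int n" for t a
    using that(2,3)
  proof (induction a rule: int_ge_induct)
    case base
    have "rise_at n m t 0 \<le> 1" if "proper (trapezoid n) m" for m
      unfolding rise_at_def by (rule properD(4)[OF that]) (use \<open>t < n\<close> in \<open>auto simp: Upw_trapezoid Dnw_trapezoid\<close>)
    moreover have "rise_at n l t 0 = 1 \<longleftrightarrow> rise_at n l' t 0 = 1"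
      using l(2) l'(2) \<open>t < n\<close> unfolding rise_at_def boundary_labels_def by auto
    ultimately show ?case using l(1) l'(1) by (metis One_nat_def le_Suc_eq le_zero_eq)
  next
    case (step a)
    then have a: "0 \<le> a" "a < int n" by auto
    have "fall_at n l t a = fall_at n l' t a" "fall_at n l (t + 1) a = fall_at n l' (t + 1) a"
      using F a \<open>t < n\<close> by auto
    then show ?case
      using strip_legal_full[OF l(1) \<open>t < n\<close> a] strip_legal_full[OF l'(1) \<open>t < n\<close> a] step legal_unique by simp metis
  qed
  have H: "hor_at n l t a = hor_at n l' t a" if "t < n" "0 \<le> a" "a < int n" for t a
    using strip_legal_full(1)[OF l(1) that] strip_legal_full(1)[OF l'(1) that] R[of t a] F[of t a] that
      legal_unique(1) by simp
  note low = lower_forced[OF l(1) realizes_final[OF p l(3) d(2,1)]]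
  note low' = lower_forced[OF l'(1) realizes_final[OF p l'(3) d(2,1)]]
  have low_eq: "fall_at n l t a = fall_at n l' t a \<and> rise_at n l t a = rise_at n l' t a \<and> hor_at n l t a = hor_at n l' t a"
    if "n \<le> t" "0 \<le> a" "a + int t \<le> 2 * int n - 1" for t a
    using low[OF _ _ that] low'[OF _ _ that] F[of n a] that by auto
  have all: "(0 \<le> a \<and> a < int n \<longrightarrow> fall_at n l t a = fall_at n l' t a \<and> hor_at n l t a = hor_at n l' t a) \<and>
      rise_at n l t a = rise_at n l' t a"
    if "0 \<le> a" "a \<le> int n" "n \<le> t \<longrightarrow> a + int t \<le> 2 * int n - 1" for t a
    using F[of t a] R[of t a] H[of t a] low_eq[of t a] that by (cases "t < n") auto
  show ?thesis
  proof (rule pieces_cong)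
    fix a b assume "Upw a b \<in> trapezoid n"
    then have c: "0 \<le> a" "a < int n" "- int n \<le> b" "a + b \<le> int n - 1" by (auto simp: Upw_trapezoid)
    let ?t = "nat (int n - 1 - a - b)"
    have b: "b = int n - 1 - int ?t - a" using c by auto
    show "up_labels l a b = up_labels l' a b"
      using all[of a ?t] c unfolding fall_at_def hor_at_def rise_at_def b[symmetric] up_labels_def by auto
  next
    fix a b assume "Dnw a b \<in> trapezoid n"
    then have c: "0 \<le> a" "a < int n" "- int n \<le> b" "a + b \<le> int n - 2" by (auto simp: Dnw_trapezoid)
    let ?t = "nat (int n - 2 - a - b)"
    have b: "b + 1 = int n - 1 - int ?t - a" "b = int n - 1 - int ?t - (a + 1)"
       "b = int n - 1 - int (?t + 1) - a" using c by auto
    have "fall_at n l (?t + 1) a = fall_at n l' (?t + 1) a"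
      using all[of a "?t + 1"] c F[of "?t + 1" a] by (cases "?t < n") auto
    then show "dn_labels l a b = dn_labels l' a b"
      using all[of a ?t] all[of "a + 1" ?t] c 
      unfolding fall_at_def hor_at_def rise_at_def b(1)[symmetric] b(2)[symmetric] b(3)[symmetric] dn_labels_def by auto
  qed
qed

text \<open>The labels have no choice, so they are given by formulas. By \<open>strip_zeros\<close>
  a rising edge must carry 1 exactly if the next path to its right has its upward 1-triangle in this
  strip, and it carries 2 if that path sits right at the edge and moves left. What has to be checked
  is that every triangle becomes legal, which uses interlacing and the order of the
  positions.\<close>

lemma pattern_puzzle:
  assumes p: "pattern n d lam mu nu u x" and d: "1 \<le> d" "d \<le> n"
    and lam: "lam \<in> partitions d n" and mu: "mu \<in> partitions d n" and nu: "nu \<in> partitions d n"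
  obtains l where "proper (trapezoid n) l" "boundary_labels n d lam mu nu l" "realizes n d l u x"
proof -
  \<comment> \<open>The index of the first path at or to the right of \<open>a\<close> on line
    \<open>t\<close>, and \<open>d + 1\<close> if there is none.\<close>
  define k where "k t a = card {i \<in> {1..d}. x i t < a} + 1" for t a
  define F where "F t a = (if \<exists>i\<in>{1..d}. x i t = a then 1 + (u (k t a) t - u (k t a + 1) t) else 0)" for t a
  define R where "R t a = (if k t a \<le> d \<and> u (k t a) (t + 1) = u (k t a) t + 1 then 1
     else if k t a \<le> d \<and> x (k t a) t = a \<and> x (k t a) (t + 1) = a - 1 then 2 else 0 :: nat)" for t a
  \<comment> \<open>The value that completes the falling and rising label to a legal upward
    triangle.\<close>
  define H where "H t a = (if F t a = 0 then if R t a = 1 then 2 else 0 else if F t a = 2 then 1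
     else if R t a = 1 then 1 else if R t a = 2 then 0 else 3 :: nat)" for t a
  have lt: "x i t < x j t" if "t \<le> n" "1 \<le> i" "i < j" "j \<le> d" for i j t
    using less_chain[of d "\<lambda>i. x i t" i j, OF patternD(8)[OF p that(1)]] that by blast
  have le: "x i t \<le> x j t" if "t \<le> n" "1 \<le> i" "i \<le> j" "j \<le> d" for i j t
    using le_chain[of d "\<lambda>i. x i t" i j, OF patternD(8)[OF p that(1)]] that by blast
  note xb = pattern_bounds[OF p d(2) lam nu]
  have kI: "k t a = j" if "t \<le> n" "j \<in> {1..d + 1}" "j = 1 \<or> x (j - 1) t < a" "j = d + 1 \<or> a \<le> x j t" for t a j
  proof -
    have "{i \<in> {1..d}. x i t < a} = {1..<j}"
    proof (intro equalityI subsetI)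
      fix i assume i: "i \<in> {i \<in> {1..d}. x i t < a}"
      show "i \<in> {1..<j}"
      proof (rule ccontr)
        assume "i \<notin> {1..<j}"
        then have "x j t \<le> x i t" using i that by (intro le) auto
        then show False using i that \<open>i \<notin> {1..<j}\<close> by auto
      qed
    next
      fix i assume i: "i \<in> {1..<j}"
      then have "x i t \<le> x (j - 1) t" using that by (intro le) auto
      then show "i \<in> {i \<in> {1..d}. x i t < a}" using i that by auto
    qed
    then show ?thesis using that(2) unfolding k_def by auto
  qed
  have kx: "k t (x i t) = i" if "t \<le> n" "i \<in> {1..d}" for t i
    using that lt[of t "i - 1" i] by (intro kI; cases "i = 1") auto
  have kx1: "k t (x i t + 1) = i + 1" if "t \<le> n" "i \<in> {1..d}" for t i
    using that lt[of t i "i + 1"] by (intro kI; cases "i = d") auto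
  have k0: "k t 0 = 1" if "t \<le> n" for t
    using that xb[of 1 t] d by (intro kI) auto
  have kn: "k t (int n) = d + 1" if "t \<le> n" for t
    using that xb[of d t] d by (intro kI) auto
  have kle: "a \<le> x (k t a) t" if "t \<le> n" "k t a \<le> d" for t a
  proof (rule ccontr)
    assume "\<not> a \<le> x (k t a) t"
    then have "{1..k t a} \<subseteq> {i \<in> {1..d}. x i t < a}"
      using that le[of t _ "k t a"] by fastforce
    then have "card {1..k t a} \<le> card {i \<in> {1..d}. x i t < a}" by (intro card_mono) auto
    then show False by (simp add: k_def)
  qed
  have klt: "x i t < a" if "t \<le> n" "1 \<le> i" "i < k t a" for t a i
  proof (rule ccontr)
    assume "\<not> x i t < a"
    then have "j < i" if "j \<in> {1..d}" "x j t < a" for j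
      using le[of t i j] \<open>t \<le> n\<close> \<open>1 \<le> i\<close> that by (cases "j < i") auto
    then have "{j \<in> {1..d}. x j t < a} \<subseteq> {1..<i}" by auto
    then have "card {j \<in> {1..d}. x j t < a} \<le> card {1..<i}" by (intro card_mono) auto
    then show False using that by (simp add: k_def)
  qed
  have k1: "1 \<le> k t a" "k t a \<le> d + 1" for t a
  proof -
    have "card {i \<in> {1..d}. x i t < a} \<le> card {1..d}" by (intro card_mono) auto
    then show "1 \<le> k t a" "k t a \<le> d + 1" by (auto simp: k_def)
  qed
  have Fx: "F t (x i t) = 1 + (u i t - u (i + 1) t)" if "t \<le> n" "i \<in> {1..d}" for t i
    using that kx[OF that] unfolding F_def by auto
  have F0: "F t a = 0" if "\<And>i. i \<in> {1..d} \<Longrightarrow> x i t \<noteq> a" for t a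
    using that unfolding F_def by auto
  have mv: "x i (t + 1) = x i t \<or> x i (t + 1) = x i t - 1 \<and> u i (t + 1) = u (i + 1) t" if "t < n" "i \<in> {1..d}" for i t
    using patternD(9)[OF p that] .
  have sg: "u i t \<le> u i (t + 1)" "u i (t + 1) \<le> u i t + 1" "u (i + 1) t \<le> u i t" "u i t \<le> u (i + 1) t + 1"
     "u (i + 1) (t + 1) \<le> u i (t + 1)" "u i (t + 1) \<le> u (i + 1) t + 1"
    if "t < n" "i \<in> {1..d}" for i t
    using patternD(3,4,5)[OF p, of t i] patternD(3)[OF p, of "t + 1" i] pattern_drop[OF p that(2), of t] that by auto
  have L: "legal (H t a) (R t a) (F t a) \<and> legal (H t a) (R t (a + 1)) (F (t + 1) a)"
    if t: "t < n" and a: "0 \<le> a" "a < int n" for t a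
  proof (cases "\<exists>i\<in>{1..d}. x i t = a")
    case True
    then obtain i where i: "i \<in> {1..d}" "a = x i t" by blast
    have tn: "t \<le> n" "t + 1 \<le> n" using t by auto
    note sg = sg[OF t i(1)] and mvi = mv[OF t i(1)]
    have ka: "k t a = i" "k t (a + 1) = i + 1" using kx[OF tn(1) i(1)] kx1[OF tn(1) i(1)] i(2) by auto
    have Fa: "F t a = 1 + (u i t - u (i + 1) t)" using Fx[OF tn(1) i(1)] i(2) by simp
    have Ra: "R t a = (if u i (t + 1) = u i t + 1 then 1 else if x i (t + 1) = a - 1 then 2 else 0)"
      unfolding R_def ka using i by auto
    have lt1: "x i (t + 1) < x (i + 1) (t + 1)" if "i < d" using lt[OF tn(2), of i "i + 1"] that i by auto
    have Ra1: "R t (a + 1) = (if i < d \<and> u (i + 1) (t + 1) = u (i + 1) t + 1 then 1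
        else if i < d \<and> x (i + 1) t = a + 1 \<and> x (i + 1) (t + 1) = a then 2 else 0)"
      unfolding R_def ka by auto
    have u': "u (i + 1) (t + 1) = u (i + 1) t + (if i < d \<and> u (i + 1) (t + 1) = u (i + 1) t + 1 then 1 else 0)"
    proof (cases "i = d")
      case True
      then show ?thesis using patternD(1)[OF p tn(1)] patternD(1)[OF p tn(2)] by simp
    next
      case False
      then have "i + 1 \<in> {1..d}" "i < d" using i by auto
      then show ?thesis using \<open>\<And>t i. t < n \<Longrightarrow> i \<in> {1..d} \<Longrightarrow> u i t \<le> u i (t + 1)\<close>[OF t, of "i + 1"]
         \<open>\<And>t i. t < n \<Longrightarrow> i \<in> {1..d} \<Longrightarrow> u i (t + 1) \<le> u i t + 1\<close>[OF t, of "i + 1"] by auto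
    qed
    show ?thesis
    proof (cases "x i (t + 1) = a")
      case stay: True
      have Fa1: "F (t + 1) a = 1 + (u i (t + 1) - u (i + 1) (t + 1))" using Fx[OF tn(2) i(1)] stay by simp
      have nm: "\<not> (i < d \<and> x (i + 1) t = a + 1 \<and> x (i + 1) (t + 1) = a)" using lt1 stay by auto
      show ?thesis
        unfolding H_def Fa Ra Ra1 Fa1 if_not_P[OF nm] legal_def using sg u' stay by (auto split: if_splits)
    next
      case False
      then have mvd: "x i (t + 1) = a - 1" "u i (t + 1) = u (i + 1) t" using mvi i by auto
      then have eq: "u i t = u i (t + 1)" "u (i + 1) (t + 1) = u (i + 1) t" using sg u' by (auto split: if_splits)
      have H0: "F t a = 1" "R t a = 2" "H t a = 0" using Fa Ra mvd eq by (auto simp: H_def)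
      \<comment> \<open>Path \<open>i\<close> leaves position \<open>a\<close>, so the label there
        on the next line depends on whether path \<open>i + 1\<close> moves in from
        \<open>a + 1\<close>.\<close>
      show ?thesis
      proof (cases "i < d \<and> x (i + 1) t = a + 1 \<and> x (i + 1) (t + 1) = a")
        case True
        then have i1: "i + 1 \<in> {1..d}" by auto
        then have "u (i + 1) (t + 1) = u (i + 2) t" using mv[OF t i1] True by auto
        moreover have "u (i + 2) t \<le> u (i + 2) (t + 1)"
          using pattern_mono[OF p, of "i + 2" t "t + 1"] i1 tn by auto
        moreover have "F (t + 1) a = 1 + (u (i + 1) (t + 1) - u (i + 2) (t + 1))"
          using Fx[OF tn(2) i1] True by simp
        ultimately show ?thesis using H0 Ra1 eq True by (auto simp: legal_def)
      next
        case nm: False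
        have "F (t + 1) a = 0"
        proof (rule F0)
          fix j assume j: "j \<in> {1..d}"
          show "x j (t + 1) \<noteq> a"
          proof (cases "j \<le> i")
            case True
            then show ?thesis using le[OF tn(2), of j i] mvd i j by auto
          next
            case False
            then have "x (i + 1) (t + 1) \<le> x j (t + 1)" "x i t < x (i + 1) t" 
              using le[OF tn(2), of "i + 1" j] lt[OF tn(1), of i "i + 1"] i j by auto
            moreover have "x (i + 1) (t + 1) \<noteq> a" using nm mv[OF t, of "i + 1"] i j False \<open>x i t < x (i + 1) t\<close> by auto
            moreover have "x (i + 1) t - 1 \<le> x (i + 1) (t + 1)" using mv[OF t, of "i + 1"] j i False by auto
            ultimately show ?thesis using i by auto
          qed
        qed
        moreover have "R t (a + 1) = 0" using Ra1 nm eq by auto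
        ultimately show ?thesis using H0 by (auto simp: legal_def)
      qed
    qed
  next
    case False
    have tn: "t \<le> n" "t + 1 \<le> n" using t by auto
    let ?i = "k t a"
    \<comment> \<open>As no path is at \<open>a\<close>, the next path is the same for both rising
      edges.\<close>
    have ka: "k t (a + 1) = ?i"
    proof (rule kI[OF tn(1)])
      show "?i \<in> {1..d + 1}" using k1 by auto
      have "x (?i - 1) t < a" if "?i \<noteq> 1"
        using that k1(1)[of t a] by (intro klt[OF tn(1)]) linarith+
      then show "?i = 1 \<or> x (?i - 1) t < a + 1" by force
      have "x ?i t \<noteq> a" if "?i \<le> d" using False k1(1)[of t a] that by auto
      then show "?i = d + 1 \<or> a + 1 \<le> x ?i t" using kle[OF tn(1), of a] k1(2)[of t a] by (cases "?i = d + 1") force+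
    qed
    have Fa: "F t a = 0" using False by (intro F0) auto
    have Ra: "R t a = (if ?i \<le> d \<and> u ?i (t + 1) = u ?i t + 1 then 1 else 0)"
      using False k1(1)[of t a] unfolding R_def by auto
    have Ra1: "R t (a + 1) = (if ?i \<le> d \<and> u ?i (t + 1) = u ?i t + 1 then 1
      else if ?i \<le> d \<and> x ?i t = a + 1 \<and> x ?i (t + 1) = a then 2 else 0)"
      unfolding R_def ka by auto
    have Fz: "F (t + 1) a = 0" if nm: "\<not> (?i \<le> d \<and> x ?i t = a + 1 \<and> x ?i (t + 1) = a)"
    proof (rule F0)
      fix j assume j: "j \<in> {1..d}"
      show "x j (t + 1) \<noteq> a"
      proof (cases "j < ?i")
        case True
        then show ?thesis using klt[OF tn(1), of j a] mv[OF t j] j by auto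
      next
        case False
        then have "?i \<le> d" "?i \<in> {1..d}" using j k1[of t a] by auto
        then have "a < x ?i t" using kle[OF tn(1)] \<open>\<not> (\<exists>i\<in>{1..d}. x i t = a)\<close> by force
        then have "a < x ?i (t + 1)" using mv[OF t \<open>?i \<in> {1..d}\<close>] nm \<open>?i \<le> d\<close> by auto
        then show ?thesis using le[OF tn(2), of ?i j] False j k1(1)[of t a] by auto
      qed
    qed
    show ?thesis
    proof (cases "?i \<le> d \<and> x ?i t = a + 1 \<and> x ?i (t + 1) = a")
      case True
      then have i: "?i \<in> {1..d}" using k1(1)[of t a] by auto
      have "u ?i (t + 1) = u (?i + 1) t" using mv[OF t i] True by auto
      moreover have "u (?i + 1) t \<le> u (?i + 1) (t + 1)" using pattern_mono[OF p, of "?i + 1" t "t + 1"] i tn by auto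
      moreover have "F (t + 1) a = 1 + (u ?i (t + 1) - u (?i + 1) (t + 1))" using Fx[OF tn(2) i] True by simp
      ultimately show ?thesis using Fa Ra Ra1 True sg[OF t i] by (auto simp: H_def legal_def)
    next
      case nm: False
      then show ?thesis using Fa Ra Ra1 Fz[OF nm] by (auto simp: H_def legal_def)
    qed
  qed
  have Fn: "F n a \<in> {0, 2}" for a
  proof (cases "\<exists>i\<in>{1..d}. x i n = a")
    case True
    then obtain i where i: "i \<in> {1..d}" "a = x i n" by blast
    then show ?thesis using Fx[of n i] pattern_final[OF p mu d(2), of i] pattern_final[OF p mu d(2), of "i + 1"] by auto
  qed (use F0 in auto)
  \<comment> \<open>Edges with \<open>a + b \<ge> 0\<close> belong to strips with
    \<open>t < n\<close>, and falling edges with \<open>a + b = - 1\<close> lie on line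
    \<open>n\<close>. Everything further down repeats line \<open>n\<close>: columns of 0-triangles
    and columns of \<open>RhHR\<close>.\<close>
  define l where "l e = (case e of
      Hor a b \<Rightarrow> if a + b \<ge> 0 then H (nat (int n - 1 - a - b)) a else if F n a = 0 then 0 else 1
    | Rise a b \<Rightarrow> if a + b \<ge> 0 then R (nat (int n - 1 - a - b)) a else 0
    | Fall a b \<Rightarrow> if a + b \<ge> - 1 then F (nat (int n - 1 - a - b)) a else F n a)" for e
  have R0: "R t 0 = (if u 1 (t + 1) = u 1 t + 1 then 1 else 0)" if "t < n" for t
    using k0[of t] xb[of 1 "t + 1"] that d unfolding R_def by auto
  have Rn: "R t (int n) = 0" if "t < n" for t
    using kn[of t] that unfolding R_def by auto
  have fl: "fall_at n l t a = F t a" if "t \<le> n" for t a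
    using that unfolding fall_at_def l_def by auto
  have F01: "F 0 a = (if \<exists>i\<in>{1..d}. a = pos n lam i then 1 else 0)" for a
  proof (cases "\<exists>i\<in>{1..d}. a = pos n lam i")
    case True
    then obtain i where i: "i \<in> {1..d}" "a = x i 0" using patternD(6)[OF p] by auto
    then have "F 0 a = 1" using Fx[of 0 i] pattern_zero[OF p, of i] by auto
    then show ?thesis using True by simp
  next
    case False
    then have "F 0 a = 0" using patternD(6)[OF p] by (intro F0) auto
    then show ?thesis using False by simp
  qed
  have low: "legal (if F n a = 0 then 0 else 1) 0 (F n a)" for a
    using Fn[of a] by (auto simp: legal_def)
  have "proper (trapezoid n) l"
    unfolding proper_def
  proof (intro conjI allI impI)
    fix a b assume "Upw a b \<in> trapezoid n"
    then have c: "0 \<le> a" "a < int n" "a + b \<le> int n - 1" by (auto simp: Upw_trapezoid)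
    show "legal (l (Hor a b)) (l (Rise a b)) (l (Fall a b))"
    proof (cases "0 \<le> a + b")
      case True
      then have "nat (int n - 1 - a - b) < n" using c by auto
      from L[OF this c(1,2)] True show ?thesis by (auto simp: l_def)
    next
      case False
      have "nat (int n - 1 - a - b) = n" if "a + b = - 1" using that by linarith
      then have "l (Fall a b) = F n a" using False by (cases "a + b = - 1") (auto simp: l_def)
      then show ?thesis using low[of a] False by (auto simp: l_def)
    qed
  next
    fix a b assume "Dnw a b \<in> trapezoid n"
    then have c: "0 \<le> a" "a < int n" "a + b \<le> int n - 2" by (auto simp: Dnw_trapezoid)
    show "legal (l (Hor a (b + 1))) (l (Rise (a + 1) b)) (l (Fall a b))"
    proof (cases "0 \<le> a + b + 1")
      case True
      let ?t = "nat (int n - 2 - a - b)"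
      have "?t < n" using c True by auto
      from L[OF this c(1,2)] have "legal (H ?t a) (R ?t (a + 1)) (F (?t + 1) a)" by blast
      moreover have "nat (int n - 1 - a - (b + 1)) = ?t" "nat (int n - 1 - (a + 1) - b) = ?t"
        "nat (int n - 1 - a - b) = ?t + 1" using c True by auto
      ultimately show ?thesis using True by (simp add: l_def algebra_simps)
    next
      case False
      then show ?thesis using low[of a] by (auto simp: l_def)
    qed
  next
    fix a b assume "(Upw a b \<in> trapezoid n) \<noteq> (Dnw a (b - 1) \<in> trapezoid n)"
    then have "a < int n" "b = - int n" by (auto simp: Upw_trapezoid Dnw_trapezoid)
    then show "l (Hor a b) \<le> 1" by (simp add: l_def)
  next
    fix a b assume "(Upw a b \<in> trapezoid n) \<noteq> (Dnw (a - 1) b \<in> trapezoid n)"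
    then have c: "a = 0 \<and> - int n \<le> b \<and> b \<le> int n - 1 \<or> a = int n \<and> - int n \<le> b \<and> b \<le> - 1"
      by (auto simp: Upw_trapezoid Dnw_trapezoid)
    show "l (Rise a b) \<le> 1"
    proof (cases "0 \<le> a + b")
      case True
      then have "nat (int n - 1 - a - b) < n" using c by auto
      then show ?thesis using c R0 Rn by (auto simp: l_def)
    qed (simp add: l_def)
  next
    fix a b assume "(Upw a b \<in> trapezoid n) \<noteq> (Dnw a b \<in> trapezoid n)"
    then have "b = int n - 1 - a" by (auto simp: Upw_trapezoid Dnw_trapezoid)
    then show "l (Fall a b) \<le> 1" using F01[of a] by (simp add: l_def)
  qed
  moreover have "boundary_labels n d lam mu nu l"
    unfolding boundary_labels_def
  proof (intro conjI ballI)
    fix b assume b: "b \<in> {- int n..- 1}"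
    show "l (Rise 0 b) = 0" using b by (simp add: l_def)
    show "l (Rise (int n) b) = 0" using b Rn by (auto simp: l_def)
  next
    fix a assume a: "a \<in> {0..int n - 1}"
    show "l (Fall a (int n - 1 - a)) = 1 \<longleftrightarrow> (\<exists>i\<in>{1..d}. a = pos n lam i)"
      using F01[of a] by (simp add: l_def)
    have "F n a \<noteq> 0 \<longleftrightarrow> (\<exists>i\<in>{1..d}. a = pos n nu i)"
      using patternD(7)[OF p] by (auto simp: F_def)
    moreover have "l (Hor a (- int n)) = (if F n a = 0 then 0 else 1)"
      using a by (simp add: l_def)
    ultimately show "l (Hor a (- int n)) = 1 \<longleftrightarrow> (\<exists>i\<in>{1..d}. a = pos n nu i)"
      by (metis zero_neq_one)
    let ?t = "nat (int n - 1 - a)"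
    have t: "?t < n" using a by auto
    let ?P = "\<lambda>s. \<exists>i\<in>{1..d}. int n - 1 - int s = pos n mu i"
    have c: "u 1 s = card {s'. s' < s \<and> ?P s'}" if "s \<le> n" for s
      using patternD(2)[OF p that] pos_mu_count[OF mu d(2) that] by simp
    have "u 1 (?t + 1) = u 1 ?t + (if ?P ?t then 1 else 0)"
      using c[of ?t] c[of "Suc ?t"] t card_less_Suc_if[of ?t ?P] by simp
    then have "R ?t 0 = 1 \<longleftrightarrow> ?P ?t" using R0[OF t] by simp
    then show "l (Rise 0 a) = 1 \<longleftrightarrow> (\<exists>i\<in>{1..d}. a = pos n mu i)"
      using a by (simp add: l_def)
  qed
  moreover have "realizes n d l u x"
    unfolding realizes_def
  proof (intro conjI allI ballI impI)
    show "fall_at n l t (x i t) = 1 + (u i t - u (i + 1) t)" if "t \<le> n" "i \<in> {1..d}" for t i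
      using fl[OF that(1)] Fx[OF that] by simp
    show "\<exists>i\<in>{1..d}. a = x i t" if "t \<le> n" "fall_at n l t a \<noteq> 0" for t a
      using fl[OF that(1), of a] that(2) F0[of t a] by force
  qed
  ultimately show ?thesis by (rule that)
qed

section \<open>Reading words of tableaux\<close>

text \<open>Only a letter \<open>k + 1\<close> can break the inequality for \<open>k\<close>, so it
  suffices to look at the prefixes ending in such a letter.\<close>

lemma yamanouchi_iff_nth:
  "yamanouchi d w \<longleftrightarrow> (\<forall>p<length w. \<forall>k\<in>{1..<d}. w ! p = k + 1 \<longrightarrow>
     count_list (take (Suc p) w) (k + 1) \<le> count_list (take (Suc p) w) k)"
proof
  assume R: "\<forall>p<length w. \<forall>k\<in>{1..<d}. w ! p = k + 1 \<longrightarrow>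
     count_list (take (Suc p) w) (k + 1) \<le> count_list (take (Suc p) w) k"
  have "count_list (take m w) (k + 1) \<le> count_list (take m w) k" if "m \<le> length w" "k \<in> {1..<d}" for m k
    using that(1)
  proof (induction m)
    case (Suc m)
    show ?case
    proof (cases "w ! m = k + 1")
      case True
      then show ?thesis using R Suc that by auto
    next
      case False
      then show ?thesis using Suc by (auto simp: take_Suc_conv_app_nth)
    qed
  qed simp
  then show "yamanouchi d w" unfolding yamanouchi_def by blast
qed (auto simp: yamanouchi_def)

section \<open>Initial parts of a reading word as sets of boxes\<close>

lemma sorted_wrt_asym_distinct:
  assumes "sorted_wrt P bs" "asymp P"
  shows "distinct bs"
  using assms by (induction bs) (auto dest: asympD)

lemma set_take_sorted_wrt:
  assumes "sorted_wrt P bs" "asymp P" "q < length bs"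
  shows "set (take (Suc q) bs) = {b \<in> set bs. P b (bs ! q) \<or> b = bs ! q}"
proof (intro equalityI subsetI)
  fix b assume "b \<in> set (take (Suc q) bs)"
  then obtain m where "m < Suc q" "b = bs ! m" using assms(3) by (auto simp: in_set_conv_nth)
  then have m: "m \<le> q" "b = bs ! m" by auto
  then show "b \<in> {b \<in> set bs. P b (bs ! q) \<or> b = bs ! q}"
    using assms(1,3) by (cases "m = q") (auto simp: sorted_wrt_iff_nth_less)
next
  fix b assume b: "b \<in> {b \<in> set bs. P b (bs ! q) \<or> b = bs ! q}"
  then obtain m where m: "m < length bs" "b = bs ! m" by (auto simp: in_set_conv_nth)
  have "m \<le> q"
  proof (rule ccontr)
    assume "\<not> m \<le> q"
    then have "P (bs ! q) b" using assms(1) m by (auto simp: sorted_wrt_iff_nth_less)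
    then show False using b asympD[OF assms(2)] by blast
  qed
  then show "b \<in> set (take (Suc q) bs)" using m by (auto simp: in_set_conv_nth)
qed

lemma set_takeWhile_sorted_wrt:
  assumes "sorted_wrt P bs" "asymp P" "b \<in> set bs"
  shows "set (takeWhile (\<lambda>x. x \<noteq> b) bs) = {a \<in> set bs. P a b}"
  using assms(1,3)
proof (induction bs)
  case (Cons a bs)
  then show ?case using asympD[OF assms(2)] by auto
qed simp

lemma count_list_map_distinct:
  assumes "distinct bs"
  shows "count_list (map f bs) v = card {b \<in> set bs. f b = v}"
proof -
  have "count_list (map f bs) v = length (filter (\<lambda>b. f b = v) bs)"
    by (induction bs) auto
  also have "\<dots> = card (set (filter (\<lambda>b. f b = v) bs))"
    using distinct_card[OF distinct_filter[OF assms, of "\<lambda>b. f b = v"]] by metis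
  finally show ?thesis by simp
qed

text \<open>The boxes read up to \<open>b\<close> are those that are \<open>P\<close>-below
  \<open>b\<close> together with \<open>b\<close>, so counting letters in prefixes becomes counting
  boxes in a set; the word \<open>w\<close> in front contributes constants.\<close>

lemma yamanouchi_append_boxes:
  assumes s: "sorted_wrt P bs" and P: "asymp P"
  shows "yamanouchi d (w @ map f bs) \<longleftrightarrow> yamanouchi d w \<and>
    (\<forall>b\<in>set bs. \<forall>k\<in>{1..<d}. f b = k + 1 \<longrightarrow>
       count_list w (k + 1) + card {a \<in> set bs. (P a b \<or> a = b) \<and> f a = k + 1}
       \<le> count_list w k + card {a \<in> set bs. (P a b \<or> a = b) \<and> f a = k})"
proof -
  let ?c = "\<lambda>p k. count_list (take (Suc p) (w @ map f bs)) k"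
  have d: "distinct bs" using sorted_wrt_asym_distinct[OF s P] .
  have c: "?c (length w + q) k = count_list w k + card {a \<in> set bs. (P a (bs ! q) \<or> a = bs ! q) \<and> f a = k}"
    if "q < length bs" for q k
  proof -
    have "{a \<in> set (take (Suc q) bs). f a = k} = {a \<in> set bs. (P a (bs ! q) \<or> a = bs ! q) \<and> f a = k}"
      unfolding set_take_sorted_wrt[OF s P that] by auto
    moreover have "?c (length w + q) k = count_list w k + count_list (map f (take (Suc q) bs)) k"
      by (simp add: take_map)
    ultimately show ?thesis
      using count_list_map_distinct[OF distinct_take[OF d], of f "Suc q" k] by presburger
  qed
  have split: "(\<forall>p<length (w @ map f bs). Q p) \<longleftrightarrow> (\<forall>p<length w. Q p) \<and> (\<forall>q<length bs. Q (length w + q))" for Q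
  proof safe
    fix p assume a: "\<forall>p<length w. Q p" "\<forall>q<length bs. Q (length w + q)" "p < length (w @ map f bs)"
    show "Q p"
    proof (cases "p < length w")
      case False
      then have "p = length w + (p - length w)" "p - length w < length bs" using a(3) by auto
      then show ?thesis using a(2) by metis
    qed (use a in auto)
  qed auto
  have "yamanouchi d (w @ map f bs) \<longleftrightarrow> yamanouchi d w \<and>
    (\<forall>q<length bs. \<forall>k\<in>{1..<d}. f (bs ! q) = k + 1 \<longrightarrow> ?c (length w + q) (k + 1) \<le> ?c (length w + q) k)"
    unfolding yamanouchi_iff_nth split by (auto simp: nth_append)
  also have "\<dots> \<longleftrightarrow> yamanouchi d w \<and>
    (\<forall>q<length bs. \<forall>k\<in>{1..<d}. f (bs ! q) = k + 1 \<longrightarrow>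
       count_list w (k + 1) + card {a \<in> set bs. (P a (bs ! q) \<or> a = bs ! q) \<and> f a = k + 1}
       \<le> count_list w k + card {a \<in> set bs. (P a (bs ! q) \<or> a = bs ! q) \<and> f a = k})"
    using c by simp
  finally show ?thesis by (simp add: all_set_conv_all_nth)
qed

lemma sorted_wrt_concat_map:
  assumes "\<And>x. x \<in> set xs \<Longrightarrow> sorted_wrt P (f x)"
    "sorted_wrt (\<lambda>x y. \<forall>a\<in>set (f x). \<forall>b\<in>set (f y). P a b) xs"
  shows "sorted_wrt P (concat (map f xs))"
  using assms by (induction xs) (auto simp: sorted_wrt_append)

text \<open>Columns of the part mu are numbered from the right and rows from the bottom. Reading
  columns from right to left and each from top to bottom makes \<open>snd\<close> increase and,
  within a column, \<open>fst\<close> decrease.\<close>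

definition mu_before :: "nat \<times> nat \<Rightarrow> nat \<times> nat \<Rightarrow> bool" where
  "mu_before a b \<longleftrightarrow> snd a < snd b \<or> snd a = snd b \<and> fst b < fst a"

lemma mu_before_asym: "asymp mu_before"
  by (intro asympI) (auto simp: mu_before_def)

lemma sorted_mu_boxes: "sorted_wrt mu_before (mu_boxes B)"
  unfolding mu_boxes_def
proof (rule sorted_wrt_concat_map)
  show "sorted_wrt mu_before (concat (map (\<lambda>r. if c < length (B ! r) then [(r, c)] else []) (rev [0..<length B])))" for c
    by (rule sorted_wrt_concat_map)
      (auto simp: mu_before_def sorted_wrt_rev intro: sorted_wrt_mono_rel[OF _ sorted_wrt_upt])
qed (auto simp: mu_before_def intro!: sorted_wrt_mono_rel[OF _ sorted_wrt_upt] split: if_splits)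

lemma set_mu_boxes:
  assumes "\<And>r. r < length B \<Longrightarrow> length (B ! r) \<le> length (hd B)"
  shows "set (mu_boxes B) = {(r, c). r < length B \<and> c < length (B ! r)}"
  using assms unfolding mu_boxes_def by (auto split: if_splits) (meson leD not_le_imp_less order_trans leI)

section \<open>The part lambda has only one admissible filling\<close>

definition lam_boxes :: "nat list list \<Rightarrow> (nat \<times> nat) list" where
  "lam_boxes A =
     [(i, j). j \<leftarrow> rev [0..<length (hd A)], i \<leftarrow> [0..<length A], j < length (A ! i)]"

text \<open>In the part lambda columns are numbered from the left and rows from the top, so both
  comparisons are opposite to those of \<open>mu_before\<close>.\<close>

definition lam_before :: "nat \<times> nat \<Rightarrow> nat \<times> nat \<Rightarrow> bool" where
  "lam_before a b \<longleftrightarrow> snd b < snd a \<or> snd a = snd b \<and> fst a < fst b"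

lemma lam_before_asym: "asymp lam_before"
  by (intro asympI) (auto simp: lam_before_def)

lemma lam_word_boxes: "lam_word A = map (\<lambda>(i, j). A ! i ! j) (lam_boxes A)"
  unfolding lam_word_def lam_boxes_def map_concat map_map
  by (intro arg_cong[where f = concat] map_cong refl) (auto simp: map_concat intro!: arg_cong[where f = concat])

lemma sorted_lam_boxes: "sorted_wrt lam_before (lam_boxes A)"
  unfolding lam_boxes_def
proof (rule sorted_wrt_concat_map)
  show "sorted_wrt lam_before (concat (map (\<lambda>i. if j < length (A ! i) then [(i, j)] else []) [0..<length A]))" for j
    by (rule sorted_wrt_concat_map)
      (auto simp: lam_before_def intro: sorted_wrt_mono_rel[OF _ sorted_wrt_upt])
qed (auto simp: lam_before_def sorted_wrt_rev intro!: sorted_wrt_mono_rel[OF _ sorted_wrt_upt] split: if_splits)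

lemma set_lam_boxes:
  assumes "\<And>i. i < length A \<Longrightarrow> length (A ! i) \<le> length (hd A)"
  shows "set (lam_boxes A) = {(i, j). i < length A \<and> j < length (A ! i)}"
  using assms unfolding lam_boxes_def by (auto split: if_splits) (meson leD not_le_imp_less order_trans leI)

lemma hd_longest:
  assumes "mu \<in> partitions d n" "map length B = mu" "r < length B"
  shows "length (B ! r) \<le> length (hd B)"
proof -
  have "length B = d" using assms unfolding partitions_def by auto
  moreover have "mu ! r \<le> mu ! 0" using assms calculation by (intro partitions_nth_mono[OF assms(1)]) auto
  moreover have "0 < length B" using assms(3) by auto
  then have "mu ! r = length (B ! r)" "mu ! 0 = length (B ! 0)"
    using nth_map[OF assms(3), of length] nth_map[of 0 B length] assms(2) by metis+
  moreover have "hd B = B ! 0" using assms(3) by (intro hd_conv_nth) auto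
  ultimately show ?thesis by simp
qed

definition lam_rows :: "nat \<Rightarrow> nat list \<Rightarrow> nat list list" where
  "lam_rows d lam = map (\<lambda>i. replicate (lam ! (i - 1)) i) [1..<d + 1]"

lemma length_lam_rows [simp]: "length (lam_rows d lam) = d"
  by (simp add: lam_rows_def)

lemma nth_lam_rows: "i < d \<Longrightarrow> lam_rows d lam ! i = replicate (lam ! i) (i + 1)"
  by (simp add: lam_rows_def nth_upt del: upt_Suc)

lemma map_length_lam_rows: "length lam = d \<Longrightarrow> map length (lam_rows d lam) = lam"
  by (intro nth_equalityI) (auto simp: nth_lam_rows)

lemma set_lam_boxes_lam_rows:
  assumes "lam \<in> partitions d n"
  shows "set (lam_boxes (lam_rows d lam)) = {(i, j). i < d \<and> j < lam ! i}"
proof -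
  have "map length (lam_rows d lam) = lam" using assms by (intro map_length_lam_rows) (simp add: partitions_def)
  from set_lam_boxes[OF hd_longest[OF assms this]] show ?thesis by (auto simp: nth_lam_rows)
qed

lemma count_lam_word:
  assumes "lam \<in> partitions d n" "k \<in> {1..d}"
  shows "count_list (lam_word (lam_rows d lam)) k = lam ! (k - 1)"
proof -
  have "distinct (lam_boxes (lam_rows d lam))"
    by (rule sorted_wrt_asym_distinct[OF sorted_lam_boxes lam_before_asym])
  then have "count_list (lam_word (lam_rows d lam)) k =
      card {b \<in> {(i, j). i < d \<and> j < lam ! i}. (case b of (i, j) \<Rightarrow> lam_rows d lam ! i ! j) = k}"
    by (simp add: lam_word_boxes count_list_map_distinct set_lam_boxes_lam_rows[OF assms(1)])
  also have "{b \<in> {(i, j). i < d \<and> j < lam ! i}. (case b of (i, j) \<Rightarrow> lam_rows d lam ! i ! j) = k}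
      = Pair (k - 1) ` {..<lam ! (k - 1)}"
    using assms(2) by (auto simp: nth_lam_rows)
  finally show ?thesis by (simp add: card_image inj_on_def)
qed

text \<open>Directly above every \<open>k + 1\<close> stands a \<open>k\<close>, which is read
  earlier; this is the injection.\<close>

lemma yamanouchi_lam_word:
  assumes "lam \<in> partitions d n"
  shows "yamanouchi d (lam_word (lam_rows d lam))"
proof -
  let ?S = "{(i, j). i < d \<and> j < lam ! i}"
  let ?f = "\<lambda>(i, j). lam_rows d lam ! i ! j"
  have fin: "finite ?S"
    using set_lam_boxes_lam_rows[OF assms] finite_set[of "lam_boxes (lam_rows d lam)"] by simp
  have "card {a \<in> ?S. (lam_before a b \<or> a = b) \<and> ?f a = k + 1} \<le> card {a \<in> ?S. (lam_before a b \<or> a = b) \<and> ?f a = k}"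
    if b: "b \<in> ?S" "k \<in> {1..<d}" "?f b = k + 1" for b k
  proof (rule card_inj_on_le)
    show "inj_on (\<lambda>(i, j). (i - 1 :: nat, j)) {a \<in> ?S. (lam_before a b \<or> a = b) \<and> ?f a = k + 1}"
      by (auto simp: inj_on_def nth_lam_rows)
    have m: "lam ! k \<le> lam ! (k - 1)" using b by (intro partitions_nth_mono[OF assms]) auto
    show "(\<lambda>(i, j). (i - 1, j)) ` {a \<in> ?S. (lam_before a b \<or> a = b) \<and> ?f a = k + 1}
        \<subseteq> {a \<in> ?S. (lam_before a b \<or> a = b) \<and> ?f a = k}"
      using b m by (auto simp: nth_lam_rows lam_before_def)
  qed (use fin in auto)
  then have "yamanouchi d ([] @ map ?f (lam_boxes (lam_rows d lam)))"
    unfolding yamanouchi_append_boxes[OF sorted_lam_boxes lam_before_asym] set_lam_boxes_lam_rows[OF assms]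
    by (simp add: yamanouchi_def[of d "[]"])
  then show ?thesis by (simp add: lam_word_boxes)
qed

text \<open>Strict columns give entries of at least \<open>i + 1\<close> in row \<open>i\<close>
  (from 0). If the rightmost entry \<open>v\<close> of the row were larger, a \<open>v - 1\<close>
  would have to be read before it; but everything read before lies in higher rows, whose entries are
  at most \<open>i\<close> by induction. The rest of the row is squeezed between
  \<open>i + 1\<close> and this entry.\<close>

lemma lam_rows_forced:
  assumes lam: "lam \<in> partitions d n" and A: "map length A = lam"
    and row: "\<And>i j. i < length A \<Longrightarrow> j + 1 < length (A ! i) \<Longrightarrow> A ! i ! j \<le> A ! i ! (j + 1)"
    and col: "\<And>i j. i + 1 < length A \<Longrightarrow> j < length (A ! (i + 1)) \<Longrightarrow> A ! i ! j < A ! (i + 1) ! j"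
    and rng: "\<forall>r \<in> set A. \<forall>v \<in> set r. v \<in> {1..d}"
    and yam: "yamanouchi d (lam_word A)"
  shows "A = lam_rows d lam"
proof -
  have len: "length A = d" using lam A unfolding partitions_def by auto
  have leni: "length (A ! i) = lam ! i" if "i < d" for i using that A len by auto
  have rng': "A ! i ! j \<in> {1..d}" if "i < d" "j < lam ! i" for i j
    using rng that leni len by (metis nth_mem)
  have set: "set (lam_boxes A) = {(i, j). i < d \<and> j < lam ! i}"
    using set_lam_boxes[OF hd_longest[OF lam A]] len leni by auto
  have lower: "i + 1 \<le> A ! i ! j" if "i < d" "j < lam ! i" for i j
    using that
  proof (induction i)
    case 0
    then show ?case using rng'[of 0 j] by auto
  next
    case (Suc i)
    have "lam ! Suc i \<le> lam ! i" using Suc by (intro partitions_nth_mono[OF lam]) auto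
    then have "i + 1 \<le> A ! i ! j" using Suc by auto
    also have "A ! i ! j < A ! (i + 1) ! j" using Suc leni len by (intro col) auto
    finally show ?case by simp
  qed
  have mono: "A ! i ! j \<le> A ! i ! j'" if "i < d" "j \<le> j'" "j' < lam ! i" for i j j'
    using that(2,3)
  proof (induction j' rule: dec_induct)
    case (step m)
    then show ?case using row[of i m] leni len that(1) by auto
  qed simp
  have main: "A ! i ! j = i + 1" if "i < d" "j < lam ! i" for i j
    using that
  proof (induction i arbitrary: j rule: less_induct)
    case (less i)
    \<comment> \<open>The first box of row \<open>i\<close> to be read.\<close>
    let ?b = "(i, lam ! i - 1)"
    let ?f = "\<lambda>(i, j). A ! i ! j"
    let ?v = "A ! i ! (lam ! i - 1)"
    have "?v = i + 1"
    proof (rule ccontr)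
      assume "?v \<noteq> i + 1"
      then have v: "i + 2 \<le> ?v" "?v \<le> d" using lower[of i "lam ! i - 1"] rng'[of i "lam ! i - 1"] less by auto
      let ?k = "?v - 1"
      have k: "?k \<in> {1..<d}" "?f ?b = ?k + 1" "?b \<in> set (lam_boxes A)" using v less set by auto
      have "yamanouchi d ([] @ map ?f (lam_boxes A))" using yam by (simp add: lam_word_boxes)
      from this[unfolded yamanouchi_append_boxes[OF sorted_lam_boxes lam_before_asym],
          THEN conjunct2, rule_format, OF k(3,1,2)]
      have "card {a \<in> set (lam_boxes A). (lam_before a ?b \<or> a = ?b) \<and> ?f a = ?k + 1}
          \<le> card {a \<in> set (lam_boxes A). (lam_before a ?b \<or> a = ?b) \<and> ?f a = ?k}"
        by simp
      moreover have "card {a \<in> set (lam_boxes A). (lam_before a ?b \<or> a = ?b) \<and> ?f a = ?k} = 0"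
      proof -
        have "A ! i' ! j' \<noteq> ?k" if "i' < d" "j' < lam ! i'" "lam_before (i', j') ?b \<or> (i', j') = ?b" for i' j'
        proof (cases "(i', j') = ?b")
          case False
          have "i' < i"
          proof (rule ccontr)
            assume "\<not> i' < i"
            then have "lam ! i' \<le> lam ! i" using that by (intro partitions_nth_mono[OF lam]) auto
            then show False using that False \<open>\<not> i' < i\<close> less by (auto simp: lam_before_def)
          qed
          then show ?thesis using less.IH[of i' j'] that v by auto
        qed (use v in auto)
        then have "{a \<in> set (lam_boxes A). (lam_before a ?b \<or> a = ?b) \<and> ?f a = ?k} = {}" using set by auto
        then show ?thesis by (metis card.empty)
      qed
      moreover have "0 < card {a \<in> set (lam_boxes A). (lam_before a ?b \<or> a = ?b) \<and> ?f a = ?k + 1}"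
      proof -
        have "?b \<in> {a \<in> set (lam_boxes A). (lam_before a ?b \<or> a = ?b) \<and> ?f a = ?k + 1}" using k by auto
        then show ?thesis by (intro card_gt_0_iff[THEN iffD2] conjI) (blast, simp)
      qed
      ultimately show False by linarith
    qed
    then show ?case using mono[of i j "lam ! i - 1"] lower[of i j] less by auto
  qed
  show ?thesis
  proof (rule nth_equalityI)
    fix i assume "i < length A"
    then show "A ! i = lam_rows d lam ! i"
      using len leni main by (intro nth_equalityI) (auto simp: nth_lam_rows)
  qed (simp add: len)
qed

section \<open>The part mu and the strips of its boxes\<close>

definition mu_filling :: "nat \<Rightarrow> nat list \<Rightarrow> entry list list \<Rightarrow> bool" where
  "mu_filling d mu B \<longleftrightarrow>
     map length B = mu \<and>
     (\<forall>row \<in> set B. \<forall>a \<in> set row. fst a \<in> {1..d}) \<and>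
     (\<forall>r c. r < length B \<and> c + 1 < length (B ! r)
        \<longrightarrow> fst (B ! r ! (c + 1)) \<le> fst (B ! r ! c)) \<and>
     (\<forall>r c. r + 1 < length B \<and> c < length (B ! (r + 1))
        \<longrightarrow> fst (B ! (r + 1) ! c) < fst (B ! r ! c))"

definition boxes :: "nat \<Rightarrow> nat list \<Rightarrow> (nat \<times> nat) set" where
  "boxes d mu = {(r, c). r < d \<and> c < mu ! r}"

text \<open>The strip that contains the piece of a puzzle from which the entry in a box comes.\<close>

definition strip :: "nat \<Rightarrow> entry list list \<Rightarrow> nat \<times> nat \<Rightarrow> nat" where
  "strip d B b = snd b + (d - val_at B b - fst b)"

text \<open>The number of steps to the left that path \<open>v\<close> has taken when it reaches
  line \<open>t\<close>, as \<open>fills_unbarred_upto\<close> shows.\<close>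

definition unbarred_upto :: "nat \<Rightarrow> nat list \<Rightarrow> entry list list \<Rightarrow> nat \<Rightarrow> nat \<Rightarrow> nat" where
  "unbarred_upto d mu B v t =
     card {b \<in> boxes d mu. \<not> barred_at B b \<and> val_at B b = v \<and> strip d B b < t}"

lemma finite_boxes [simp]: "finite (boxes d mu)"
proof (rule finite_subset)
  show "boxes d mu \<subseteq> (SIGMA r:{..<d}. {..<mu ! r})" by (auto simp: boxes_def)
qed auto

lemma mu_filling_shape:
  assumes "mu_filling d mu B" "mu \<in> partitions d n"
  shows "length B = d" "\<And>r. r < d \<Longrightarrow> length (B ! r) = mu ! r" "set (mu_boxes B) = boxes d mu"
proof -
  have m: "map length B = mu" using assms(1) by (simp add: mu_filling_def)
  then show l: "length B = d" using assms(2) by (auto simp: partitions_def)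
  show n: "length (B ! r) = mu ! r" if "r < d" for r using m l that by auto
  show "set (mu_boxes B) = boxes d mu"
    using set_mu_boxes[OF hd_longest[OF assms(2) m]] l n by (auto simp: boxes_def)
qed

lemma mu_filling_val:
  assumes B: "mu_filling d mu B" and mu: "mu \<in> partitions d n"
    and "r1 \<le> r2" "r2 < d" "c1 \<le> c2" "c2 < mu ! r2"
  shows "val_at B (r2, c2) + (r2 - r1) \<le> val_at B (r1, c1)"
proof -
  note sh = mu_filling_shape[OF B mu]
  have row: "val_at B (r, c + 1) \<le> val_at B (r, c)" if "r < d" "c + 1 < mu ! r" for r c
    using B that sh unfolding mu_filling_def val_at_def by auto
  have col: "val_at B (r + 1, c) < val_at B (r, c)" if "r + 1 < d" "c < mu ! (r + 1)" for r c
    using B that sh unfolding mu_filling_def val_at_def by auto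
  have 1: "val_at B (r2, c2) \<le> val_at B (r2, c1)"
    using assms(5,6)
  proof (induction c2 rule: dec_induct)
    case (step c)
    then show ?case using row[OF assms(4), of c] by auto
  qed simp
  have c1: "c1 < mu ! r2" using assms(5,6) by simp
  have "val_at B (r2, c1) + (r2 - r1) \<le> val_at B (r1, c1)"
    using assms(3,4) c1
  proof (induction r2 rule: dec_induct)
    case (step r)
    then have "mu ! (r + 1) \<le> mu ! r" by (intro partitions_nth_mono[OF mu]) auto
    then show ?case using step col[of r c1] by auto
  qed simp
  with 1 show ?thesis by simp
qed

text \<open>Below a box in row \<open>r\<close> (from 0) stand \<open>r\<close> larger entries,
  strictly increasing downwards and bounded by \<open>d\<close>. Hence the subtraction in
  \<open>strip\<close> does not truncate.\<close>

lemma mu_filling_val_range: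
  assumes B: "mu_filling d mu B" and mu: "mu \<in> partitions d n" and b: "(r, c) \<in> boxes d mu"
  shows "1 \<le> val_at B (r, c)" "val_at B (r, c) + r \<le> d"
proof -
  note sh = mu_filling_shape[OF B mu]
  have rng: "val_at B (r, c) \<in> {1..d}" if "(r, c) \<in> boxes d mu" for r c
    using B that sh unfolding mu_filling_def val_at_def boxes_def by (auto simp: all_set_conv_all_nth)
  from rng[OF b] show "1 \<le> val_at B (r, c)" by simp
  have "mu ! r \<le> mu ! 0" using b by (intro partitions_nth_mono[OF mu]) (auto simp: boxes_def)
  then have "(0, c) \<in> boxes d mu" using b by (auto simp: boxes_def)
  from rng[OF this] mu_filling_val[OF B mu, of 0 r c c] b
  show "val_at B (r, c) + r \<le> d" by (auto simp: boxes_def)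
qed

text \<open>Up to a constant, the strip is column minus value minus row. If the columns and rows of
  the two boxes do not already decide the comparison, one box lies above and to the left of the
  other; then \<open>mu_filling_val\<close> bounds the difference of the values, which is known to
  be 0 or 1.\<close>

lemma mu_before_iff_strip:
  assumes B: "mu_filling d mu B" and mu: "mu \<in> partitions d n"
    and a: "a \<in> boxes d mu" and b: "b \<in> boxes d mu"
    and v: "val_at B a = val_at B b \<or> val_at B a + 1 = val_at B b"
  shows "mu_before a b \<or> a = b \<longleftrightarrow> strip d B a \<le> strip d B b"
proof -
  obtain r' c' r c where ab: "a = (r', c')" "b = (r, c)" by (cases a, cases b)
  let ?v = "val_at B (r', c')" and ?w = "val_at B (r, c)"
  have va: "?v + r' \<le> d" and vb: "?w + r \<le> d" using mu_filling_val_range[OF B mu] a b ab by auto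
  have s: "int (strip d B a) = int c' + int d - int ?v - int r'" "int (strip d B b) = int c + int d - int ?w - int r"
    using va vb ab by (auto simp: strip_def)
  have in_box: "r' < d" "c' < mu ! r'" "r < d" "c < mu ! r" using a b ab by (auto simp: boxes_def)
  have st: "strip d B a \<le> strip d B b \<longleftrightarrow> int c' - int ?v - int r' \<le> int c - int ?w - int r"
    using s by linarith
  have v': "?v = ?w \<or> ?v + 1 = ?w" using v ab by simp
  show ?thesis
  proof (cases "r \<le> r'")
    case True
    show ?thesis
    proof (cases "c' \<le> c")
      case le: True
      then have "mu_before a b \<or> a = b" using True ab by (auto simp: mu_before_def)
      \<comment> \<open>Boxes with different values are different, so one of the two weak
        inequalities is strict and compensates for the 1.\<close>
      moreover have "?v + 1 = ?w \<Longrightarrow> r < r' \<or> c' < c" using True le by (cases "r = r' \<and> c' = c") auto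
      then have "strip d B a \<le> strip d B b" unfolding st using v' True le by auto
      ultimately show ?thesis by simp
    next
      case False
      then have "?v + (r' - r) \<le> ?w" using mu_filling_val[OF B mu, of r r' c c'] True in_box by auto
      then have "\<not> strip d B a \<le> strip d B b" unfolding st using v' False True by auto
      moreover have "\<not> (mu_before a b \<or> a = b)" using False ab by (auto simp: mu_before_def)
      ultimately show ?thesis by simp
    qed
  next
    case False
    show ?thesis
    proof (cases "c' < c")
      case True
      then have "?w + (r - r') \<le> ?v" using mu_filling_val[OF B mu, of r' r c' c] False in_box by auto
      then show ?thesis using v' False by auto
    next
      case ge: False
      then have "\<not> strip d B a \<le> strip d B b" unfolding st using v' False by auto
      moreover have "\<not> (mu_before a b \<or> a = b)" using False ge ab by (auto simp: mu_before_def)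
      ultimately show ?thesis by simp
    qed
  qed
qed

lemma mu_before_iff_strip_less:
  assumes B: "mu_filling d mu B" and mu: "mu \<in> partitions d n"
    and a: "a \<in> boxes d mu" and b: "b \<in> boxes d mu" and v: "val_at B a = val_at B b"
  shows "mu_before a b \<longleftrightarrow> strip d B a < strip d B b"
proof -
  have "mu_before a b \<longleftrightarrow> \<not> (mu_before b a \<or> b = a)"
    by (cases a, cases b) (auto simp: mu_before_def)
  then show ?thesis using mu_before_iff_strip[OF B mu b a] v by auto
qed

lemma strip_less:
  assumes "mu \<in> partitions d n" "d \<le> n" "mu_filling d mu B" "b \<in> boxes d mu"
  shows "strip d B b < n"
proof -
  obtain r c where b: "b = (r, c)" by (cases b)
  have "c < mu ! r" "r < d" "mu ! r \<le> n - d" "1 \<le> val_at B (r, c)"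
    using partitions_nth_le[OF assms(1), of r] mu_filling_val_range(1)[OF assms(3,1)] assms(4) b
    by (auto simp: boxes_def)
  then show ?thesis using assms(2) b unfolding strip_def by simp
qed

definition unbarred_boxes :: "entry list list \<Rightarrow> (nat \<times> nat) list" where
  "unbarred_boxes B = filter (\<lambda>b. \<not> barred_at B b) (mu_boxes B)"

text \<open>At a box of value \<open>k + 1\<close> only the entries \<open>k\<close> and
  \<open>k + 1\<close> read so far matter, and for these the reading order is the order of the
  strips. Between two such boxes the left side is constant and the right side does not decrease, so
  the inequality extends to all \<open>t\<close>; it says that path \<open>k\<close> stays to the
  left of path \<open>k + 1\<close>.\<close>

lemma yamanouchi_unbarred_word:
  assumes B: "mu_filling d mu B" and lam: "lam \<in> partitions d n" and mu: "mu \<in> partitions d n"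
  shows "yamanouchi d (unbarred_word (lam_rows d lam, B)) \<longleftrightarrow>
    (\<forall>k\<in>{1..<d}. \<forall>t. lam ! k + unbarred_upto d mu B (k + 1) t \<le> lam ! (k - 1) + unbarred_upto d mu B k t)"
proof -
  let ?N = "unbarred_upto d mu B" and ?w = "lam_word (lam_rows d lam)"
  have sorted: "sorted_wrt mu_before (unbarred_boxes B)"
    unfolding unbarred_boxes_def by (intro sorted_wrt_filter sorted_mu_boxes)
  have set: "set (unbarred_boxes B) = {b \<in> boxes d mu. \<not> barred_at B b}"
    using mu_filling_shape(3)[OF B mu] by (auto simp: unbarred_boxes_def)
  have N: "card {a \<in> set (unbarred_boxes B). (mu_before a b \<or> a = b) \<and> val_at B a = v} = ?N v (Suc (strip d B b))"
    if b: "b \<in> boxes d mu" and v: "v = val_at B b \<or> v + 1 = val_at B b" for b v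
  proof -
    have "{a \<in> set (unbarred_boxes B). (mu_before a b \<or> a = b) \<and> val_at B a = v}
      = {a \<in> boxes d mu. \<not> barred_at B a \<and> val_at B a = v \<and> strip d B a < Suc (strip d B b)}"
      using mu_before_iff_strip[OF B mu _ b] v unfolding set by (auto simp: less_Suc_eq_le)
    then show ?thesis by (simp add: unbarred_upto_def)
  qed
  have cw: "count_list ?w (k + 1) = lam ! k" "count_list ?w k = lam ! (k - 1)" if "k \<in> {1..<d}" for k
    using count_lam_word[OF lam, of "k + 1"] count_lam_word[OF lam, of k] that by auto
  have "yamanouchi d (unbarred_word (lam_rows d lam, B)) \<longleftrightarrow>
      yamanouchi d (?w @ map (val_at B) (unbarred_boxes B))"
    by (simp add: unbarred_word_def unbarred_values_def unbarred_boxes_def)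
  also have "\<dots> \<longleftrightarrow> (\<forall>b\<in>set (unbarred_boxes B). \<forall>k\<in>{1..<d}. val_at B b = k + 1 \<longrightarrow>
       lam ! k + ?N (k + 1) (Suc (strip d B b)) \<le> lam ! (k - 1) + ?N k (Suc (strip d B b)))"
  proof -
    have "count_list ?w (k + 1) + card {a \<in> set (unbarred_boxes B). (mu_before a b \<or> a = b) \<and> val_at B a = k + 1}
       \<le> count_list ?w k + card {a \<in> set (unbarred_boxes B). (mu_before a b \<or> a = b) \<and> val_at B a = k} \<longleftrightarrow>
       lam ! k + ?N (k + 1) (Suc (strip d B b)) \<le> lam ! (k - 1) + ?N k (Suc (strip d B b))"
      if "b \<in> set (unbarred_boxes B)" "k \<in> {1..<d}" "val_at B b = k + 1" for b k
    proof -
      have "b \<in> boxes d mu" using that(1) set by auto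
      then show ?thesis using N[of b "k + 1"] N[of b k] cw[OF that(2)] that(3) by simp
    qed
    then show ?thesis
      unfolding yamanouchi_append_boxes[OF sorted mu_before_asym] using yamanouchi_lam_word[OF lam] by blast
  qed
  also have "\<dots> \<longleftrightarrow> (\<forall>k\<in>{1..<d}. \<forall>t. lam ! k + ?N (k + 1) t \<le> lam ! (k - 1) + ?N k t)"
  proof
    assume Y: "\<forall>b\<in>set (unbarred_boxes B). \<forall>k\<in>{1..<d}. val_at B b = k + 1 \<longrightarrow>
       lam ! k + ?N (k + 1) (Suc (strip d B b)) \<le> lam ! (k - 1) + ?N k (Suc (strip d B b))"
    show "\<forall>k\<in>{1..<d}. \<forall>t. lam ! k + ?N (k + 1) t \<le> lam ! (k - 1) + ?N k t"
    proof (intro ballI allI)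
      fix k t assume k: "k \<in> {1..<d}"
      show "lam ! k + ?N (k + 1) t \<le> lam ! (k - 1) + ?N k t"
      proof (induction t)
        case 0
        show ?case using partitions_nth_mono[OF lam, of "k - 1" k] k by (auto simp: unbarred_upto_def)
      next
        case (Suc t)
        show ?case
        proof (cases "\<exists>b \<in> set (unbarred_boxes B). val_at B b = k + 1 \<and> strip d B b = t")
          case True
          then show ?thesis using Y k by blast
        next
          case False
          then have "{b \<in> boxes d mu. \<not> barred_at B b \<and> val_at B b = k + 1 \<and> strip d B b < Suc t}
            = {b \<in> boxes d mu. \<not> barred_at B b \<and> val_at B b = k + 1 \<and> strip d B b < t}"
            using set by (auto simp: less_Suc_eq)
          then have "?N (k + 1) (Suc t) = ?N (k + 1) t" unfolding unbarred_upto_def by argo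
          moreover have "?N k t \<le> ?N k (Suc t)" unfolding unbarred_upto_def by (intro card_mono) auto
          ultimately show ?thesis using Suc by linarith
        qed
      qed
    qed
  qed auto
  finally show ?thesis .
qed

lemma content_unbarred_word:
  assumes B: "mu_filling d mu B" and lam: "lam \<in> partitions d n" and mu: "mu \<in> partitions d n"
    and d: "d \<le> n" and nu: "nu \<in> partitions d n"
  shows "content d (unbarred_word (lam_rows d lam, B)) = nu \<longleftrightarrow>
    (\<forall>v\<in>{1..d}. lam ! (v - 1) + unbarred_upto d mu B v n = nu ! (v - 1))"
proof -
  have c: "count_list (unbarred_word (lam_rows d lam, B)) v = lam ! (v - 1) + unbarred_upto d mu B v n"
    if "v \<in> {1..d}" for v
  proof -
    have "distinct (unbarred_boxes B)"
      unfolding unbarred_boxes_def by (intro distinct_filter sorted_wrt_asym_distinct[OF sorted_mu_boxes mu_before_asym])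
    then have "count_list (map (val_at B) (unbarred_boxes B)) v = card {b \<in> set (unbarred_boxes B). val_at B b = v}"
      by (rule count_list_map_distinct)
    also have "{b \<in> set (unbarred_boxes B). val_at B b = v}
        = {b \<in> boxes d mu. \<not> barred_at B b \<and> val_at B b = v \<and> strip d B b < n}"
      using strip_less[OF mu d B] mu_filling_shape(3)[OF B mu] by (auto simp: unbarred_boxes_def)
    finally show ?thesis using count_lam_word[OF lam that]
      by (simp add: unbarred_word_def unbarred_values_def unbarred_boxes_def unbarred_upto_def)
  qed
  have "content d (unbarred_word (lam_rows d lam, B)) = map (\<lambda>v. lam ! (v - 1) + unbarred_upto d mu B v n) [1..<d + 1]"
    unfolding content_def using c by (intro map_cong) auto
  moreover have "nu = map (\<lambda>v. nu ! (v - 1)) [1..<d + 1]"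
    using nu by (intro nth_equalityI) (auto simp: partitions_def nth_upt simp del: upt_Suc)
  ultimately have "content d (unbarred_word (lam_rows d lam, B)) = nu \<longleftrightarrow>
    map (\<lambda>v. lam ! (v - 1) + unbarred_upto d mu B v n) [1..<d + 1] = map (\<lambda>v. nu ! (v - 1)) [1..<d + 1]"
    by metis
  then show ?thesis by (auto simp: map_eq_conv simp del: upt_Suc)
qed

text \<open>In terms of \<open>pos\<close>, the last two conditions say that paths which start at
  the positions of \<open>lam\<close> and step left at the unbarred entries do not meet and end at
  the positions of \<open>nu\<close>.\<close>

lemma LR_iff:
  assumes lam: "lam \<in> partitions d n" and mu: "mu \<in> partitions d n" and nu: "nu \<in> partitions d n"
    and d: "d \<le> n"
  shows "(A, B) \<in> LR d lam mu nu \<longleftrightarrow> A = lam_rows d lam \<and> mu_filling d mu B \<and>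
    (\<forall>k\<in>{1..<d}. \<forall>t. lam ! k + unbarred_upto d mu B (k + 1) t \<le> lam ! (k - 1) + unbarred_upto d mu B k t) \<and>
    (\<forall>v\<in>{1..d}. lam ! (v - 1) + unbarred_upto d mu B v n = nu ! (v - 1))"
proof -
  have "A = lam_rows d lam \<and> mu_filling d mu B" if "(A, B) \<in> LR d lam mu nu"
  proof
    have t: "skew_barred_tableau d lam mu (A, B)" and y: "yamanouchi d (unbarred_word (A, B))"
      using that by (auto simp: LR_def)
    show "mu_filling d mu B" using t by (simp add: skew_barred_tableau_def mu_filling_def)
    have "yamanouchi d (lam_word A)"
    proof -
      have "unbarred_word (A, B) = lam_word A @ map (val_at B) (unbarred_boxes B)"
        by (simp add: unbarred_word_def unbarred_values_def unbarred_boxes_def)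
      moreover have "sorted_wrt mu_before (unbarred_boxes B)"
        unfolding unbarred_boxes_def by (intro sorted_wrt_filter sorted_mu_boxes)
      ultimately show ?thesis using y yamanouchi_append_boxes[OF _ mu_before_asym] by metis
    qed
    then show "A = lam_rows d lam"
      using t by (intro lam_rows_forced[OF lam]) (auto simp: skew_barred_tableau_def)
  qed
  moreover have "skew_barred_tableau d lam mu (lam_rows d lam, B) \<longleftrightarrow> mu_filling d mu B"
  proof -
    have len: "length lam = d" using lam by (simp add: partitions_def)
    have mono: "lam ! (i + 1) \<le> lam ! i" if "i + 1 < d" for i using that by (intro partitions_nth_mono[OF lam]) auto
    let ?A = "lam_rows d lam"
    have "\<forall>row \<in> set ?A. \<forall>v \<in> set row. v \<in> {1..d}"
      by (auto simp: lam_rows_def)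
    moreover have "\<forall>i j. i < length ?A \<and> j + 1 < length (?A ! i) \<longrightarrow> ?A ! i ! j \<le> ?A ! i ! (j + 1)"
      by (auto simp: nth_lam_rows)
    moreover have "\<forall>i j. i + 1 < length ?A \<and> j < length (?A ! (i + 1)) \<longrightarrow> ?A ! i ! j < ?A ! (i + 1) ! j"
    proof (intro allI impI, elim conjE)
      fix i j assume "i + 1 < length ?A" "j < length (?A ! (i + 1))"
      then have "i + 1 < d" "j < lam ! (i + 1)" by (simp_all add: nth_lam_rows)
      with mono[of i] show "?A ! i ! j < ?A ! (i + 1) ! j" by (simp add: nth_lam_rows)
    qed
    moreover note map_length_lam_rows[OF len]
    ultimately show ?thesis unfolding skew_barred_tableau_def mu_filling_def prod.case by blast
  qed
  moreover have "(lam_rows d lam, B) \<in> LR d lam mu nu \<longleftrightarrow> skew_barred_tableau d lam mu (lam_rows d lam, B) \<and>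
      yamanouchi d (unbarred_word (lam_rows d lam, B)) \<and> content d (unbarred_word (lam_rows d lam, B)) = nu"
    by (simp add: LR_def)
  ultimately show ?thesis
    using yamanouchi_unbarred_word[OF _ lam mu, of B] content_unbarred_word[OF _ lam mu d nu, of B]
    by metis
qed

section \<open>Tableaux and path patterns\<close>

text \<open>
  The entries of value \<open>i\<close> in row \<open>r\<close> (counted from 0) come from the strips that path \<open>i\<close> crosses after
  it has met \<open>d - i - r\<close> upward 1-triangles.
\<close>

definition fills :: "nat \<Rightarrow> nat list \<Rightarrow> (nat \<Rightarrow> nat \<Rightarrow> nat) \<Rightarrow> (nat \<Rightarrow> nat \<Rightarrow> int) \<Rightarrow> entry list list \<Rightarrow> bool" where
  "fills d mu u x B \<longleftrightarrow> map length B = mu \<and> (\<forall>(r, c) \<in> boxes d mu.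
     1 \<le> val_at B (r, c) \<and> val_at B (r, c) + r \<le> d \<and>
     (\<forall>i. 1 \<le> i \<longrightarrow> i + r \<le> d \<longrightarrow> (i \<le> val_at B (r, c) \<longleftrightarrow> u i (c + 1 + (d - i - r)) \<le> d - i - r)) \<and>
     (barred_at B (r, c) \<longleftrightarrow>
        x (val_at B (r, c)) (strip d B (r, c) + 1) = x (val_at B (r, c)) (strip d B (r, c))))"

lemma fillsD:
  assumes "fills d mu u x B" "(r, c) \<in> boxes d mu"
  shows "1 \<le> val_at B (r, c)" "val_at B (r, c) + r \<le> d"
    and "1 \<le> i \<Longrightarrow> i + r \<le> d \<Longrightarrow> i \<le> val_at B (r, c) \<longleftrightarrow> u i (c + 1 + (d - i - r)) \<le> d - i - r"
    and "barred_at B (r, c) \<longleftrightarrow>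
      x (val_at B (r, c)) (strip d B (r, c) + 1) = x (val_at B (r, c)) (strip d B (r, c))"
proof -
  from assms have *: "1 \<le> val_at B (r, c) \<and> val_at B (r, c) + r \<le> d \<and>
     (\<forall>i. 1 \<le> i \<longrightarrow> i + r \<le> d \<longrightarrow> (i \<le> val_at B (r, c) \<longleftrightarrow> u i (c + 1 + (d - i - r)) \<le> d - i - r)) \<and>
     (barred_at B (r, c) \<longleftrightarrow>
        x (val_at B (r, c)) (strip d B (r, c) + 1) = x (val_at B (r, c)) (strip d B (r, c)))"
    unfolding fills_def by auto
  show "1 \<le> val_at B (r, c)" "val_at B (r, c) + r \<le> d"
    "1 \<le> i \<Longrightarrow> i + r \<le> d \<Longrightarrow> i \<le> val_at B (r, c) \<longleftrightarrow> u i (c + 1 + (d - i - r)) \<le> d - i - r"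
    "barred_at B (r, c) \<longleftrightarrow>
      x (val_at B (r, c)) (strip d B (r, c) + 1) = x (val_at B (r, c)) (strip d B (r, c))"
    using * by blast+
qed

text \<open>The condition for \<open>i = v\<close> bounds \<open>u v\<close> from above at the end
  of the strip, and that for \<open>i = v + 1\<close> bounds \<open>u (v + 1)\<close> from below at
  its start (trivially if \<open>v + r = d\<close>). Monotonicity then squeezes all three numbers to
  \<open>d - v - r\<close>: in this strip path \<open>v\<close> has met as many downward as upward
  1-triangles and meets no further one.\<close>

lemma box_active:
  assumes b: "(r, c) \<in> boxes d mu" and v: "v = val_at B (r, c)" "1 \<le> v" "v + r \<le> d"
    and f: "\<forall>i. 1 \<le> i \<longrightarrow> i + r \<le> d \<longrightarrow> (i \<le> v \<longleftrightarrow> u i (c + 1 + (d - i - r)) \<le> d - i - r)"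
    and u: "u v (strip d B (r, c)) \<le> u v (strip d B (r, c) + 1)"
      "u (v + 1) (strip d B (r, c)) \<le> u v (strip d B (r, c))"
  shows "u v (strip d B (r, c) + 1) = d - v - r" "u v (strip d B (r, c)) = d - v - r"
    "u (v + 1) (strip d B (r, c)) = d - v - r"
proof -
  have s: "strip d B (r, c) = c + (d - v - r)" using v by (simp add: strip_def)
  have 1: "u v (strip d B (r, c) + 1) \<le> d - v - r" using f[rule_format, of v] v s by (simp add: algebra_simps)
  have 2: "d - v - r \<le> u (v + 1) (strip d B (r, c))"
  proof (cases "v + r = d")
    case False
    then have "v + 1 + r \<le> d" using v by simp
    then have "d - (v + 1) - r < u (v + 1) (c + 1 + (d - (v + 1) - r))" using f[rule_format, of "v + 1"] by simp
    moreover have "c + 1 + (d - (v + 1) - r) = strip d B (r, c)" using \<open>v + 1 + r \<le> d\<close> s by simp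
    ultimately show ?thesis using \<open>v + 1 + r \<le> d\<close> by simp
  qed simp
  show "u v (strip d B (r, c) + 1) = d - v - r" "u v (strip d B (r, c)) = d - v - r"
    "u (v + 1) (strip d B (r, c)) = d - v - r" using 1 2 u by linarith+
qed

lemma pattern_le:
  assumes p: "pattern n d lam mu nu u x" and i: "i \<in> {1..d + 1}" and t: "t \<le> n"
  shows "u i t \<le> t"
  using t
proof (induction t)
  case 0
  then show ?case using pattern_zero[OF p i] by simp
next
  case (Suc t)
  show ?case
  proof (cases "i = d + 1")
    case True
    then show ?thesis using patternD(1)[OF p, of "Suc t"] Suc by simp
  next
    case False
    then have "i \<in> {1..d}" using i by auto
    then show ?thesis using patternD(5)[OF p, of t i] patternD(3)[OF p, of t i] Suc by auto
  qed
qed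

text \<open>Path 1 has met at least \<open>i + j\<close> upward 1-triangles by line
  \<open>mu ! (d - i - j) + i + j\<close>, by the count of ones on the NW side. Passing from path
  \<open>m\<close> to path \<open>m + 1\<close>, the interlacing inequality gives up one triangle
  and one strip.\<close>

lemma pattern_row_full:
  assumes p: "pattern n d lam mu nu u x" and mu: "mu \<in> partitions d n" and d: "d \<le> n"
    and i: "1 \<le> i" and j: "i + j \<le> d" and t: "mu ! (d - i - j) + j + 1 \<le> t" "t \<le> n"
  shows "j + 1 \<le> u i t"
proof -
  let ?K = "i + j"
  have T: "mu ! (d - ?K) + ?K \<le> n"
    using partitions_nth_le[OF mu, of "d - ?K"] i j d by auto
  have K: "?K + 1 - m \<le> u m (mu ! (d - ?K) + ?K + 1 - m)" if "1 \<le> m" "m \<le> ?K" for m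
    using that
  proof (induction m rule: dec_induct)
    case base
    have "mu ! (d - k) + k \<le> mu ! (d - ?K) + ?K" if "k \<in> {1..?K}" for k
    proof -
      have "mu ! (d - k) \<le> mu ! (d - ?K)" using that j by (intro partitions_nth_mono[OF mu]) auto
      then show ?thesis using that by simp
    qed
    then have "{1..?K} \<subseteq> {k \<in> {1..d}. mu ! (d - k) + k \<le> mu ! (d - ?K) + ?K}" using j by auto
    then have "card {1..?K} \<le> card {k \<in> {1..d}. mu ! (d - k) + k \<le> mu ! (d - ?K) + ?K}" by (intro card_mono) auto
    then show ?case using patternD(2)[OF p T] by simp
  next
    case (step m)
    let ?t = "mu ! (d - ?K) + ?K + 1 - Suc m"
    have "u m (?t + 1) \<le> u (m + 1) ?t + 1"
      using step T j by (intro patternD(5)[OF p]) auto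
    moreover have "?t + 1 = mu ! (d - ?K) + ?K + 1 - m" using step by auto
    ultimately have "u m (mu ! (d - ?K) + ?K + 1 - m) \<le> u (m + 1) ?t + 1" by metis
    moreover have "?K + 1 - m \<le> u m (mu ! (d - ?K) + ?K + 1 - m)" using step by simp
    ultimately have "?K + 1 - (m + 1) \<le> u (m + 1) ?t" by linarith
    then show ?case by simp
  qed
  have "j + 1 \<le> u i (mu ! (d - ?K) + j + 1)" using K[of i] i by simp
  also have "\<dots> \<le> u i t" using t i j by (intro pattern_mono[OF p]) (auto simp: diff_diff_eq)
  finally show ?thesis .
qed

text \<open>Counterpart of \<open>box_active_pattern\<close>, leading from a strip to its box. If
  the box were outside \<open>mu\<close>, its row would have ended, and by
  \<open>pattern_row_full\<close> path \<open>i\<close> would have met \<open>j + 1\<close> upward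
  1-triangles by line \<open>s + 1\<close>. The conditions for \<open>i\<close> and
  \<open>i + 1\<close> then pin down the value.\<close>

lemma active_box:
  assumes p: "pattern n d lam mu nu u x" and mu: "mu \<in> partitions d n" and d: "d \<le> n"
    and B: "fills d mu u x B" and i: "i \<in> {1..d}" and s: "s < n" and act: "u i (s + 1) = u (i + 1) s"
  defines "j \<equiv> u i s"
  shows "i + j \<le> d" "j \<le> s" "(d - i - j, s - j) \<in> boxes d mu" "val_at B (d - i - j, s - j) = i"
    "strip d B (d - i - j, s - j) = s"
proof -
  have eq: "u i s = u i (s + 1)" "u (i + 1) s = j"
    using patternD(3,4)[OF p, of s i] i s act by (auto simp: j_def)
  have "u (i + 1) s \<le> u (i + 1) n" using pattern_mono[OF p, of "i + 1" s n] i s by auto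
  then show ij: "i + j \<le> d" using pattern_final[OF p mu d, of "i + 1"] eq i by auto
  show js: "j \<le> s" using pattern_le[OF p, of "i + 1" s] i s eq by auto
  have "\<not> mu ! (d - i - j) + j + 1 \<le> s + 1"
    using pattern_row_full[OF p mu d, of i j "s + 1"] i ij s eq by (auto simp: j_def)
  then show box: "(d - i - j, s - j) \<in> boxes d mu" using i js by (auto simp: boxes_def)
  note D = fillsD[OF B box]
  let ?v = "val_at B (d - i - j, s - j)"
  have "i \<le> ?v" using D(3)[of i] ij i js eq by (auto simp: j_def)
  moreover have "\<not> i + 1 \<le> ?v"
  proof
    assume v: "i + 1 \<le> ?v"
    then have r: "i + 1 + (d - i - j) \<le> d" using D(2) by linarith
    then have "u (i + 1) (s - j + 1 + (d - (i + 1) - (d - i - j))) \<le> d - (i + 1) - (d - i - j)"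
      using D(3)[of "i + 1"] v by auto
    moreover have "s - j + 1 + (d - (i + 1) - (d - i - j)) = s" "d - (i + 1) - (d - i - j) < j"
      using r ij js by auto
    ultimately show False using eq by simp
  qed
  ultimately show v: "?v = i" by simp
  show "strip d B (d - i - j, s - j) = s" using v ij js by (simp add: strip_def)
qed

lemma box_active_pattern:
  assumes p: "pattern n d lam mu nu u x" and mu: "mu \<in> partitions d n" and d: "d \<le> n"
    and B: "fills d mu u x B" and box: "(r, c) \<in> boxes d mu"
  defines "v \<equiv> val_at B (r, c)" and "s \<equiv> strip d B (r, c)"
  shows "v \<in> {1..d}" "s < n" "u v (s + 1) = u (v + 1) s" "u v s = d - v - r" "s = c + (d - v - r)" "v + r \<le> d"
proof -
  note D = fillsD[OF B box, folded v_def s_def]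
  show v: "v \<in> {1..d}" "v + r \<le> d" using D(1,2) by auto
  show s: "s = c + (d - v - r)" by (simp add: s_def v_def strip_def)
  have "c < mu ! r" "mu ! r \<le> n - d" using partitions_nth_le[OF mu, of r] box by (auto simp: boxes_def)
  then show sn: "s < n" using s v d by auto
  have "u v s \<le> u v (s + 1)" "u (v + 1) s \<le> u v s" using patternD(3,4)[OF p, of s v] v sn by auto
  moreover have "\<forall>i. 1 \<le> i \<longrightarrow> i + r \<le> d \<longrightarrow> (i \<le> v \<longleftrightarrow> u i (c + 1 + (d - i - r)) \<le> d - i - r)"
    using D(3) by blast
  ultimately show "u v (s + 1) = u (v + 1) s" "u v s = d - v - r"
    using box_active[OF box v_def[THEN meta_eq_to_obj_eq] D(1,2), of u] by (simp_all add: s_def)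
qed

text \<open>Whenever path \<open>i\<close> moves left it is active, so \<open>active_box\<close>
  provides a box, which is unbarred precisely because of the move. Conversely an unbarred box causes
  a move, and a strip contains at most one box of a given value.\<close>

lemma fills_unbarred_upto:
  assumes p: "pattern n d lam mu nu u x" and mu: "mu \<in> partitions d n" and d: "d \<le> n"
    and B: "fills d mu u x B" and i: "i \<in> {1..d}" and t: "t \<le> n"
  shows "x i t = pos n lam i - int (unbarred_upto d mu B i t)"
  using t
proof (induction t)
  case 0
  then show ?case using patternD(6)[OF p i] by (simp add: unbarred_upto_def)
next
  case (Suc t)
  let ?S = "{b \<in> boxes d mu. \<not> barred_at B b \<and> val_at B b = i \<and> strip d B b < t}"
  let ?S' = "{b \<in> boxes d mu. \<not> barred_at B b \<and> val_at B b = i \<and> strip d B b < Suc t}"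
  let ?E = "{b \<in> boxes d mu. \<not> barred_at B b \<and> val_at B b = i \<and> strip d B b = t}"
  have "?S' = ?S \<union> ?E" "?S \<inter> ?E = {}" by (auto simp: less_Suc_eq)
  moreover have "finite ?S" "finite ?E" by (rule finite_subset[of _ "boxes d mu"]; auto)+
  ultimately have card: "unbarred_upto d mu B i (Suc t) = unbarred_upto d mu B i t + card ?E"
    unfolding unbarred_upto_def by (simp add: card_Un_disjoint)
  \<comment> \<open>The value and the strip determine the box: they give the number of upward
    1-triangles met, hence the row, and then the column.\<close>
  have un: "b = (d - i - u i t, t - u i t)" if "b \<in> boxes d mu" "val_at B b = i" "strip d B b = t" for b
  proof -
    obtain r c where b: "b = (r, c)" by (cases b)
    have "u i t = d - i - r" "t = c + (d - i - r)" "i + r \<le> d"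
      using box_active_pattern(4,5,6)[OF p mu d B, of r c] that b by auto
    then show ?thesis using b by auto
  qed
  show ?case
  proof (cases "x i (t + 1) = x i t")
    case True
    have "?E = {}" using True fillsD(4)[OF B] by auto
    then show ?thesis using True card Suc by simp
  next
    case False
    then have m: "x i (t + 1) = x i t - 1" "u i (t + 1) = u (i + 1) t" using patternD(9)[OF p, of t i] i Suc by auto
    have tn: "t < n" using Suc by simp
    note A = active_box[OF p mu d B i tn m(2)]
    have "\<not> barred_at B (d - i - u i t, t - u i t)" using fillsD(4)[OF B A(3)] A(4,5) False by auto
    then have "?E = {(d - i - u i t, t - u i t)}" using A(3-5) un by blast
    then show ?thesis using m card Suc by simp
  qed
qed

text \<open>The positions follow from \<open>fills_unbarred_upto\<close>. For \<open>u\<close>, the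
  truth of \<open>u i t \<le> j\<close> is settled for every \<open>j\<close>: by the entry in box
  \<open>(d - i - j, t - 1 - j)\<close> if this box belongs to \<open>mu\<close>, and otherwise by
  bounds that all patterns obey.\<close>

lemma fills_pattern_unique:
  assumes p: "pattern n d lam mu nu u x" and p': "pattern n d lam mu nu u' x'"
    and mu: "mu \<in> partitions d n" and d: "d \<le> n"
    and B: "fills d mu u x B" "fills d mu u' x' B" and i: "i \<in> {1..d}" and t: "t \<le> n"
  shows "x i t = x' i t" "u i t = u' i t"
proof -
  show "x i t = x' i t"
    using fills_unbarred_upto[OF p mu d B(1) i t] fills_unbarred_upto[OF p' mu d B(2) i t] by simp
  have "u i t \<le> j \<longleftrightarrow> u' i t \<le> j" for j
  proof -
    have full: "u i t \<le> d + 1 - i" if "pattern n d lam mu nu u x" for u x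
      using pattern_mono[OF that, of i t n] pattern_final[OF that mu d, of i] i t by auto
    consider "d < i + j" | "i + j \<le> d" "t \<le> j" | "i + j \<le> d" "j < t" "mu ! (d - i - j) \<le> t - 1 - j"
      | "i + j \<le> d" "j < t" "t - 1 - j < mu ! (d - i - j)" by linarith
    then show ?thesis
    proof cases
      case 1
      then show ?thesis using full[OF p] full[OF p'] by auto
    next
      case 2
      then show ?thesis using pattern_le[OF p, of i t] pattern_le[OF p', of i t] i t by auto
    next
      case 3
      then have "mu ! (d - i - j) + j + 1 \<le> t" "1 \<le> i" using i by auto
      then have "j + 1 \<le> u i t" "j + 1 \<le> u' i t"
        using pattern_row_full[OF p mu d _ 3(1) _ t] pattern_row_full[OF p' mu d _ 3(1) _ t] by blast+
      then show ?thesis by simp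
    next
      case 4
      then have box: "(d - i - j, t - 1 - j) \<in> boxes d mu" using i by (auto simp: boxes_def)
      have "d - i - (d - i - j) = j" "t - 1 - j + 1 + j = t" "i + (d - i - j) \<le> d" using 4 by auto
      then show ?thesis
        using fillsD(3)[OF B(1) box, of i] fillsD(3)[OF B(2) box, of i] i by auto
    qed
  qed
  from this[of "u i t"] this[of "u' i t"] show "u i t = u' i t" by simp
qed

lemma fills_unique:
  assumes B: "fills d mu u x B" "fills d mu u' x' B'" and d: "length mu = d"
    and u: "\<And>i t. i \<in> {1..d} \<Longrightarrow> t \<le> n \<Longrightarrow> u i t = u' i t"
    and x: "\<And>i t. i \<in> {1..d} \<Longrightarrow> t \<le> n \<Longrightarrow> x i t = x' i t"
    and mu: "mu \<in> partitions d n" "d \<le> n"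
  shows "B = B'"
proof -
  have len: "map length B = mu" "map length B' = mu" using B by (auto simp: fills_def)
  have l: "length B = d" "length B' = d" using len d by (metis length_map)+
  have l': "length (B ! r) = mu ! r" "length (B' ! r) = mu ! r" if "r < d" for r
    using nth_map[of r B length] nth_map[of r B' length] len l that by metis+
  have eq: "B ! r ! c = B' ! r ! c" if b: "(r, c) \<in> boxes d mu" for r c
  proof -
    note D = fillsD[OF B(1) b] and D' = fillsD[OF B(2) b]
    have c: "c < mu ! r" "mu ! r \<le> n - d" using b partitions_nth_le[OF mu(1), of r] by (auto simp: boxes_def)
    have iff: "i \<le> val_at B (r, c) \<longleftrightarrow> i \<le> val_at B' (r, c)" if "1 \<le> i" "i + r \<le> d" for i
    proof -
      have "c + 1 + (d - i - r) \<le> n" using c mu(2) that by simp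
      then show ?thesis using D(3)[OF that] D'(3)[OF that] u[of i "c + 1 + (d - i - r)"] that by auto
    qed
    have v: "val_at B (r, c) = val_at B' (r, c)"
      using iff[of "val_at B (r, c)"] iff[of "val_at B' (r, c)"] D(1,2) D'(1,2) by auto
    then have s: "strip d B (r, c) = strip d B' (r, c)" by (simp add: strip_def)
    have "strip d B (r, c) + 1 \<le> n" "val_at B (r, c) \<in> {1..d}" using c mu(2) D(1,2) by (auto simp: strip_def)
    then have "barred_at B (r, c) = barred_at B' (r, c)"
      using D(4) D'(4) v s x by auto
    then show ?thesis using v by (auto simp: val_at_def barred_at_def prod_eq_iff)
  qed
  show ?thesis
  proof (rule nth_equalityI)
    fix r assume "r < length B"
    then show "B ! r = B' ! r" using l l' eq by (intro nth_equalityI) (auto simp: boxes_def)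
  qed (simp add: l)
qed

text \<open>The numbers satisfying \<open>P\<close> form an initial segment of
  \<open>{1..m}\<close>, whose length is the count.\<close>

lemma count_down_closed:
  fixes P :: "nat \<Rightarrow> bool"
  assumes "\<And>j. 1 \<le> j \<Longrightarrow> j < m \<Longrightarrow> P (j + 1) \<Longrightarrow> P j" "1 \<le> j" "j \<le> m"
  shows "j \<le> card {j \<in> {1..m}. P j} \<longleftrightarrow> P j"
proof -
  have dn: "P i" if "P k" "1 \<le> i" "i \<le> k" "k \<le> m" for i k
    using that(3,1,2,4)
  proof (induction i rule: inc_induct)
    case (step i)
    then show ?case using assms(1)[of i] by auto
  qed
  show ?thesis
  proof
    assume Pj: "P j"
    have "{1..j} \<subseteq> {j \<in> {1..m}. P j}" using dn[OF Pj] assms(3) by auto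
    then have "card {1..j} \<le> card {j \<in> {1..m}. P j}" by (intro card_mono) auto
    then show "j \<le> card {j \<in> {1..m}. P j}" by simp
  next
    assume c: "j \<le> card {j \<in> {1..m}. P j}"
    show "P j"
    proof (rule ccontr)
      assume "\<not> P j"
      then have "k < j" if "P k" "k \<in> {1..m}" for k
        using dn[of k j] that assms(2) by (cases "k < j") auto
      then have "{j \<in> {1..m}. P j} \<subseteq> {1..<j}" by auto
      then have "card {j \<in> {1..m}. P j} \<le> card {1..<j}" by (intro card_mono) auto
      then show False using c assms(2) by simp
    qed
  qed
qed

text \<open>The tableau conditions turn into the pattern conditions one by one: weak rows make
  \<open>u\<close> increase with the line, strict columns make it decrease with the path, the
  remaining interlacing inequality compares one entry with \<open>i\<close> and with
  \<open>i + 1\<close>, and the Yamanouchi and content conditions concern \<open>x\<close>.\<close>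

lemma tableau_pattern:
  assumes lam: "lam \<in> partitions d n" and mu: "mu \<in> partitions d n" and nu: "nu \<in> partitions d n"
    and d: "d \<le> n" and L: "(A, B) \<in> LR d lam mu nu"
  obtains u x where "pattern n d lam mu nu u x" "fills d mu u x B"
proof -
  let ?N = "unbarred_upto d mu B"
  have B: "mu_filling d mu B"
    and yam: "\<And>k t. k \<in> {1..<d} \<Longrightarrow> lam ! k + ?N (k + 1) t \<le> lam ! (k - 1) + ?N k t"
    and con: "\<And>v. v \<in> {1..d} \<Longrightarrow> lam ! (v - 1) + ?N v n = nu ! (v - 1)"
    using L unfolding LR_iff[OF lam mu nu d] by blast+
  note sh = mu_filling_shape[OF B mu] and rng = mu_filling_val_range[OF B mu]
  \<comment> \<open>Path \<open>i\<close> is to have met at least \<open>j\<close> upward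
    1-triangles before line \<open>t\<close>. This is the negated condition of \<open>fills\<close>
    with \<open>r = d + 1 - i - j\<close> and \<open>c = t - j\<close>, taken as true beyond the end
    of a row and as false for \<open>t < j\<close>.\<close>
  define G where "G i j t \<longleftrightarrow> j \<le> t \<and> \<not> (t - j < mu ! (d + 1 - i - j) \<and> i \<le> val_at B (d + 1 - i - j, t - j))" for i j t
  define u where "u i t = card {j \<in> {1..d + 1 - i}. G i j t}" for i t
  have box: "r1 < d \<and> c1 < mu ! r1 \<and> val_at B (r2, c2) + (r2 - r1) \<le> val_at B (r1, c1)"
    if "r1 \<le> r2" "r2 < d" "c1 \<le> c2" "c2 < mu ! r2" for r1 r2 c1 c2
    using mu_filling_val[OF B mu that] partitions_nth_mono[OF mu that(1,2)] that by auto
  \<comment> \<open>Passing from \<open>j + 1\<close> to \<open>j\<close> moves the box one row up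
    and one column to the left, where the entry is smaller or the box is missing.\<close>
  have le_u: "j \<le> u i t \<longleftrightarrow> G i j t" if i: "i \<in> {1..d}" and "1 \<le> j" "i + j \<le> d + 1" for i j t
    unfolding u_def
  proof (rule count_down_closed)
    fix j assume j: "1 \<le> j" "j < d + 1 - i" and G: "G i (j + 1) t"
    show "G i j t"
    proof (rule ccontr)
      assume "\<not> G i j t"
      then have "t - j < mu ! (d + 1 - i - j)" "i \<le> val_at B (d + 1 - i - j, t - j)" using G by (auto simp: G_def)
      moreover have "d + 1 - i - j < d" "d + 1 - i - (j + 1) \<le> d + 1 - i - j" "t - (j + 1) \<le> t - j"
        using i j by auto
      ultimately show False
        using box[of "d + 1 - i - (j + 1)" "d + 1 - i - j" "t - (j + 1)" "t - j"] G by (auto simp: G_def)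
    qed
  qed (use \<open>1 \<le> j\<close> \<open>i + j \<le> d + 1\<close> in auto)
  have u_le: "u i t \<le> d + 1 - i" for i t
  proof -
    have "u i t \<le> card {1..d + 1 - i}" unfolding u_def by (intro card_mono) auto
    then show ?thesis by simp
  qed
  have dec: "u (i + 1) t \<le> u i t" if i: "i \<in> {1..d}" for i t
  proof (cases "u (i + 1) t = 0")
    case False
    let ?j = "u (i + 1) t"
    have j: "1 \<le> ?j" "i + 1 + ?j \<le> d + 1" using False u_le[of "i + 1" t] by auto
    then have G: "G (i + 1) ?j t" using le_u[of "i + 1" ?j t] i by auto
    have "G i ?j t"
    proof (rule ccontr)
      assume "\<not> G i ?j t"
      then have "t - ?j < mu ! (d + 1 - i - ?j)" "i \<le> val_at B (d + 1 - i - ?j, t - ?j)" using G by (auto simp: G_def)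
      moreover have "d + 1 - i - ?j < d" "d + 1 - i - ?j = Suc (d + 1 - (i + 1) - ?j)" using i j by auto
      ultimately show False
        using box[of "d + 1 - (i + 1) - ?j" "d + 1 - i - ?j" "t - ?j" "t - ?j"] G by (auto simp: G_def)
    qed
    then show ?thesis using le_u[of i ?j t] i j by auto
  qed simp
  have mono: "u i t \<le> u i (t + 1)" if i: "i \<in> {1..d}" for i t
  proof (cases "u i t = 0")
    case False
    let ?j = "u i t"
    have j: "1 \<le> ?j" "i + ?j \<le> d + 1" using False u_le[of i t] i by auto
    then have G: "G i ?j t" using le_u[of i ?j t] i by auto
    have "G i ?j (t + 1)"
    proof (rule ccontr)
      assume "\<not> G i ?j (t + 1)"
      then have "t + 1 - ?j < mu ! (d + 1 - i - ?j)" "i \<le> val_at B (d + 1 - i - ?j, t + 1 - ?j)" using G by (auto simp: G_def)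
      moreover have "d + 1 - i - ?j < d" "t - ?j \<le> t + 1 - ?j" using i j by auto
      ultimately show False
        using box[of "d + 1 - i - ?j" "d + 1 - i - ?j" "t - ?j" "t + 1 - ?j"] G by (auto simp: G_def)
    qed
    then show ?thesis using le_u[of i ?j "t + 1"] i j by auto
  qed simp
  have inter: "u i (t + 1) \<le> u (i + 1) t + 1" if i: "i \<in> {1..d}" for i t
  proof (cases "u i (t + 1) \<le> 1")
    case False
    define j where "j = u i (t + 1) - 1"
    have j: "1 \<le> j" "u i (t + 1) = j + 1" "i + 1 + j \<le> d + 1" using False u_le[of i "t + 1"] i by (auto simp: j_def)
    then have G: "G i (j + 1) (t + 1)" using le_u[of i "j + 1" "t + 1"] i by auto
    \<comment> \<open>Both statements inspect the same box, and a value below \<open>i\<close> is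
      also below \<open>i + 1\<close>.\<close>
    then have "G (i + 1) j t" using j by (auto simp: G_def)
    then have "j \<le> u (i + 1) t" using le_u[of "i + 1" j t] i j by auto
    then show ?thesis using j by simp
  qed simp
  have top: "u 1 t = card {j \<in> {1..d}. mu ! (d - j) + j \<le> t}" for t
  proof -
    \<comment> \<open>All entries are at least 1, so for path 1 only the shape \<open>mu\<close> is
      left.\<close>
    have "G 1 j t \<longleftrightarrow> mu ! (d - j) + j \<le> t" if j: "j \<in> {1..d}" for j
    proof -
      have "1 \<le> val_at B (d - j, t - j)" if "t - j < mu ! (d - j)"
        using rng(1)[of "d - j" "t - j"] that j by (auto simp: boxes_def)
      then show ?thesis using j by (auto simp: G_def)
    qed
    then have "{j \<in> {1..d + 1 - 1}. G 1 j t} = {j \<in> {1..d}. mu ! (d - j) + j \<le> t}" by auto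
    then show ?thesis unfolding u_def by argo
  qed
  have ival: "i \<le> val_at B (r, c) \<longleftrightarrow> u i (c + 1 + (d - i - r)) \<le> d - i - r"
    if "(r, c) \<in> boxes d mu" "1 \<le> i" "i + r \<le> d" for i r c
  proof -
    let ?j = "d - i - r + 1"
    have "?j \<le> u i (c + ?j) \<longleftrightarrow> G i ?j (c + ?j)" using that by (intro le_u) auto
    moreover have "d + 1 - i - ?j = r" using that by auto
    ultimately show ?thesis using that by (auto simp: G_def boxes_def add.assoc)
  qed
  define x where "x i t = pos n lam i - int (?N i t)" for i t
  have len: "length lam = d" "length nu = d" using lam nu by (auto simp: partitions_def)
  have act: "u (val_at B b) (strip d B b + 1) = u (val_at B b + 1) (strip d B b) \<and>
      u (val_at B b) (strip d B b) = d - val_at B b - fst b"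
    if "b \<in> boxes d mu" for b
  proof -
    obtain r c where b: "b = (r, c)" by (cases b)
    have v: "1 \<le> val_at B (r, c)" "val_at B (r, c) + r \<le> d" using rng that b by auto
    then have vd: "val_at B (r, c) \<in> {1..d}" by auto
    have f: "\<forall>i. 1 \<le> i \<longrightarrow> i + r \<le> d \<longrightarrow>
        (i \<le> val_at B (r, c) \<longleftrightarrow> u i (c + 1 + (d - i - r)) \<le> d - i - r)"
      using ival[OF that[unfolded b]] by blast
    show ?thesis
      using box_active[where u = u and B = B and r = r and c = c and v = "val_at B (r, c)",
          OF that[unfolded b] refl v f mono[OF vd] dec[OF vd]] b by simp
  qed
  have step: "?N i (t + 1) = ?N i t + card {b \<in> boxes d mu. \<not> barred_at B b \<and> val_at B b = i \<and> strip d B b = t}" for i t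
  proof -
    let ?S = "{b \<in> boxes d mu. \<not> barred_at B b \<and> val_at B b = i \<and> strip d B b < t}"
    let ?S' = "{b \<in> boxes d mu. \<not> barred_at B b \<and> val_at B b = i \<and> strip d B b < t + 1}"
    let ?E = "{b \<in> boxes d mu. \<not> barred_at B b \<and> val_at B b = i \<and> strip d B b = t}"
    have "?S' = ?S \<union> ?E" "?S \<inter> ?E = {}" by auto
    moreover have "finite ?S" "finite ?E" by (rule finite_subset[of _ "boxes d mu"]; auto)+
    ultimately show ?thesis unfolding unbarred_upto_def by (simp add: card_Un_disjoint)
  qed
  have uniq: "a = b" if "a \<in> boxes d mu" "b \<in> boxes d mu" "val_at B a = val_at B b" "strip d B a = strip d B b" for a b
  proof -
    have "\<not> mu_before a b" "\<not> mu_before b a"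
      using mu_before_iff_strip_less[OF B mu] that by auto
    then show ?thesis by (cases a, cases b) (auto simp: mu_before_def)
  qed
  have "pattern n d lam mu nu u x"
    unfolding pattern_def
  proof (intro conjI allI ballI impI)
    show "u (d + 1) t = 0" for t by (simp add: u_def)
    show "x i 0 = pos n lam i" for i by (simp add: x_def unbarred_upto_def)
    show "x i n = pos n nu i" if "i \<in> {1..d}" for i
      using con[OF that] len by (auto simp: x_def pos_def)
    show "x i t < x (i + 1) t" if "i \<in> {1..<d}" for i t
      using yam[OF that, of t] len that by (auto simp: x_def pos_def)
    fix t i assume i: "i \<in> {1..d}"
    let ?E = "{b \<in> boxes d mu. \<not> barred_at B b \<and> val_at B b = i \<and> strip d B b = t}"
    show "x i (t + 1) = x i t \<or> x i (t + 1) = x i t - 1 \<and> u i (t + 1) = u (i + 1) t"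
    proof (cases "?E = {}")
      case True
      then show ?thesis unfolding x_def step by simp
    next
      case False
      then obtain b where b: "b \<in> ?E" by blast
      have "a = b" if "a \<in> ?E" for a using that b by (intro uniq) auto
      then have "?E = {b}" using b by blast
      moreover have "u i (t + 1) = u (i + 1) t" using b act[of b] by auto
      ultimately show ?thesis unfolding x_def step by simp
    qed
  qed (use dec mono inter top in auto)
  moreover have "fills d mu u x B"
  proof -
    have "barred_at B b \<longleftrightarrow> x (val_at B b) (strip d B b + 1) = x (val_at B b) (strip d B b)"
      if b: "b \<in> boxes d mu" for b
    proof -
      let ?E = "{a \<in> boxes d mu. \<not> barred_at B a \<and> val_at B a = val_at B b \<and> strip d B a = strip d B b}"
      have "a = b" if "a \<in> ?E" for a using that b by (intro uniq) auto
      then have "?E = (if barred_at B b then {} else {b})" using b by auto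
      then have "card ?E = (if barred_at B b then 0 else 1)" by simp
      then show ?thesis unfolding x_def step by simp
    qed
    then show ?thesis
      using ival rng B unfolding fills_def mu_filling_def by auto
  qed
  ultimately show ?thesis by (rule that)
qed

text \<open>Rows are weak because \<open>u\<close> grows with the line. For columns, the condition
  on \<open>i\<close> in row \<open>r + 1\<close> and the condition on \<open>i + 1\<close> in row
  \<open>r\<close> concern the same line and have the same bound, so
  \<open>u (i + 1) t \<le> u i t\<close> suffices.\<close>

lemma fills_mu_filling:
  assumes p: "pattern n d lam mu nu u x" and mu: "mu \<in> partitions d n" and d: "d \<le> n"
    and B: "fills d mu u x B"
  shows "mu_filling d mu B"
proof -
  have m: "map length B = mu" using B by (simp add: fills_def)
  then have l: "length B = d" using mu by (auto simp: partitions_def)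
  have lr: "length (B ! r) = mu ! r" if "r < d" for r using nth_map[of r B length] m l that by simp
  have bnd: "c + 1 + (d - i - r) \<le> n" if "(r, c) \<in> boxes d mu" "1 \<le> i" for i r c
    using that partitions_nth_le[OF mu, of r] d by (auto simp: boxes_def)
  have row: "val_at B (r, c + 1) \<le> val_at B (r, c)" if b: "r < d" "c + 1 < mu ! r" for r c
  proof -
    have b1: "(r, c + 1) \<in> boxes d mu" and b2: "(r, c) \<in> boxes d mu" using b by (auto simp: boxes_def)
    let ?i = "val_at B (r, c + 1)"
    note D = fillsD[OF B b1]
    have "u ?i (c + 1 + (d - ?i - r)) \<le> u ?i (c + 1 + 1 + (d - ?i - r))"
      using bnd[OF b1 D(1)] D(1,2) by (intro pattern_mono[OF p]) auto
    also have "\<dots> \<le> d - ?i - r" using D(3)[OF D(1,2)] by simp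
    finally show ?thesis using fillsD(3)[OF B b2 D(1,2)] by simp
  qed
  have col: "val_at B (r + 1, c) < val_at B (r, c)" if b: "r + 1 < d" "c < mu ! (r + 1)" for r c
  proof -
    have "mu ! (r + 1) \<le> mu ! r" using b by (intro partitions_nth_mono[OF mu]) auto
    then have b1: "(r + 1, c) \<in> boxes d mu" and b2: "(r, c) \<in> boxes d mu" using b by (auto simp: boxes_def)
    let ?i = "val_at B (r + 1, c)"
    note D = fillsD[OF B b1]
    let ?t = "c + 1 + (d - ?i - (r + 1))"
    have "u (?i + 1) ?t \<le> u ?i ?t"
      using bnd[OF b1 D(1)] D(1,2) by (intro patternD(3)[OF p]) auto
    also have "\<dots> \<le> d - ?i - (r + 1)" using D(3)[OF D(1,2)] by simp
    finally show ?thesis using fillsD(3)[OF B b2, of "?i + 1"] D(1,2) by simp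
  qed
  have "val_at B (r, c) \<in> {1..d}" if "(r, c) \<in> boxes d mu" for r c using fillsD(1,2)[OF B that] by auto
  then have "\<forall>row \<in> set B. \<forall>a \<in> set row. fst a \<in> {1..d}"
    using l lr unfolding all_set_conv_all_nth val_at_def boxes_def by auto
  moreover have "\<forall>r c. r < length B \<and> c + 1 < length (B ! r) \<longrightarrow> fst (B ! r ! (c + 1)) \<le> fst (B ! r ! c)"
    using row l lr unfolding val_at_def by auto
  moreover have "\<forall>r c. r + 1 < length B \<and> c < length (B ! (r + 1)) \<longrightarrow> fst (B ! (r + 1) ! c) < fst (B ! r ! c)"
    using col l lr unfolding val_at_def by auto
  ultimately show ?thesis using m unfolding mu_filling_def by blast
qed

lemma fills_LR:
  assumes p: "pattern n d lam mu nu u x" and lam: "lam \<in> partitions d n" and mu: "mu \<in> partitions d n"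
    and nu: "nu \<in> partitions d n" and d: "d \<le> n" and B: "fills d mu u x B"
  shows "(lam_rows d lam, B) \<in> LR d lam mu nu"
  unfolding LR_iff[OF lam mu nu d]
proof (intro conjI ballI allI refl)
  let ?N = "unbarred_upto d mu B"
  have len: "length lam = d" "length nu = d" using lam nu by (auto simp: partitions_def)
  show F: "mu_filling d mu B" by (rule fills_mu_filling[OF p mu d B])
  show "lam ! (v - 1) + ?N v n = nu ! (v - 1)" if "v \<in> {1..d}" for v
    using fills_unbarred_upto[OF p mu d B that order_refl] patternD(7)[OF p that] len
    by (simp add: pos_def)
  fix k t assume k: "k \<in> {1..<d}"
  \<comment> \<open>The strips of all boxes are less than \<open>n\<close>, so lines beyond
    \<open>n\<close>, about which a pattern says nothing, add no boxes.\<close>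
  have "?N v t = ?N v (min t n)" for v
    using strip_less[OF mu d F] unfolding unbarred_upto_def by (intro arg_cong[where f = card]) auto
  moreover have "lam ! k + ?N (k + 1) s \<le> lam ! (k - 1) + ?N k s" if "s \<le> n" for s
    using fills_unbarred_upto[OF p mu d B _ that, of k] fills_unbarred_upto[OF p mu d B _ that, of "k + 1"]
      patternD(8)[OF p that k] k len by (simp add: pos_def)
  ultimately show "lam ! k + ?N (k + 1) t \<le> lam ! (k - 1) + ?N k t" by simp
qed

text \<open>By interlacing, the \<open>i\<close> that are to be at most the entry form an initial
  segment, so the entry is their number. It is at least 1 because of the condition on
  \<open>u 1\<close>, which encodes the shape.\<close>

lemma pattern_fills:
  assumes p: "pattern n d lam mu nu u x" and mu: "mu \<in> partitions d n" and d: "d \<le> n"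
  obtains B where "fills d mu u x B"
proof -
  define val where "val r c = card {i \<in> {1..d - r}. u i (c + 1 + (d - i - r)) \<le> d - i - r}" for r c
  define B where "B = map (\<lambda>r. map (\<lambda>c. (val r c, x (val r c) (c + (d - val r c - r) + 1) =
      x (val r c) (c + (d - val r c - r)))) [0..<mu ! r]) [0..<d]"
  have nthB: "B ! r ! c = (val r c, x (val r c) (c + (d - val r c - r) + 1) = x (val r c) (c + (d - val r c - r)))"
    if "(r, c) \<in> boxes d mu" for r c
    using that by (simp add: B_def boxes_def)
  have len: "length mu = d" using mu by (simp add: partitions_def)
  have v: "i \<le> val r c \<longleftrightarrow> u i (c + 1 + (d - i - r)) \<le> d - i - r"
    if b: "(r, c) \<in> boxes d mu" and i: "1 \<le> i" "i + r \<le> d" for i r c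
    unfolding val_def
  proof (rule count_down_closed)
    fix i assume i: "1 \<le> i" "i < d - r" and le: "u (i + 1) (c + 1 + (d - (i + 1) - r)) \<le> d - (i + 1) - r"
    let ?t = "c + (d - i - r)"
    have "?t < n" using b i d partitions_nth_le[OF mu, of r] by (auto simp: boxes_def)
    then have "u i (?t + 1) \<le> u (i + 1) ?t + 1" using i by (intro patternD(5)[OF p]) auto
    moreover have "c + 1 + (d - (i + 1) - r) = ?t" using i by auto
    ultimately show "u i (c + 1 + (d - i - r)) \<le> d - i - r" using le i by auto
  qed (use i in auto)
  have v1: "1 \<le> val r c" if b: "(r, c) \<in> boxes d mu" for r c
  proof -
    have r: "r < d" "c < mu ! r" using b by (auto simp: boxes_def)
    let ?t = "c + 1 + (d - 1 - r)"
    have "?t \<le> n" using r d partitions_nth_le[OF mu, of r] by auto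
    then have "u 1 ?t = card {j \<in> {1..d}. mu ! (d - j) + j \<le> ?t}" by (rule patternD(2)[OF p])
    \<comment> \<open>At line \<open>?t\<close> row \<open>r\<close> has not ended yet, so only ones
      that end rows above it, with \<open>j < d - r\<close>, are counted.\<close>
    also have "\<dots> \<le> card {1..<d - r}"
    proof (intro card_mono subsetI)
      fix j assume j: "j \<in> {j \<in> {1..d}. mu ! (d - j) + j \<le> ?t}"
      have "j < d - r"
      proof (rule ccontr)
        assume "\<not> j < d - r"
        then have "mu ! r \<le> mu ! (d - j)" using j r by (intro partitions_nth_mono[OF mu]) auto
        then show False using j r \<open>\<not> j < d - r\<close> by auto
      qed
      then show "j \<in> {1..<d - r}" using j by auto
    qed simp
    finally show ?thesis using v[OF b, of 1] r by auto
  qed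
  have v2: "val r c + r \<le> d" if "(r, c) \<in> boxes d mu" for r c
  proof -
    have "val r c \<le> card {1..d - r}" unfolding val_def by (intro card_mono) auto
    then show ?thesis using that by (auto simp: boxes_def)
  qed
  have "map length B = mu" using len by (intro nth_equalityI) (auto simp: B_def)
  then have "fills d mu u x B"
    unfolding fills_def using nthB v v1 v2 by (auto simp: val_at_def barred_at_def strip_def)
  then show ?thesis by (rule that)
qed

section \<open>Weights\<close>

text \<open>\<open>puzzle_pattern\<close> yields these equivalences for one pattern, and
  \<open>realizes_unique\<close> shows that it agrees with the given one.\<close>

lemma realizes_rise:
  assumes d: "1 \<le> d" "d \<le> n" and lam: "lam \<in> partitions d n" and mu: "mu \<in> partitions d n"
    and nu: "nu \<in> partitions d n" and l: "proper (trapezoid n) l" and bd: "boundary_labels n d lam mu nu l"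
    and p: "pattern n d lam mu nu u x" and r: "realizes n d l u x" and t: "t < n" and i: "i \<in> {1..d}"
  shows "rise_at n l t (x i t) = 1 \<longleftrightarrow> u i (t + 1) = u i t + 1"
    and "rise_at n l t (x i t) = 2 \<longleftrightarrow> x i (t + 1) = x i t - 1"
proof -
  obtain u' x' where p': "pattern n d lam mu nu u' x'" and r': "realizes n d l u' x'"
    and R: "\<And>t i. t < n \<Longrightarrow> i \<in> {1..d} \<Longrightarrow> rise_at n l t (x' i t) = 1 \<longleftrightarrow> u' i (t + 1) = u' i t + 1"
    "\<And>t i. t < n \<Longrightarrow> i \<in> {1..d} \<Longrightarrow> rise_at n l t (x' i t) = 2 \<longleftrightarrow> x' i (t + 1) = x' i t - 1"
    using puzzle_pattern[OF d lam mu nu l bd] by blast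
  note U = realizes_unique[OF p p' r r' d(2) lam nu]
  have "x i t = x' i t" "x i (t + 1) = x' i (t + 1)" "u i t = u' i t" "u i (t + 1) = u' i (t + 1)"
    using U(1)[of t] U(1)[of "t + 1"] U(2)[of t] U(2)[of "t + 1"] t i by auto
  then show "rise_at n l t (x i t) = 1 \<longleftrightarrow> u i (t + 1) = u i t + 1"
    and "rise_at n l t (x i t) = 2 \<longleftrightarrow> x i (t + 1) = x i t - 1" using R[OF t i] by auto
qed

text \<open>The piece of path \<open>i\<close> that covers the upward triangle in strip \<open>s\<close>.\<close>

definition path_piece :: "(nat \<Rightarrow> nat \<Rightarrow> nat) \<Rightarrow> (nat \<Rightarrow> nat \<Rightarrow> int) \<Rightarrow> nat \<Rightarrow> nat \<Rightarrow> piece" where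
  "path_piece u x i s =
     (if u i s \<noteq> u (i + 1) s then RhHR else if u i (s + 1) = u i s + 1 then Up1
      else if x i (s + 1) = x i s - 1 then RhHF else Equiv)"

text \<open>The falling and rising label at the path determine the upward triangle, and its
  horizontal label together with the next line determines the downward triangle below it.\<close>

lemma path_piece_in:
  assumes d: "1 \<le> d" "d \<le> n" and lam: "lam \<in> partitions d n" and mu: "mu \<in> partitions d n"
    and nu: "nu \<in> partitions d n" and l: "proper (trapezoid n) l" and bd: "boundary_labels n d lam mu nu l"
    and p: "pattern n d lam mu nu u x" and r: "realizes n d l u x" and s: "s < n" and i: "i \<in> {1..d}"
  shows "(path_piece u x i s, x i s, int n - 1 - int s - x i s) \<in> pieces (trapezoid n) l"
    and "u (i + 1) (s + 1) = u (i + 1) s + 1 \<Longrightarrow>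
      (Dn1, x i s, int n - 2 - int s - x i s) \<in> pieces (trapezoid n) l"
proof -
  let ?a = "x i s" and ?b = "int n - 1 - int s - x i s"
  have sn: "s \<le> n" "s + 1 \<le> n" using s by auto
  note R = realizes_rise[OF d lam mu nu l bd p r s i]
  have a: "0 \<le> ?a" "?a < int n" using pattern_bounds[OF p d(2) lam nu i sn(1)] by auto
  have f: "fall_at n l s ?a = 1 + (u i s - u (i + 1) s)" by (rule realizesD(1)[OF r sn(1) i])
  have g: "fall_at n l (s + 1) (x i (s + 1)) = 1 + (u i (s + 1) - u (i + 1) (s + 1))"
    by (rule realizesD(1)[OF r sn(2) i])
  note L = strip_legal_full[OF l s a]
  have up: "Upw ?a ?b \<in> trapezoid n" using a s by (simp add: Upw_trapezoid)
  have drop: "u (i + 1) s \<le> u i s" "u i s \<le> u (i + 1) s + 1"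
    using patternD(3)[OF p sn(1) i] pattern_drop[OF p i sn(1)] by auto
  have at: "hor_at n l s ?a = l (Hor ?a ?b)" "rise_at n l s ?a = l (Rise ?a ?b)" "fall_at n l s ?a = l (Fall ?a ?b)"
    by (simp_all add: hor_at_def rise_at_def fall_at_def)
  have hor: "path_piece u x i s = RhHR \<or> path_piece u x i s = Up1 \<Longrightarrow> l (Hor ?a ?b) = 1"
    using L(1) f R drop unfolding path_piece_def at legal_def by (auto split: if_splits)
  show "(path_piece u x i s, ?a, ?b) \<in> pieces (trapezoid n) l"
    using L(1) f R drop up unfolding path_piece_def at legal_def by (auto simp: pieces_simps split: if_splits)
  assume inc: "u (i + 1) (s + 1) = u (i + 1) s + 1"
  have le: "u (i + 1) (s + 1) \<le> u i (s + 1)" using patternD(3)[OF p sn(2) i] .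
  have le': "u i (s + 1) \<le> u (i + 1) s + 1" "u i s \<le> u i (s + 1)" using patternD(4,5)[OF p s i] by auto
  have stay: "x i (s + 1) = x i s" using patternD(9)[OF p s i] inc le by auto
  have "path_piece u x i s = RhHR \<or> path_piece u x i s = Up1"
    using inc le le' drop unfolding path_piece_def by auto
  then have h: "l (Hor ?a ?b) = 1" by (rule hor)
  have "fall_at n l (s + 1) ?a = 1" using g stay inc le le' by simp
  then have "rise_at n l s (?a + 1) = 1" using L(2) h at unfolding legal_def by auto
  moreover have "Dnw ?a (?b - 1) \<in> trapezoid n" using a s by (simp add: Dnw_trapezoid)
  ultimately have "(Dn1, ?a, ?b - 1) \<in> pieces (trapezoid n) l"
    using h \<open>fall_at n l (s + 1) ?a = 1\<close> by (simp add: pieces_simps rise_at_def fall_at_def algebra_simps)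
  then show "(Dn1, x i s, int n - 2 - int s - x i s) \<in> pieces (trapezoid n) l"
    by (simp add: algebra_simps)
qed

text \<open>The steps at which a path is active but stays in place. They index the equivariant
  pieces of the puzzle as well as the barred entries of the tableau, which allows the two products
  to be compared factor by factor.\<close>

definition equiv_steps :: "nat \<Rightarrow> nat \<Rightarrow> (nat \<Rightarrow> nat \<Rightarrow> nat) \<Rightarrow> (nat \<Rightarrow> nat \<Rightarrow> int) \<Rightarrow> (nat \<times> nat) set" where
  "equiv_steps n d u x = {(i, s). i \<in> {1..d} \<and> s < n \<and> u i (s + 1) = u (i + 1) s \<and> x i (s + 1) = x i s}"

lemma equivariant_pieces_eq:
  assumes d: "1 \<le> d" "d \<le> n" and lam: "lam \<in> partitions d n" and mu: "mu \<in> partitions d n"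
    and nu: "nu \<in> partitions d n" and l: "proper (trapezoid n) l" and bd: "boundary_labels n d lam mu nu l"
    and p: "pattern n d lam mu nu u x" and r: "realizes n d l u x"
  shows "equivariant_pieces (pieces (trapezoid n) l) =
    image_mset (\<lambda>(i, s). (Equiv, x i s, int n - 1 - int s - x i s)) (mset_set (equiv_steps n d u x))"
proof -
  let ?g = "\<lambda>(i, s). (Equiv, x i s, int n - 1 - int s - x i s)"
  let ?P = "pieces (trapezoid n) l"
  have "{y \<in> ?P. fst y = Equiv} = ?g ` equiv_steps n d u x"
  proof (intro equalityI subsetI)
    fix y assume y: "y \<in> {y \<in> ?P. fst y = Equiv}"
    then obtain a b where ab: "y = (Equiv, a, b)" by (cases y) auto
    then have e: "Upw a b \<in> trapezoid n" "l (Hor a b) = 3" "l (Rise a b) = 0" "l (Fall a b) = 1"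
      using y by (auto simp: pieces_simps)
    then have c: "0 \<le> a" "a < int n" "- int n \<le> b" "a + b \<le> int n - 1" by (auto simp: Upw_trapezoid)
    let ?s = "nat (int n - 1 - a - b)"
    have b: "b = int n - 1 - int ?s - a" using c by auto
    have at: "hor_at n l ?s a = 3" "rise_at n l ?s a = 0" "fall_at n l ?s a = 1"
      using e b by (simp_all add: hor_at_def rise_at_def fall_at_def)
    \<comment> \<open>Below line \<open>n\<close> horizontal labels are at most 1, which leaves no
      equivariant pieces there.\<close>
    have s: "?s < n"
    proof (rule ccontr)
      assume "\<not> ?s < n"
      then have "hor_at n l ?s a = (if fall_at n l n a = 0 then 0 else 1)"
        using lower_forced[OF l realizes_final[OF p r mu d(2)], of ?s a] c by auto
      then show False using at(1) by (auto split: if_splits)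
    qed
    then obtain i where i: "i \<in> {1..d}" "a = x i ?s" using realizesD(2)[OF r, of ?s a] c at by auto
    note R = realizes_rise[OF d lam mu nu l bd p r s i(1)]
    have "u i ?s = u (i + 1) ?s"
      using realizesD(1)[OF r _ i(1), of ?s] patternD(3)[OF p _ i(1), of ?s] s at i by auto
    then have "u i (?s + 1) = u (i + 1) ?s"
      using patternD(4,5)[OF p s i(1)] R(1) at(2) i(2) by auto
    moreover have "x i (?s + 1) = x i ?s" using patternD(9)[OF p s i(1)] R(2) at(2) i(2) by auto
    ultimately have "(i, ?s) \<in> equiv_steps n d u x" using i s by (simp add: equiv_steps_def)
    moreover have "y = ?g (i, ?s)" using ab b i(2) by simp
    ultimately show "y \<in> ?g ` equiv_steps n d u x" by blast
  next
    fix y assume "y \<in> ?g ` equiv_steps n d u x"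
    then obtain i s where y: "y = ?g (i, s)" and e: "(i, s) \<in> equiv_steps n d u x" by auto
    then have i: "i \<in> {1..d}" and s: "s < n" and u: "u i (s + 1) = u (i + 1) s" and x: "x i (s + 1) = x i s"
      by (auto simp: equiv_steps_def)
    have "u i s \<le> u i (s + 1)" "u (i + 1) s \<le> u i s" using patternD(3,4)[OF p _ i, of s] s by auto
    then have "path_piece u x i s = Equiv" using u x by (simp add: path_piece_def)
    then show "y \<in> {y \<in> ?P. fst y = Equiv}"
      using path_piece_in(1)[OF d lam mu nu l bd p r s i] y by simp
  qed
  moreover have "inj_on ?g (equiv_steps n d u x)"
  proof (rule inj_onI)
    fix y z assume yz: "y \<in> equiv_steps n d u x" "z \<in> equiv_steps n d u x" "?g y = ?g z"
    obtain i s i' s' where ys: "y = (i, s)" "z = (i', s')" by (cases y, cases z)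
    then have eq: "s = s'" "x i s = x i' s" and i: "i \<in> {1..d}" "i' \<in> {1..d}" "s < n"
      using yz by (auto simp: equiv_steps_def)
    have "x i s < x j s" if "i < j" "i \<in> {1..d}" "j \<in> {1..d}" for i j
      using less_chain[of d "\<lambda>i. x i s" i j, OF patternD(8)[OF p]] that i by auto
    from this[of i i'] this[of i' i] show "y = z" using eq i ys by (cases i i' rule: linorder_cases) auto
  qed
  ultimately show ?thesis
    unfolding equivariant_pieces_def by (simp add: image_mset_mset_set)
qed

lemma barred_boxes_eq:
  assumes p: "pattern n d lam mu nu u x" and mu: "mu \<in> partitions d n" and d: "d \<le> n"
    and B: "fills d mu u x B"
  shows "barred_boxes (A, B) =
    image_mset (\<lambda>(i, s). (d - i - u i s, s - u i s)) (mset_set (equiv_steps n d u x))"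
proof -
  let ?h = "\<lambda>(i, s). (d - i - u i s, s - u i s)"
  note F = fills_mu_filling[OF p mu d B]
  have vs: "val_at B (?h y) = fst y \<and> strip d B (?h y) = snd y \<and> ?h y \<in> boxes d mu"
    if "y \<in> equiv_steps n d u x" for y
  proof -
    obtain i s where y: "y = (i, s)" by (cases y)
    then have "i \<in> {1..d}" "s < n" "u i (s + 1) = u (i + 1) s" using that by (auto simp: equiv_steps_def)
    from active_box(3,4,5)[OF p mu d B this] show ?thesis using y by simp
  qed
  have "{b \<in> boxes d mu. barred_at B b} = ?h ` equiv_steps n d u x"
  proof (intro equalityI subsetI)
    fix b assume b: "b \<in> {b \<in> boxes d mu. barred_at B b}"
    obtain r c where rc: "b = (r, c)" by (cases b)
    have box: "(r, c) \<in> boxes d mu" using b rc by simp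
    let ?v = "val_at B (r, c)" and ?s = "strip d B (r, c)"
    note A = box_active_pattern[OF p mu d B box]
    have "x ?v (?s + 1) = x ?v ?s" using fillsD(4)[OF B box] b rc by simp
    then have "(?v, ?s) \<in> equiv_steps n d u x" using A by (simp add: equiv_steps_def)
    moreover have "b = ?h (?v, ?s)" using A(4-6) rc by simp
    ultimately show "b \<in> ?h ` equiv_steps n d u x" by (rule image_eqI[rotated])
  next
    fix b assume "b \<in> ?h ` equiv_steps n d u x"
    then obtain y where y: "b = ?h y" "y \<in> equiv_steps n d u x" by blast
    obtain r c where rc: "b = (r, c)" by (cases b)
    from vs[OF y(2)] y rc have "val_at B (r, c) = fst y" "strip d B (r, c) = snd y" "(r, c) \<in> boxes d mu" by auto
    then show "b \<in> {b \<in> boxes d mu. barred_at B b}"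
      using fillsD(4)[OF B, of r c] y rc by (auto simp: equiv_steps_def)
  qed
  moreover have "inj_on ?h (equiv_steps n d u x)"
  proof (rule inj_onI)
    fix y z assume y: "y \<in> equiv_steps n d u x" and z: "z \<in> equiv_steps n d u x" and eq: "?h y = ?h z"
    have "fst y = val_at B (?h y)" "snd y = strip d B (?h y)" using vs[OF y] by auto
    moreover have "fst z = val_at B (?h z)" "snd z = strip d B (?h z)" using vs[OF z] by auto
    ultimately show "y = z" unfolding eq by (simp add: prod_eq_iff)
  qed
  moreover have "barred_boxes (A, B) = mset_set {b \<in> boxes d mu. barred_at B b}"
  proof -
    have "distinct (filter (barred_at B) (mu_boxes B))"
      by (intro distinct_filter sorted_wrt_asym_distinct[OF sorted_mu_boxes mu_before_asym])
    then have "mset (filter (barred_at B) (mu_boxes B)) = mset_set (set (filter (barred_at B) (mu_boxes B)))"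
      by (simp only: mset_set_set)
    then show ?thesis using mu_filling_shape(3)[OF F mu] by (simp add: barred_boxes_def)
  qed
  ultimately show ?thesis by (simp add: image_mset_mset_set)
qed

text \<open>Among entries of equal value the reading order is the order of the strips. So the count
  is \<open>lam ! (v - 1)\<close> plus the number of left steps that path \<open>v\<close> has made,
  where \<open>v\<close> is the value in the box, and this fixes the position of the path.\<close>

lemma omega_before_eq:
  assumes p: "pattern n d lam mu nu u x" and lam: "lam \<in> partitions d n" and mu: "mu \<in> partitions d n"
    and d: "d \<le> n" and B: "fills d mu u x B" and b: "b \<in> boxes d mu"
  shows "omega_before (lam_rows d lam, B) b =
    int n - 1 - int d + int (val_at B b) - x (val_at B b) (strip d B b)"
proof -
  note F = fills_mu_filling[OF p mu d B]
  obtain r c where rc: "b = (r, c)" by (cases b)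
  let ?v = "val_at B b" and ?s = "strip d B b"
  have v: "?v \<in> {1..d}" "?s < n" using box_active_pattern(1,2)[OF p mu d B] b rc by auto
  let ?bs = "filter (\<lambda>b. \<not> barred_at B b) (takeWhile (\<lambda>x. x \<noteq> b) (mu_boxes B))"
  have "b \<in> set (mu_boxes B)" using b mu_filling_shape(3)[OF F mu] by simp
  from set_takeWhile_sorted_wrt[OF sorted_mu_boxes mu_before_asym this]
  have "{a \<in> set ?bs. val_at B a = ?v} = {a \<in> boxes d mu. \<not> barred_at B a \<and> val_at B a = ?v \<and> strip d B a < ?s}"
    using mu_before_iff_strip_less[OF F mu _ b] mu_filling_shape(3)[OF F mu] by auto
  moreover have "distinct ?bs"
    by (intro distinct_filter distinct_takeWhile sorted_wrt_asym_distinct[OF sorted_mu_boxes mu_before_asym])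
  ultimately have "count_list (map (val_at B) ?bs) ?v = unbarred_upto d mu B ?v ?s"
    by (simp add: count_list_map_distinct unbarred_upto_def)
  then have "omega_before (lam_rows d lam, B) b = int (lam ! (?v - 1) + unbarred_upto d mu B ?v ?s)"
    using count_lam_word[OF lam v(1)]
    by (simp add: omega_before_def unbarred_word_before_def unbarred_values_def)
  then show ?thesis
    using fills_unbarred_upto[OF p mu d B v(1), of ?s] v(2) lam by (simp add: pos_def partitions_def)
qed

text \<open>At step \<open>(i, s)\<close> the lines through the piece give \<open>n - x i s\<close>
  and \<open>s + 1\<close>. On the other side \<open>d + 1 - i\<close> is added to the count from
  \<open>omega_before_eq\<close> and to column minus row, which is \<open>s - d + i\<close> because
  the number \<open>u i s\<close> cancels; the same two numbers result.\<close>

lemma weights_eq: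
  assumes d: "1 \<le> d" "d \<le> n" and lam: "lam \<in> partitions d n" and mu: "mu \<in> partitions d n"
    and nu: "nu \<in> partitions d n" and l: "proper (trapezoid n) l" and bd: "boundary_labels n d lam mu nu l"
    and p: "pattern n d lam mu nu u x" and r: "realizes n d l u x" and B: "fills d mu u x B"
  shows "puzzle_c n (pieces (trapezoid n) l) = tableau_c d (lam_rows d lam, B)"
    and "puzzle_C n (pieces (trapezoid n) l) = tableau_C d n (lam_rows d lam, B)"
proof -
  let ?E = "equiv_steps n d u x" and ?h = "\<lambda>(i, s). (d - i - u i s, s - u i s)"
  have finE: "finite ?E"
    by (rule finite_subset[of _ "{1..d} \<times> {..<n}"]) (auto simp: equiv_steps_def)
  have key: "val_at B (?h y) = fst y \<and>
      omega_before (lam_rows d lam, B) (?h y) = int n - 1 - int d + int (fst y) - x (fst y) (snd y) \<and>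
      col_minus_row (?h y) = int (snd y) - int d + int (fst y)" if "y \<in> ?E" for y
  proof -
    obtain i s where y: "y = (i, s)" by (cases y)
    then have "i \<in> {1..d}" "s < n" "u i (s + 1) = u (i + 1) s" using that by (auto simp: equiv_steps_def)
    note A = active_box[OF p mu d(2) B this]
    have "col_minus_row (?h y) = int s - int d + int i"
      using A(1,2) y by (simp add: col_minus_row_def)
    then show ?thesis using A(4,5) omega_before_eq[OF p lam mu d(2) B A(3)] y by simp
  qed
  show "puzzle_c n (pieces (trapezoid n) l) = tableau_c d (lam_rows d lam, B)"
    unfolding puzzle_c_def tableau_c_def barred_boxes_eq[OF p mu d(2) B] equivariant_pieces_eq[OF d lam mu nu l bd p r]
      multiset.map_comp
    by (rule image_mset_cong) (use key finE in \<open>auto simp: Let_def line_e_def line_f_def\<close>)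
  show "puzzle_C n (pieces (trapezoid n) l) = tableau_C d n (lam_rows d lam, B)"
    unfolding puzzle_C_def tableau_C_def barred_boxes_eq[OF p mu d(2) B] equivariant_pieces_eq[OF d lam mu nu l bd p r]
      multiset.map_comp
    by (rule image_mset_cong) (use key finE in \<open>auto simp: Let_def line_e_def line_f_def\<close>)
qed

section \<open>Puzzles as trapezoid puzzles\<close>

lemma Upw_triangle: "Upw a b \<in> triangle n \<longleftrightarrow> 0 \<le> a \<and> 0 \<le> b \<and> a + b \<le> int n - 1"
  by (auto simp: triangle_def)

lemma Dnw_triangle: "Dnw a b \<in> triangle n \<longleftrightarrow> 0 \<le> a \<and> 0 \<le> b \<and> a + b \<le> int n - 2"
  by (auto simp: triangle_def)

text \<open>Below D the label of an edge of D is repeated down its strip; under a 1 the strip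
  consists of \<open>RhHR\<close>, whose diagonal is the falling edge with label 2.\<close>

fun extend_labels :: "(edge \<Rightarrow> nat) \<Rightarrow> edge \<Rightarrow> nat" where
  "extend_labels l (Hor a b) = (if 0 \<le> b then l (Hor a b) else l (Hor a 0))"
| "extend_labels l (Rise a b) = (if 0 \<le> b then l (Rise a b) else 0)"
| "extend_labels l (Fall a b) =
     (if 0 \<le> b then l (Fall a b) else if l (Hor a 0) = 1 then 2 else 0)"

lemma triangle_bottom:
  assumes "proper (triangle n) l" "0 \<le> a" "a < int n"
  shows "l (Hor a 0) \<le> 1"
  by (rule properD(3)[OF assms(1)]) (use assms(2,3) in \<open>auto simp: Upw_triangle Dnw_triangle\<close>)

lemma proper_extend_labels:
  assumes l: "proper (triangle n) l"
  shows "proper (trapezoid n) (extend_labels l)"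
  unfolding proper_def
proof (intro conjI allI impI)
  fix a b
  note bot = triangle_bottom[OF l, of a]
  {
    assume u: "Upw a b \<in> trapezoid n"
    show "legal (extend_labels l (Hor a b)) (extend_labels l (Rise a b)) (extend_labels l (Fall a b))"
    proof (cases "0 \<le> b")
      case True
      then have "Upw a b \<in> triangle n" using u by (auto simp: Upw_triangle Upw_trapezoid)
      from properD(1)[OF l this] True show ?thesis by simp
    next
      case False
      then have "l (Hor a 0) = 0 \<or> l (Hor a 0) = 1" using bot u by (auto simp: Upw_trapezoid)
      then show ?thesis using False by (auto simp: legal_def)
    qed
  next
    assume u: "Dnw a b \<in> trapezoid n"
    show "legal (extend_labels l (Hor a (b + 1))) (extend_labels l (Rise (a + 1) b)) (extend_labels l (Fall a b))"
    proof (cases "0 \<le> b")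
      case True
      then have "Dnw a b \<in> triangle n" using u by (auto simp: Dnw_triangle Dnw_trapezoid)
      from properD(2)[OF l this] True show ?thesis by simp
    next
      case False
      then have "l (Hor a 0) = 0 \<or> l (Hor a 0) = 1" using bot u by (auto simp: Dnw_trapezoid)
      moreover have "extend_labels l (Hor a (b + 1)) = l (Hor a 0)" using False by (cases "b = - 1") auto
      ultimately show ?thesis using False by (auto simp: legal_def)
    qed
  next
    assume "(Upw a b \<in> trapezoid n) \<noteq> (Dnw a (b - 1) \<in> trapezoid n)"
    then have "0 \<le> a" "a < int n" "b = - int n" by (auto simp: Upw_trapezoid Dnw_trapezoid)
    then show "extend_labels l (Hor a b) \<le> 1" using bot by simp
  next
    assume "(Upw a b \<in> trapezoid n) \<noteq> (Dnw (a - 1) b \<in> trapezoid n)"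
    then have c: "a = 0 \<and> b \<le> int n - 1 \<or> b < 0" by (auto simp: Upw_trapezoid Dnw_trapezoid)
    have "l (Rise a b) \<le> 1" if "0 \<le> b"
      by (rule properD(4)[OF l]) (use that c in \<open>auto simp: Upw_triangle Dnw_triangle\<close>)
    then show "extend_labels l (Rise a b) \<le> 1" by simp
  next
    assume "(Upw a b \<in> trapezoid n) \<noteq> (Dnw a b \<in> trapezoid n)"
    then have c: "0 \<le> a" "a < int n" "b = int n - 1 - a" by (auto simp: Upw_trapezoid Dnw_trapezoid)
    have "l (Fall a b) \<le> 1"
      by (rule properD(5)[OF l]) (use c in \<open>auto simp: Upw_triangle Dnw_triangle\<close>)
    then show "extend_labels l (Fall a b) \<le> 1" using c by simp
  }
qed

lemma strip_embed_pieces: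
  assumes P: "tiling (triangle n) P"
  shows "strip_embed n P = pieces (trapezoid n) (extend_labels (labelling P))"
proof -
  let ?l = "labelling P"
  let ?N = "{(RhHR, a, b) | a b. 0 \<le> a \<and> a < int n \<and> - int n \<le> b \<and> b < 0 \<and> edge_label P (Hor a 0) = 1}
     \<union> {(q, a, b) | q a b. q \<in> {Up0, Dn0} \<and> 0 \<le> a \<and> a < int n \<and> - int n \<le> b \<and> b < 0 \<and> edge_label P (Hor a 0) = 0}"
  note pr = labelling_proper[OF P]
  have nn: "0 \<le> b" if "(p, a, b) \<in> P" for p a b
  proof -
    have "Upw a b \<in> triangle n \<or> Dnw a b \<in> triangle n"
      using P that unfolding tiling_def by (cases p) fastforce+
    then show ?thesis by (auto simp: Upw_triangle Dnw_triangle)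
  qed
  have edge: "edge_label P (Hor a 0) = ?l (Hor a 0) \<and> ?l (Hor a 0) \<le> 1" if "0 \<le> a" "a < int n" for a
    using triangle_bottom[OF pr that] edge_label_labelling by blast
  have "(p, a, b) \<in> strip_embed n P \<longleftrightarrow> (p, a, b) \<in> pieces (trapezoid n) (extend_labels ?l)" for p a b
  proof (cases "0 \<le> b")
    case True
    then have "(p, a, b) \<in> strip_embed n P \<longleftrightarrow> (p, a, b) \<in> pieces (triangle n) ?l"
      unfolding strip_embed_def pieces_labelling[OF P] by auto
    also have "\<dots> \<longleftrightarrow> (p, a, b) \<in> pieces (trapezoid n) (extend_labels ?l)"
      using True
      by (cases p) (auto simp: pieces_simps Upw_triangle Dnw_triangle Upw_trapezoid Dnw_trapezoid simp del: labelling.simps)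
    finally show ?thesis .
  next
    case False
    have hb: "extend_labels ?l (Hor a b) = ?l (Hor a 0)" "extend_labels ?l (Hor a (b + 1)) = ?l (Hor a 0)"
      using False by (cases "b = - 1"; simp del: labelling.simps)+
    have "(p, a, b) \<in> strip_embed n P \<longleftrightarrow> (p, a, b) \<in> ?N" using False nn[of p a b] unfolding strip_embed_def by blast
    also have "\<dots> \<longleftrightarrow> (p, a, b) \<in> pieces (trapezoid n) (extend_labels ?l)"
      using False edge[of a] hb
      by (cases p) (auto simp: pieces_simps Upw_trapezoid Dnw_trapezoid simp del: labelling.simps)
    finally show ?thesis .
  qed
  then show ?thesis by (auto simp: set_eq_iff)
qed

lemma LP_plus_boundary:
  assumes d: "d \<le> n" and lam: "lam \<in> partitions d n" and mu: "mu \<in> partitions d n" and nu: "nu \<in> partitions d n"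
    and P: "P \<in> LP_plus n lam mu nu"
  shows "boundary_labels n d lam mu nu (extend_labels (labelling P))"
proof -
  let ?l = "labelling P"
  note [simp del] = labelling.simps
  from P have T: "tiling (triangle n) P" by (simp add: LP_plus_def)
  note L = properD[OF labelling_proper[OF T]]
  have w: "?l (Rise 0 b) \<le> 1" if "b \<in> {0..int n - 1}" for b
    by (rule L(4)) (use that in \<open>auto simp: Upw_triangle Dnw_triangle\<close>)
  have s: "?l (Hor p 0) \<le> 1" if "p \<in> {0..int n - 1}" for p
    by (rule L(3)) (use that in \<open>auto simp: Upw_triangle Dnw_triangle\<close>)
  have ne: "?l (Fall p (int n - 1 - p)) \<le> 1" if "p \<in> {0..int n - 1}" for p
    by (rule L(5)) (use that in \<open>auto simp: Upw_triangle Dnw_triangle\<close>)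
  have sides: "side_partition P (NE_side n) = lam \<longleftrightarrow>
      (\<forall>p\<in>{0..int n - 1}. ?l (Fall p (int n - 1 - p)) = 1 \<longleftrightarrow> (\<exists>i\<in>{1..d}. p = pos n lam i))"
    "side_partition P (NW_side n) = mu \<longleftrightarrow>
      (\<forall>p\<in>{0..int n - 1}. ?l (Rise 0 p) = 1 \<longleftrightarrow> (\<exists>i\<in>{1..d}. p = pos n mu i))"
    "side_partition P (horizontal_side n 0) = nu \<longleftrightarrow>
      (\<forall>p\<in>{0..int n - 1}. ?l (Hor p 0) = 1 \<longleftrightarrow> (\<exists>i\<in>{1..d}. p = pos n nu i))"
    unfolding NE_side_def NW_side_def horizontal_side_def
    by (rule side_partition_labelling; use d lam mu nu w ne s in force)+
  then show ?thesis using P unfolding LP_plus_def boundary_labels_def by auto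
qed

section \<open>Paths of a puzzle inside its extension\<close>

lemma path_from_to_append:
  "path_from_to P e (xs @ ys) f \<longleftrightarrow> (\<exists>g. path_from_to P e xs g \<and> path_from_to P g ys f)"
  by (induction xs arbitrary: e) auto

lemma entry_edge_cases:
  "entry_edge (p, a, b) = Some (Fall a' b') \<longleftrightarrow> p \<in> {RhHF, Equiv, Up1} \<and> a' = a \<and> b' = b"
  "entry_edge (p, a, b) = Some (Hor a' b') \<longleftrightarrow> p \<in> {RhHR, Dn1} \<and> a' = a \<and> b' = b + 1"
  "entry_edge (p, a, b) \<noteq> Some (Rise a' b')"
  by (cases p; auto)+

text \<open>The entry edge singles out a triangle of the piece: the downward one under a horizontal
  edge, the upward one at a falling edge.\<close>

lemma entry_edge_unique:
  assumes "tiling R P" "x \<in> P" "y \<in> P" "entry_edge x = Some e" "entry_edge y = Some e"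
  shows "x = y"
proof -
  obtain p a b q a' b' where xy: "x = (p, a, b)" "y = (q, a', b')" by (cases x, cases y)
  have "\<exists>c. c \<in> cells x \<and> c \<in> cells y"
  proof (cases e)
    case (Hor c h)
    then show ?thesis using assms(4,5) unfolding xy
      by (intro exI[of _ "Dnw c (h - 1)"]) (auto simp: entry_edge_cases)
  next
    case (Fall c h)
    then show ?thesis using assms(4,5) unfolding xy
      by (intro exI[of _ "Upw c h"]) (auto simp: entry_edge_cases)
  qed (use assms(4) xy in \<open>simp add: entry_edge_cases\<close>)
  then show ?thesis using tiling_unique[OF assms(1-3)] by blast
qed

text \<open>A path cannot branch, since each edge is the entry of at most one piece, and it cannot
  continue beyond D. This justifies the description operator in \<open>path\<close>.\<close>

lemma path_unique:
  assumes P: "tiling (triangle n) P"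
    and "path_from_to P e xs (Hor a 0)" "path_from_to P e ys (Hor a' 0)"
  shows "xs = ys"
  using assms(2,3)
proof (induction xs arbitrary: e ys)
  have stop: "entry_edge x \<noteq> Some (Hor a 0)" if "x \<in> P" for x a
  proof
    assume e: "entry_edge x = Some (Hor a 0)"
    obtain p c b where x: "x = (p, c, b)" by (cases x)
    have "Dnw c b \<in> cells x" "b = - 1" using e unfolding x by (auto simp: entry_edge_cases)
    then have "Dnw c (- 1) \<in> triangle n" using P that unfolding tiling_def by blast
    then show False by (simp add: Dnw_triangle)
  qed
  {
    case Nil
    then have "path_from_to P (Hor a 0) ys (Hor a' 0)" by simp
    then show ?case using stop by (cases ys) auto
  next
    case (Cons x xs)
    show ?case
    proof (cases ys)
      case Nil
      then have "x \<in> P" "entry_edge x = Some (Hor a' 0)" using Cons.prems by auto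
      then show ?thesis using stop by blast
    next
      case (Cons y ys')
      then have "x = y" using Cons.prems entry_edge_unique[OF P] by auto
      then show ?thesis using Cons.IH Cons.prems Cons by auto
    qed
  }
qed

lemma strip_embed_outside:
  assumes "(p, a, b) \<in> strip_embed n P" "(p, a, b) \<notin> P"
  shows "p \<in> {RhHR, Up0, Dn0} \<and> b < 0"
  using assms unfolding strip_embed_def by auto

text \<open>Pieces of \<open>P\<close> lie above D, and among the pieces added below only
  \<open>RhHR\<close> can be entered.\<close>

lemma path_below:
  assumes P: "tiling (triangle n) P" and "path_from_to (strip_embed n P) (Hor a h) zs f" "h \<le> 0"
  shows "\<forall>z\<in>set zs. fst z = RhHR"
  using assms(2,3)
proof (induction zs arbitrary: a h)
  case (Cons z zs)
  obtain p c b where z: "z = (p, c, b)" by (cases z)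
  have e: "p \<in> {RhHR, Dn1}" "b = h - 1" "c = a" "z \<in> strip_embed n P"
    using Cons.prems z by (auto simp: entry_edge_cases)
  have "z \<notin> P"
  proof
    assume "z \<in> P"
    moreover have "Dnw c b \<in> cells z" using e z by auto
    ultimately have "Dnw c b \<in> triangle n" using P unfolding tiling_def by blast
    then show False using e Cons.prems by (simp add: Dnw_triangle)
  qed
  then have p: "p = RhHR" using e z strip_embed_outside[of p c b n P] by auto
  then have "path_from_to (strip_embed n P) (Hor c b) zs f" using Cons.prems z by auto
  then show ?case using Cons.IH[of c b] e Cons.prems p z by simp
qed simp

text \<open>\<open>path\<close> stops at D, while a pattern describes a path down to line
  \<open>n\<close>. The part beyond D is a run of \<open>RhHR\<close>. The last hypothesis is the
  invariant of the induction: it keeps the current edge above or on D, so the cut happens on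
  D.\<close>

lemma path_cut:
  assumes P: "tiling (triangle n) P" and "path_from_to (strip_embed n P) e xs (Hor a h)" "h \<le> 0"
    and "(\<exists>a b. e = Fall a b \<and> 0 \<le> b) \<or> (\<exists>a b. e = Hor a b \<and> 0 \<le> b \<and> 0 \<le> a \<and> a < int n)"
  shows "\<exists>ys zs a'. xs = ys @ zs \<and> path_from_to P e ys (Hor a' 0) \<and> 0 \<le> a' \<and> a' < int n \<and>
    (\<forall>z\<in>set zs. fst z = RhHR)"
  using assms(2,4)
proof (induction xs arbitrary: e)
  case Nil
  then have "e = Hor a h" "0 \<le> a" "a < int n" "h = 0" using assms(3) by auto
  then show ?case by auto
next
  case (Cons x xs)
  show ?case
  proof (cases "\<exists>a. e = Hor a 0")
    case True
    then obtain a' where a': "e = Hor a' 0" "0 \<le> a'" "a' < int n" using Cons.prems by auto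
    have "path_from_to (strip_embed n P) (Hor a' 0) (x # xs) (Hor a h)"
      using Cons.prems(1) unfolding a'(1) .
    then have "\<forall>z\<in>set (x # xs). fst z = RhHR" by (rule path_below[OF P]) simp
    then show ?thesis using a' by (intro exI[of _ "[]"] exI[of _ "x # xs"] exI[of _ a']) simp
  next
    case False
    obtain p c b where x: "x = (p, c, b)" by (cases x)
    obtain g where g: "x \<in> strip_embed n P" "entry_edge x = Some e" "exit_edge x = Some g"
      "path_from_to (strip_embed n P) g xs (Hor a h)" using Cons.prems by auto
    have b: "0 \<le> b" "p \<in> {RhHF, Equiv, Up1, RhHR, Dn1}"
      using Cons.prems(2) False g(2) unfolding x by (auto simp: entry_edge_cases)
    then have xP: "x \<in> P" using g(1) strip_embed_outside[of p c b n P] x by auto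
    then have cells: "cells x \<subseteq> triangle n" using P unfolding tiling_def by blast
    have "(\<exists>a b. g = Fall a b \<and> 0 \<le> b) \<or> (\<exists>a b. g = Hor a b \<and> 0 \<le> b \<and> 0 \<le> a \<and> a < int n)"
      using b cells g(3) unfolding x by (auto simp: Upw_triangle Dnw_triangle) blast+
    from Cons.IH[OF g(4) this] obtain ys zs a' where ih: "xs = ys @ zs" "path_from_to P g ys (Hor a' 0)"
      "0 \<le> a'" "a' < int n" "\<forall>z\<in>set zs. fst z = RhHR" by blast
    then have "path_from_to P e (x # ys) (Hor a' 0)" using xP g by simp
    then show ?thesis using ih by (intro exI[of _ "x # ys"] exI[of _ zs] exI[of _ a']) simp
  qed
qed

text \<open>The tail has neither upward nor downward 1-triangles. As long as an upward one remains,
  every cut at a downward 1-triangle and the final one fall inside \<open>ys\<close>.\<close>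

lemma segment_append:
  assumes zs: "\<forall>z\<in>set zs. fst z = RhHR"
    and up: "\<exists>p \<in> set (((\<lambda>ys. tl (dropWhile (\<lambda>x. fst x \<noteq> Dn1) ys)) ^^ j) (ys @ zs)). fst p = Up1"
  shows "segment (ys @ zs) (j + 1) = segment ys (j + 1)"
proof -
  let ?D = "\<lambda>ys. tl (dropWhile (\<lambda>x. fst x \<noteq> Dn1) ys) :: placed list"
  have tl: "set (tl w) \<subseteq> set w" for w :: "placed list" by (cases w) auto
  have sub: "set (?D w) \<subseteq> set w" for w
    using tl set_dropWhileD by fastforce
  have "(?D ^^ j) (ys @ zs) = (?D ^^ j) ys @ zs"
    using up
  proof (induction j)
    case (Suc j)
    then have up: "\<exists>p \<in> set (?D ((?D ^^ j) (ys @ zs))). fst p = Up1" by simp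
    then have ih: "(?D ^^ j) (ys @ zs) = (?D ^^ j) ys @ zs" using Suc.IH sub by blast
    let ?Y = "(?D ^^ j) ys"
    define Y where "Y = ?Y"
    have "\<exists>p \<in> set Y. fst p = Dn1"
    proof (rule ccontr)
      assume "\<not> (\<exists>p \<in> set Y. fst p = Dn1)"
      then have "dropWhile (\<lambda>x. fst x \<noteq> Dn1) (Y @ zs) = dropWhile (\<lambda>x. fst x \<noteq> Dn1) zs"
        by (intro dropWhile_append2) blast
      then have "set (?D (Y @ zs)) \<subseteq> set zs" using sub[of zs] by simp
      moreover obtain p where "p \<in> set (?D (Y @ zs))" "fst p = Up1" using up unfolding ih Y_def by blast
      ultimately have "p \<in> set zs" "fst p = Up1" by blast+
      then show False using zs by auto
    qed
    then obtain p where p: "p \<in> set Y" "fst p = Dn1" by blast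
    then have "dropWhile (\<lambda>x. fst x \<noteq> Dn1) (Y @ zs) = dropWhile (\<lambda>x. fst x \<noteq> Dn1) Y @ zs"
      by (intro dropWhile_append1) auto
    moreover have "dropWhile (\<lambda>x. fst x \<noteq> Dn1) Y \<noteq> []" using p by (auto simp: dropWhile_eq_Nil_conv)
    ultimately have "?D (Y @ zs) = ?D Y @ zs" by simp
    then show ?case using ih by (simp add: Y_def)
  qed simp
  moreover have "takeWhile (\<lambda>x. fst x \<noteq> Up1) ((?D ^^ j) ys @ zs) = takeWhile (\<lambda>x. fst x \<noteq> Up1) ((?D ^^ j) ys)"
  proof -
    obtain p where "p \<in> set ((?D ^^ j) ys @ zs)" "fst p = Up1" using up calculation by auto
    then have "p \<in> set ((?D ^^ j) ys)" using zs by auto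
    then show ?thesis using \<open>fst p = Up1\<close> by (intro takeWhile_append1) auto
  qed
  ultimately show ?thesis by (simp add: segment_def)
qed

text \<open>In a weakly decreasing row equal values are contiguous and the block of the largest
  value comes first; the induction on \<open>m\<close> splits it off.\<close>

lemma concat_filter_values:
  assumes "sorted_wrt (\<lambda>a b. fst b \<le> fst a) row" "\<forall>a\<in>set row. fst a \<in> {1..m}"
  shows "concat (map (\<lambda>i. filter (\<lambda>a. fst a = i) row) (rev [1..<m + 1])) = row"
  using assms
proof (induction m arbitrary: row)
  case 0
  then show ?case by (cases row) auto
next
  case (Suc m)
  have split: "row = filter (\<lambda>a. fst a = M) row @ filter (\<lambda>a. fst a \<noteq> M) row"
    if "sorted_wrt (\<lambda>a b. fst b \<le> fst a) row" "\<forall>a\<in>set row. fst a \<le> M" for M and row :: "(nat \<times> 'a) list"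
    using that
  proof (induction row)
    case (Cons a row)
    show ?case
    proof (cases "fst a = M")
      case False
      then have "fst b < M" if "b \<in> set row" for b using Cons.prems that by fastforce
      then have "filter (\<lambda>a. fst a = M) row = []" by (auto simp: filter_empty_conv)
      then show ?thesis using Cons False by simp
    qed (use Cons in simp)
  qed simp
  let ?rest = "filter (\<lambda>a. fst a \<noteq> m + 1) row"
  have "concat (map (\<lambda>i. filter (\<lambda>a. fst a = i) row) (rev [1..<Suc m + 1]))
    = filter (\<lambda>a. fst a = m + 1) row @ concat (map (\<lambda>i. filter (\<lambda>a. fst a = i) row) (rev [1..<m + 1]))"
    by simp
  also have "concat (map (\<lambda>i. filter (\<lambda>a. fst a = i) row) (rev [1..<m + 1]))
    = concat (map (\<lambda>i. filter (\<lambda>a. fst a = i) ?rest) (rev [1..<m + 1]))"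
  proof (intro arg_cong[where f = concat] map_cong refl)
    fix i assume "i \<in> set (rev [1..<m + 1])"
    then show "filter (\<lambda>a. fst a = i) row = filter (\<lambda>a. fst a = i) ?rest"
      unfolding filter_filter by (intro filter_cong) auto
  qed
  also have "\<dots> = ?rest"
    using Suc.prems by (intro Suc.IH sorted_wrt_filter) auto
  also have "filter (\<lambda>a. fst a = m + 1) row @ ?rest = row"
    using split[of row "m + 1"] Suc.prems by auto
  finally show ?case .
qed

text \<open>Within a strip the path passes also through a downward 1-triangle exactly if path
  \<open>i + 1\<close> meets an upward one there.\<close>

definition path_steps ::
    "nat \<Rightarrow> (nat \<Rightarrow> nat \<Rightarrow> nat) \<Rightarrow> (nat \<Rightarrow> nat \<Rightarrow> int) \<Rightarrow> nat \<Rightarrow> nat \<Rightarrow> placed list" where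
  "path_steps n u x i s =
     (path_piece u x i s, x i s, int n - 1 - int s - x i s) #
     (if u (i + 1) (s + 1) = u (i + 1) s + 1 then [(Dn1, x i s, int n - 2 - int s - x i s)] else [])"

text \<open>The edge through which path \<open>i\<close> enters the piece that covers its upward triangle in strip \<open>s\<close>.\<close>

definition path_edge :: "nat \<Rightarrow> (nat \<Rightarrow> nat \<Rightarrow> nat) \<Rightarrow> (nat \<Rightarrow> nat \<Rightarrow> int) \<Rightarrow> nat \<Rightarrow> nat \<Rightarrow> edge" where
  "path_edge n u x i s =
     (if u i s = u (i + 1) s then Fall (x i s) (int n - 1 - int s - x i s)
      else Hor (x i s) (int n - int s - x i s))"

text \<open>In case \<open>dormant\<close> the path is, on line \<open>s\<close>, between an upward
  and the next downward 1-triangle; in the other cases it is active. Only after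
  \<open>dormant\<close> and \<open>up\<close> can a downward 1-triangle follow in the same
  strip.\<close>

lemma pattern_step_cases:
  assumes p: "pattern n d lam mu nu u x" and s: "s < n" and i: "i \<in> {1..d}"
  obtains (dormant) "u i s = u (i + 1) s + 1" "u i (s + 1) = u i s" "x i (s + 1) = x i s"
      "path_piece u x i s = RhHR" "u (i + 1) (s + 1) = u (i + 1) s \<or> u (i + 1) (s + 1) = u (i + 1) s + 1"
    | (up) "u i s = u (i + 1) s" "u i (s + 1) = u i s + 1" "x i (s + 1) = x i s"
      "path_piece u x i s = Up1" "u (i + 1) (s + 1) = u (i + 1) s \<or> u (i + 1) (s + 1) = u (i + 1) s + 1"
    | (left) "u i s = u (i + 1) s" "u i (s + 1) = u i s" "x i (s + 1) = x i s - 1"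
      "path_piece u x i s = RhHF" "u (i + 1) (s + 1) = u (i + 1) s"
    | (equiv) "u i s = u (i + 1) s" "u i (s + 1) = u i s" "x i (s + 1) = x i s"
      "path_piece u x i s = Equiv" "u (i + 1) (s + 1) = u (i + 1) s"
proof -
  have sn: "s \<le> n" "s + 1 \<le> n" using s by auto
  have b: "u (i + 1) s \<le> u i s" "u i s \<le> u (i + 1) s + 1" "u i s \<le> u i (s + 1)" "u i (s + 1) \<le> u (i + 1) s + 1"
    "u (i + 1) (s + 1) \<le> u i (s + 1)" "u (i + 1) s \<le> u (i + 1) (s + 1)"
    using patternD(3)[OF p sn(1) i] pattern_drop[OF p i sn(1)] patternD(4,5)[OF p s i] patternD(3)[OF p sn(2) i]
      pattern_mono[OF p, of "i + 1" s "s + 1"] i sn by auto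
  note x = patternD(9)[OF p s i]
  show ?thesis
  proof (cases "u i s = u (i + 1) s")
    case False
    have u: "u i s = u (i + 1) s + 1" "u i (s + 1) = u i s" using b False by linarith+
    show ?thesis
    proof (rule dormant[OF u])
      show "x i (s + 1) = x i s" using x u by simp
      show "path_piece u x i s = RhHR" using False by (simp add: path_piece_def)
      show "u (i + 1) (s + 1) = u (i + 1) s \<or> u (i + 1) (s + 1) = u (i + 1) s + 1" using b u by linarith
    qed
  next
    case eq: True
    show ?thesis
    proof (cases "u i (s + 1) = u i s + 1")
      case True
      show ?thesis
      proof (rule up[OF eq True])
        show "x i (s + 1) = x i s" using x eq True by simp
        show "path_piece u x i s = Up1" using eq True by (simp add: path_piece_def)
        show "u (i + 1) (s + 1) = u (i + 1) s \<or> u (i + 1) (s + 1) = u (i + 1) s + 1" using b eq True by linarith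
      qed
    next
      case False
      have u: "u i (s + 1) = u i s" "u (i + 1) (s + 1) = u (i + 1) s" using b eq False by linarith+
      show ?thesis
      proof (cases "x i (s + 1) = x i s - 1")
        case True
        show ?thesis by (rule left[OF eq u(1) True _ u(2)]) (use eq u True in \<open>simp add: path_piece_def\<close>)
      next
        case False
        then have st: "x i (s + 1) = x i s" using x by blast
        show ?thesis by (rule equiv[OF eq u(1) st _ u(2)]) (use eq u st in \<open>simp add: path_piece_def\<close>)
      qed
    qed
  qed
qed

lemma path_steps_from_to:
  assumes d: "1 \<le> d" "d \<le> n" and lam: "lam \<in> partitions d n" and mu: "mu \<in> partitions d n"
    and nu: "nu \<in> partitions d n" and l: "proper (trapezoid n) l" and bd: "boundary_labels n d lam mu nu l"
    and p: "pattern n d lam mu nu u x" and r: "realizes n d l u x" and s: "s < n" and i: "i \<in> {1..d}"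
  shows "path_from_to (pieces (trapezoid n) l) (path_edge n u x i s) (path_steps n u x i s) (path_edge n u x i (s + 1))"
proof -
  note P = path_piece_in[OF d lam mu nu l bd p r s i]
  show ?thesis
  proof (cases rule: pattern_step_cases[OF p s i, case_names dormant up left equiv])
    case dormant
    then show ?thesis using P by (auto simp: path_edge_def path_steps_def algebra_simps)
  next
    case up
    then show ?thesis using P by (auto simp: path_edge_def path_steps_def algebra_simps)
  next
    case left
    then show ?thesis using P by (auto simp: path_edge_def path_steps_def algebra_simps)
  next
    case equiv
    then show ?thesis using P by (auto simp: path_edge_def path_steps_def algebra_simps)
  qed
qed

lemma full_path_from_to:
  assumes d: "1 \<le> d" "d \<le> n" and lam: "lam \<in> partitions d n" and mu: "mu \<in> partitions d n"
    and nu: "nu \<in> partitions d n" and l: "proper (trapezoid n) l" and bd: "boundary_labels n d lam mu nu l"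
    and p: "pattern n d lam mu nu u x" and r: "realizes n d l u x" and i: "i \<in> {1..d}" and m: "m \<le> n"
  shows "path_from_to (pieces (trapezoid n) l) (path_edge n u x i 0)
    (concat (map (path_steps n u x i) [0..<m])) (path_edge n u x i m)"
  using m
proof (induction m)
  case (Suc m)
  have "path_from_to (pieces (trapezoid n) l) (path_edge n u x i m) (path_steps n u x i m) (path_edge n u x i (m + 1))"
    using Suc by (intro path_steps_from_to[OF d lam mu nu l bd p r _ i]) auto
  then show ?case using Suc by (auto simp: path_from_to_append)
qed simp

lemma path_piece_neq_Dn1: "path_piece u x i s \<noteq> Dn1"
  by (simp add: path_piece_def)

lemma first_time:
  fixes v :: "nat \<Rightarrow> nat"
  assumes "v 0 \<le> j" "j < v n"
  obtains m where "m < n" "v m \<le> j" "j < v (m + 1)" "\<And>s. s \<le> m \<Longrightarrow> v s \<le> j"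
proof -
  define t where "t = (LEAST t. j < v t)"
  have t: "j < v t" "t \<le> n" and min: "\<And>s. s < t \<Longrightarrow> v s \<le> j"
    unfolding t_def using assms(2) by (auto intro: LeastI Least_le dest: not_less_Least)
  have "t \<noteq> 0" using t assms(1) by (metis not_le)
  then obtain m where "t = m + 1" by (metis Suc_eq_plus1 not0_implies_Suc)
  then show ?thesis using t min that[of m] by auto
qed

lemma upt_split3: "t \<le> m \<Longrightarrow> m < n \<Longrightarrow> [t..<n] = [t..<m] @ m # [m + 1..<n]"
  using upt_add_eq_append[of t m "n - m"] upt_conv_Cons[of m n] by simp

text \<open>The \<open>j\<close>-th downward 1-triangle lies in the strip in which
  \<open>u (i + 1)\<close> reaches \<open>j\<close>, the next upward one in the strip in which
  \<open>u i\<close> exceeds \<open>j\<close>; each strip in between contributes a single rhombus.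
  The last conclusion is what \<open>segment_append\<close> asks for.\<close>

lemma segment_steps:
  assumes p: "pattern n d lam mu nu u x" and mu: "mu \<in> partitions d n" and d: "d \<le> n"
    and i: "1 \<le> i" and j: "i + j \<le> d"
  defines "xs \<equiv> concat (map (path_steps n u x i) [0..<n])"
  obtains t m where
    "segment xs (j + 1) = map (\<lambda>s. (path_piece u x i s, x i s, int n - 1 - int s - x i s)) [t..<m]"
    "\<And>s. t \<le> s \<and> s < m \<longleftrightarrow> s < n \<and> u i (s + 1) = j \<and> u (i + 1) s = j"
    "\<exists>q \<in> set (((\<lambda>ys. tl (dropWhile (\<lambda>x. fst x \<noteq> Dn1) ys)) ^^ j) xs). fst q = Up1"
proof -
  let ?D = "\<lambda>ys. tl (dropWhile (\<lambda>x. fst x \<noteq> Dn1) ys) :: placed list"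
  let ?st = "path_steps n u x i"
  have i': "i \<in> {1..d}" "i \<in> {1..d + 1}" "i + 1 \<in> {1..d + 1}" using i j by auto
  have fin: "u i n = d + 1 - i" "u (i + 1) n = d - i"
    using pattern_final[OF p mu d i'(2)] pattern_final[OF p mu d i'(3)] by auto
  have zero: "u i 0 = 0" "u (i + 1) 0 = 0" using pattern_zero[OF p] i' by auto
  have mono: "u i s \<le> u i t" "u (i + 1) s \<le> u (i + 1) t" if "s \<le> t" "t \<le> n" for s t
    using pattern_mono[OF p i'(2) that] pattern_mono[OF p i'(3) that] by auto
  note cases = pattern_step_cases[OF p _ i'(1)]
  have inc: "u (i + 1) (s + 1) \<le> u (i + 1) s + 1" if "s < n" for s
    by (cases rule: cases[OF that]) auto
  \<comment> \<open>After \<open>k\<close> downward 1-triangles the rest of the path starts on the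
    first line with \<open>u (i + 1) t = k\<close>.\<close>
  have "\<exists>t\<le>n. u (i + 1) t = k \<and> (\<forall>s<t. u (i + 1) s < k) \<and> (?D ^^ k) xs = concat (map ?st [t..<n])" if "k \<le> j" for k
    using that
  proof (induction k)
    case 0
    then show ?case using zero by (intro exI[of _ 0]) (simp add: xs_def)
  next
    case (Suc k)
    then obtain t where t: "t \<le> n" "u (i + 1) t = k" "\<forall>s<t. u (i + 1) s < k"
      "(?D ^^ k) xs = concat (map ?st [t..<n])" by auto
    have "u (i + 1) 0 \<le> k" "k < u (i + 1) n" using zero fin j Suc.prems by auto
    then obtain m where m: "m < n" "u (i + 1) m \<le> k" "k < u (i + 1) (m + 1)" "\<And>s. s \<le> m \<Longrightarrow> u (i + 1) s \<le> k"
      by (rule first_time) blast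
    have tm: "t \<le> m"
    proof (rule ccontr)
      assume "\<not> t \<le> m"
      then have "u (i + 1) (m + 1) \<le> u (i + 1) t" using t by (intro mono) auto
      then show False using m t by auto
    qed
    have um: "u (i + 1) m = k" "u (i + 1) (m + 1) = k + 1"
      using inc[OF m(1)] m(1-3) mono(2)[OF tm] t(2) by linarith+
    have noD: "fst q \<noteq> Dn1" if q: "q \<in> set (concat (map ?st [t..<m]))" for q
    proof -
      obtain s where s: "t \<le> s" "s < m" "q \<in> set (?st s)" using q by auto
      have "u (i + 1) s = k" "u (i + 1) (s + 1) = k"
        using m(4)[of s] m(4)[of "s + 1"] mono(2)[of t s] mono(2)[of t "s + 1"] t s m(1) by auto
      then show ?thesis using s(3) path_piece_neq_Dn1 by (auto simp: path_steps_def)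
    qed
    have split: "concat (map ?st [t..<n]) = concat (map ?st [t..<m]) @
        (path_piece u x i m, x i m, int n - 1 - int m - x i m) # (Dn1, x i m, int n - 2 - int m - x i m) #
        concat (map ?st [m + 1..<n])"
      unfolding upt_split3[OF tm m(1)] using um by (simp add: path_steps_def)
    have "dropWhile (\<lambda>x. fst x \<noteq> Dn1) (concat (map ?st [t..<m]) @ w) = dropWhile (\<lambda>x. fst x \<noteq> Dn1) w" for w
      by (rule dropWhile_append2) (rule noD)
    then have "?D (concat (map ?st [t..<n])) = concat (map ?st [m + 1..<n])"
      unfolding split using path_piece_neq_Dn1 by simp
    then have "(?D ^^ Suc k) xs = concat (map ?st [m + 1..<n])" using t(4) by simp
    moreover have "\<forall>s<m + 1. u (i + 1) s < k + 1" using m(4) by (auto simp: less_Suc_eq_le)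
    ultimately show ?case using um m(1) by (intro exI[of _ "m + 1"]) simp
  qed
  from this[OF order_refl] obtain t where t: "t \<le> n" "u (i + 1) t = j" "\<forall>s<t. u (i + 1) s < j"
    and D: "(?D ^^ j) xs = concat (map ?st [t..<n])" by blast
  have "u i 0 \<le> j" "j < u i n" using zero fin j by auto
  then obtain m where m: "m < n" "u i m \<le> j" "j < u i (m + 1)" "\<And>s. s \<le> m \<Longrightarrow> u i s \<le> j"
    by (rule first_time) blast
  have le: "u (i + 1) s \<le> u i s" if "s \<le> n" for s using patternD(3)[OF p that i'(1)] .
  have "j \<le> u (i + 1) m" using patternD(5)[OF p m(1) i'(1)] m by auto
  then have um: "u (i + 1) m = j" "u i m = j" using le[OF less_imp_le[OF m(1)]] m(2) by linarith+
  then have tm: "t \<le> m" using t(3) by (metis less_irrefl not_le)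
  have piece: "path_piece u x i m = Up1"
    using um m(3) by (cases rule: cases[OF m(1)]) auto
  have S: "t \<le> s \<and> s < m \<longleftrightarrow> s < n \<and> u i (s + 1) = j \<and> u (i + 1) s = j" for s
  proof
    assume s: "t \<le> s \<and> s < m"
    then have "u i (s + 1) \<le> j" "j \<le> u (i + 1) s" "u i s \<le> u i (s + 1)" "u (i + 1) s \<le> u i s" 
      using m mono(2)[of t s] mono(1)[of s "s + 1"] le[of s] t by auto
    then show "s < n \<and> u i (s + 1) = j \<and> u (i + 1) s = j" using s m(1) by auto
  next
    assume s: "s < n \<and> u i (s + 1) = j \<and> u (i + 1) s = j"
    have "t \<le> s" using s t(3) by (metis less_irrefl not_le)
    moreover have "s < m"
    proof (rule ccontr)
      assume "\<not> s < m"
      then have "u i (m + 1) \<le> u i (s + 1)" using s by (intro mono) auto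
      then show False using s m by auto
    qed
    ultimately show "t \<le> s \<and> s < m" by simp
  qed
  have st: "?st s = [(path_piece u x i s, x i s, int n - 1 - int s - x i s)]" "path_piece u x i s \<noteq> Up1"
    if "t \<le> s" "s < m" for s
  proof -
    have s: "s < n" "u i (s + 1) = j" "u (i + 1) s = j" using S[of s] that by auto
    have "u i s \<le> u i (s + 1)" using mono(1)[of s "s + 1"] s by auto
    then have "u i s = j" using le[of s] s by auto
    then show "?st s = [(path_piece u x i s, x i s, int n - 1 - int s - x i s)]" "path_piece u x i s \<noteq> Up1"
      using s unfolding path_steps_def by (cases rule: cases[OF s(1)]; auto)+
  qed
  have eq: "concat (map ?st [t..<m]) = map (\<lambda>s. (path_piece u x i s, x i s, int n - 1 - int s - x i s)) [t..<m]"
  proof -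
    have "map ?st [t..<m] = map (\<lambda>s. [(path_piece u x i s, x i s, int n - 1 - int s - x i s)]) [t..<m]"
      using st(1) by (intro map_cong) auto
    then show ?thesis by (simp add: concat_map_singleton del: map_eq_conv)
  qed
  obtain rest where rest: "?st m @ concat (map ?st [m + 1..<n]) = (Up1, x i m, int n - 1 - int m - x i m) # rest"
    using piece by (simp add: path_steps_def)
  have split: "concat (map ?st [t..<n]) = concat (map ?st [t..<m]) @ (Up1, x i m, int n - 1 - int m - x i m) # rest"
    unfolding upt_split3[OF tm m(1)] using rest by simp
  have "takeWhile (\<lambda>x. fst x \<noteq> Up1) (concat (map ?st [t..<n])) = concat (map ?st [t..<m])"
    unfolding split eq using st(2) by (subst takeWhile_append2) auto
  then have "segment xs (j + 1) = map (\<lambda>s. (path_piece u x i s, x i s, int n - 1 - int s - x i s)) [t..<m]"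
    using D eq by (simp add: segment_def)
  moreover have "\<exists>q \<in> set ((?D ^^ j) xs). fst q = Up1" unfolding D split by simp
  ultimately show ?thesis using that S by blast
qed

text \<open>From top to bottom along the NE side the first coordinate increases, so the numbering of
  the paths from the top agrees with that by \<open>pos n lam\<close>.\<close>

lemma NE_ones:
  assumes "boundary_labels n d lam mu nu (extend_labels (labelling P))" "tiling (triangle n) P"
    and lam: "lam \<in> partitions d n" and d: "d \<le> n" and i: "i \<in> {1..d}"
  shows "filter (\<lambda>e. edge_label P e = 1) (NE_side n) ! (i - 1) = Fall (pos n lam i) (int n - 1 - pos n lam i)"
proof -
  let ?g = "\<lambda>a. Fall a (int n - 1 - a)"
  let ?Q = "\<lambda>a. edge_label P (?g a) = 1"
  have Q: "?Q a \<longleftrightarrow> (\<exists>i\<in>{1..d}. a = pos n lam i)" if a: "a \<in> {0..int n - 1}" for a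
  proof -
    have "labelling P (?g a) \<le> 1"
      by (rule properD(5)[OF labelling_proper[OF assms(2)]]) (use a in \<open>auto simp: Upw_triangle Dnw_triangle\<close>)
    then have "edge_label P (?g a) = extend_labels (labelling P) (?g a)"
      using edge_label_labelling a by (simp del: labelling.simps)
    then show ?thesis using assms(1) a unfolding boundary_labels_def by (simp del: labelling.simps extend_labels.simps)
  qed
  have "filter ?Q [0..int n - 1] = map (pos n lam) [1..<d + 1]"
  proof (rule strict_sorted_equal)
    show "sorted_wrt (<) (filter ?Q [0..int n - 1])"
      by (intro sorted_wrt_filter) (simp add: strict_sorted_iff)
    have "sorted_wrt (\<lambda>i j. pos n lam i < pos n lam j) [1..<d + 1]"
      unfolding sorted_wrt_iff_nth_less using pos_less[OF lam] by (auto simp: nth_upt simp del: upt_Suc)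
    then show "sorted_wrt (<) (map (pos n lam) [1..<d + 1])" by (simp only: sorted_wrt_map)
    show "set (filter ?Q [0..int n - 1]) = set (map (pos n lam) [1..<d + 1])"
    proof (rule sym, intro equalityI subsetI)
      fix a assume "a \<in> set (map (pos n lam) [1..<d + 1])"
      then obtain i where "i \<in> {1..<d + 1}" and a: "a = pos n lam i" unfolding set_map set_upt by blast
      then have i: "i \<in> {1..d}" "a = pos n lam i" by auto
      then have "a \<in> {0..int n - 1}" using pos_bounds[OF lam d, of i] by auto
      then show "a \<in> set (filter ?Q [0..int n - 1])" using Q i by auto
    next
      fix a assume "a \<in> set (filter ?Q [0..int n - 1])"
      then have a: "a \<in> {0..int n - 1}" "?Q a" by auto
      then obtain i where "i \<in> {1..d}" "a = pos n lam i" using Q by blast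
      then show "a \<in> set (map (pos n lam) [1..<d + 1])" by (auto simp del: upt_Suc)
    qed
  qed
  then have "filter (\<lambda>e. edge_label P e = 1) (NE_side n) = map ?g (map (pos n lam) [1..<d + 1])"
    unfolding NE_side_def filter_map comp_def by simp
  moreover obtain k where "i = k + 1" "k < d" using i by (cases i) auto
  ultimately show ?thesis by (simp add: nth_upt del: upt_Suc)
qed

section \<open>The bijection\<close>

text \<open>With \<open>j = d - i - row\<close>, the segment of path \<open>i\<close> runs over
  consecutive strips, and subtracting \<open>j\<close> turns them into the columns of the entries
  \<open>i\<close> in this row. Since the row is weakly decreasing, these blocks make up the
  row.\<close>

lemma mu_row_eq:
  assumes d: "1 \<le> d" "d \<le> n" and lam: "lam \<in> partitions d n" and mu: "mu \<in> partitions d n"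
    and nu: "nu \<in> partitions d n" and P: "P \<in> LP_plus n lam mu nu"
    and p: "pattern n d lam mu nu u x" and r: "realizes n d (extend_labels (labelling P)) u x"
    and B: "fills d mu u x B" and row: "row < d"
  shows "mu_row d n P (row + 1) = B ! row"
proof -
  let ?l = "extend_labels (labelling P)"
  have T: "tiling (triangle n) P" using P by (simp add: LP_plus_def)
  note l = proper_extend_labels[OF labelling_proper[OF T]]
  note bd = LP_plus_boundary[OF d(2) lam mu nu P]
  note Q = strip_embed_pieces[OF T]
  note F = fills_mu_filling[OF p mu d(2) B]
  note sh = mu_filling_shape[OF F mu]
  have len: "length (B ! row) = mu ! row" using sh(2)[OF row] .
  have rowmap: "B ! row = map (\<lambda>c. B ! row ! c) [0..<mu ! row]"
    using len by (metis map_nth)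
  have seg: "map (\<lambda>q. (i, fst q = Equiv)) (segment (path n P i) (d + 2 - i - (row + 1))) =
      filter (\<lambda>a. fst a = i) (B ! row)"
    if i: "1 \<le> i" "i \<le> d - row" for i
  proof -
    define j where "j = d - i - row"
    have j: "i + j \<le> d" "d + 2 - i - (row + 1) = j + 1" "row = d - i - j" "i \<in> {1..d}"
      using i row by (auto simp: j_def)
    let ?xs = "concat (map (path_steps n u x i) [0..<n])"
    obtain t m where s1: "segment ?xs (j + 1) =
        map (\<lambda>s. (path_piece u x i s, x i s, int n - 1 - int s - x i s)) [t..<m]"
      and s2: "\<And>s. t \<le> s \<and> s < m \<longleftrightarrow> s < n \<and> u i (s + 1) = j \<and> u (i + 1) s = j"
      and s3: "\<exists>q \<in> set (((\<lambda>ys. tl (dropWhile (\<lambda>x. fst x \<noteq> Dn1) ys)) ^^ j) ?xs). fst q = Up1"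
      using segment_steps[OF p mu d(2) i(1) j(1)] by blast
    have start: "path_edge n u x i 0 = Fall (pos n lam i) (int n - 1 - pos n lam i)"
      using patternD(6)[OF p j(4)] pattern_zero[OF p, of i] pattern_zero[OF p, of "i + 1"] j(4)
      by (simp add: path_edge_def)
    have finish: "path_edge n u x i n = Hor (x i n) (- x i n)"
      using pattern_final[OF p mu d(2), of i] pattern_final[OF p mu d(2), of "i + 1"] j(4)
      by (simp add: path_edge_def)
    have xb: "0 \<le> x i n" "pos n lam i < int n"
      using pattern_bounds[OF p d(2) lam nu j(4)] pos_bounds[OF lam d(2)] j(4) by auto
    have full: "path_from_to (strip_embed n P) (Fall (pos n lam i) (int n - 1 - pos n lam i)) ?xs (Hor (x i n) (- x i n))"
      using full_path_from_to[OF d lam mu nu l bd p r j(4) order_refl] unfolding Q start finish .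
    obtain ys zs a where cut: "?xs = ys @ zs"
      "path_from_to P (Fall (pos n lam i) (int n - 1 - pos n lam i)) ys (Hor a 0)"
      "0 \<le> a" "a < int n" "\<forall>z\<in>set zs. fst z = RhHR"
      using path_cut[OF T full] xb by auto
    have path: "path n P i = ys"
      unfolding path_def NE_ones[OF bd T lam d(2) j(4)]
    proof (rule the_equality)
      show "\<exists>f\<in>set (horizontal_side n 0). path_from_to P (Fall (pos n lam i) (int n - 1 - pos n lam i)) ys f"
        using cut by (intro bexI[of _ "Hor a 0"]) (auto simp: horizontal_side_def)
    next
      fix ws assume "\<exists>f\<in>set (horizontal_side n 0). path_from_to P (Fall (pos n lam i) (int n - 1 - pos n lam i)) ws f"
      then obtain a' where "path_from_to P (Fall (pos n lam i) (int n - 1 - pos n lam i)) ws (Hor a' 0)"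
        by (auto simp: horizontal_side_def)
      then show "ws = ys" using path_unique[OF T _ cut(2)] by blast
    qed
    have "segment (path n P i) (j + 1) = segment ?xs (j + 1)"
      using segment_append[OF cut(5), of j ys] s3 unfolding path cut(1) by simp
    then have "map (\<lambda>q. (i, fst q = Equiv)) (segment (path n P i) (d + 2 - i - (row + 1)))
      = map (\<lambda>s. (i, path_piece u x i s = Equiv)) [t..<m]"
      unfolding j(2) s1 by simp
    \<comment> \<open>Both lists are strictly increasing, so only their sets need to be
      compared.\<close>
    also have "[t..<m] = map (\<lambda>c. c + j) (filter (\<lambda>c. val_at B (row, c) = i) [0..<mu ! row])"
    proof (rule strict_sorted_equal)
      show "sorted_wrt (<) (map (\<lambda>c. c + j) (filter (\<lambda>c. val_at B (row, c) = i) [0..<mu ! row]))"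
        by (simp add: sorted_wrt_map sorted_wrt_filter)
      show "sorted_wrt (<) [t..<m]" by simp
      show "set [t..<m] = set (map (\<lambda>c. c + j) (filter (\<lambda>c. val_at B (row, c) = i) [0..<mu ! row]))"
      proof (intro equalityI subsetI)
        fix s assume "s \<in> set [t..<m]"
        then have s: "s < n" "u i (s + 1) = j" "u (i + 1) s = j" using s2[of s] by auto
        have "u i s = j"
          using patternD(4)[OF p s(1) j(4)] patternD(3)[OF p less_imp_le[OF s(1)] j(4)] s by simp
        then have "j \<le> s" "(row, s - j) \<in> boxes d mu" "val_at B (row, s - j) = i"
          using active_box[OF p mu d(2) B j(4) s(1)] s j(3) by auto
        then show "s \<in> set (map (\<lambda>c. c + j) (filter (\<lambda>c. val_at B (row, c) = i) [0..<mu ! row]))"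
          by (auto simp: boxes_def image_iff intro!: bexI[of _ "s - j"])
      next
        fix s assume "s \<in> set (map (\<lambda>c. c + j) (filter (\<lambda>c. val_at B (row, c) = i) [0..<mu ! row]))"
        then obtain c where c: "s = c + j" "c < mu ! row" "val_at B (row, c) = i" by auto
        then have box: "(row, c) \<in> boxes d mu" using row by (simp add: boxes_def)
        note A = box_active_pattern[OF p mu d(2) B box, unfolded c(3)]
        have s: "strip d B (row, c) = s" using A(5) c by (simp add: j_def)
        have "u i s = j" "u i (s + 1) = u (i + 1) s" "s < n" using A(2-4) s by (simp_all add: j_def)
        moreover have "u i s \<le> u i (s + 1)" "u (i + 1) s \<le> u i s"
          using patternD(4)[OF p \<open>s < n\<close> j(4)] patternD(3)[OF p less_imp_le[OF \<open>s < n\<close>] j(4)] by auto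
        ultimately show "s \<in> set [t..<m]" using s2[of s] by auto
      qed
    qed
    also have "map (\<lambda>s. (i, path_piece u x i s = Equiv)) (map (\<lambda>c. c + j) (filter (\<lambda>c. val_at B (row, c) = i) [0..<mu ! row]))
      = map (\<lambda>c. B ! row ! c) (filter (\<lambda>c. val_at B (row, c) = i) [0..<mu ! row])"
      unfolding map_map
    proof (rule map_cong[OF refl])
      fix c assume "c \<in> set (filter (\<lambda>c. val_at B (row, c) = i) [0..<mu ! row])"
      then have c: "c < mu ! row" "val_at B (row, c) = i" by auto
      then have box: "(row, c) \<in> boxes d mu" using row by (simp add: boxes_def)
      note A = box_active_pattern[OF p mu d(2) B box, unfolded c(2)]
      have s: "strip d B (row, c) = c + j" using A(5) by (simp add: j_def)
      have "path_piece u x i (c + j) = Equiv \<longleftrightarrow> x i (c + j + 1) = x i (c + j)"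
        by (cases rule: pattern_step_cases[OF p A(2) j(4)]) (use A(2-4) s in \<open>auto simp: j_def\<close>)
      then have "path_piece u x i (c + j) = Equiv \<longleftrightarrow> barred_at B (row, c)"
        using fillsD(4)[OF B box] c(2) s by simp
      then show "((\<lambda>s. (i, path_piece u x i s = Equiv)) \<circ> (\<lambda>c. c + j)) c = B ! row ! c"
        using c(2) by (simp add: val_at_def barred_at_def prod_eq_iff)
    qed
    also have "\<dots> = filter (\<lambda>a. fst a = i) (B ! row)"
      by (subst (2) rowmap) (simp add: filter_map comp_def val_at_def)
    finally show ?thesis .
  qed
  have "mu_row d n P (row + 1) = concat (map (\<lambda>i. filter (\<lambda>a. fst a = i) (B ! row)) (rev [1..<d - row + 1]))"
  proof -
    have "d + 2 - (row + 1) = d - row + 1" using row by simp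
    then show ?thesis unfolding mu_row_def
      by (intro arg_cong[where f = concat] map_cong) (use seg in auto)
  qed
  also have "\<dots> = B ! row"
  proof (rule concat_filter_values)
    have "val_at B (row, c2) \<le> val_at B (row, c1)" if "c1 < c2" "c2 < mu ! row" for c1 c2
      using mu_filling_val[OF F mu order_refl row, of c1 c2] that by simp
    then show "sorted_wrt (\<lambda>a b. fst b \<le> fst a) (B ! row)"
      unfolding sorted_wrt_iff_nth_less len by (simp add: val_at_def)
    show "\<forall>a\<in>set (B ! row). fst a \<in> {1..d - row}"
      using mu_filling_val_range[OF F mu] row unfolding all_set_conv_all_nth len
      by (auto simp: boxes_def val_at_def) (metis add_le_imp_le_diff)
  qed
  finally show ?thesis .
qed

lemma Phi_eq:
  assumes "1 \<le> d" "d \<le> n" "lam \<in> partitions d n" "mu \<in> partitions d n" "nu \<in> partitions d n"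
    "P \<in> LP_plus n lam mu nu" "pattern n d lam mu nu u x"
    "realizes n d (extend_labels (labelling P)) u x" and B: "fills d mu u x B"
  shows "Phi d n lam P = (lam_rows d lam, B)"
proof -
  have "map length B = mu" "length mu = d" using B assms(4) by (auto simp: fills_def partitions_def)
  then have len: "length B = d" by (metis length_map)
  have "map (mu_row d n P) [1..<d + 1] = B"
  proof (rule nth_equalityI)
    fix row assume "row < length (map (mu_row d n P) [1..<d + 1])"
    then have "row < d" by (simp del: upt_Suc)
    then show "map (mu_row d n P) [1..<d + 1] ! row = B ! row"
      using mu_row_eq[OF assms] by (simp add: nth_upt del: upt_Suc)
  qed (simp add: len)
  then show ?thesis by (simp add: Phi_def lam_rows_def)
qed

text \<open>A labelling is recovered from its pieces only inside the trapezoid, and a tableau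
  determines a pattern only for the paths 1 to \<open>d\<close> and the lines up to
  \<open>n\<close>; this allows replacement within these ranges.\<close>

lemma realizes_cong:
  assumes "\<And>t a. t \<le> n \<Longrightarrow> 0 \<le> a \<Longrightarrow> a < int n \<Longrightarrow> fall_at n l t a = fall_at n l' t a"
    and r: "realizes n d l u x"
    and "\<And>i t. i \<in> {1..d} \<Longrightarrow> t \<le> n \<Longrightarrow> 0 \<le> x i t \<and> x i t < int n"
    and "\<And>i t. i \<in> {1..d} \<Longrightarrow> t \<le> n \<Longrightarrow> x i t = x' i t \<and> u i t = u' i t"
    and "\<And>t. t \<le> n \<Longrightarrow> u (d + 1) t = 0 \<and> u' (d + 1) t = 0"
  shows "realizes n d l' u' x'"
  unfolding realizes_def
proof (intro allI impI conjI ballI)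
  fix t i assume t: "t \<le> n" and i: "i \<in> {1..d}"
  have "u (i + 1) t = u' (i + 1) t" using assms(4)[of "i + 1" t] assms(5)[OF t] t i by (cases "i = d") auto
  then show "fall_at n l' t (x' i t) = 1 + (u' i t - u' (i + 1) t)"
    using realizesD(1)[OF r t i] assms(1)[OF t] assms(3,4)[OF i t] by metis
next
  fix t a assume t: "t \<le> n" and a: "a \<in> {0..int n - 1}" "fall_at n l' t a \<noteq> 0"
  then have "fall_at n l t a \<noteq> 0" using assms(1)[OF t, of a] by auto
  then obtain i where "i \<in> {1..d}" "a = x i t" using realizesD(2)[OF r t, of a] a by auto
  then show "\<exists>i\<in>{1..d}. a = x' i t" using assms(4)[OF _ t] by auto
qed

text \<open>A relation instead of a function: a puzzle determines its pattern and hence its tableau,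
  and the tableau determines the pattern and hence the puzzle, so both directions are treated
  alike.\<close>

definition corresponds ::
    "nat \<Rightarrow> nat \<Rightarrow> nat list \<Rightarrow> nat list \<Rightarrow> nat list \<Rightarrow> placed set \<Rightarrow> entry list list \<Rightarrow> bool" where
  "corresponds n d lam mu nu P B \<longleftrightarrow>
     (\<exists>u x. pattern n d lam mu nu u x \<and> realizes n d (labelling P) u x \<and> fills d mu u x B)"

lemma fall_at_labelling_pieces:
  assumes "proper (trapezoid n) l" "t \<le> n" "0 \<le> a" "a < int n"
  shows "fall_at n (labelling (pieces (trapezoid n) l)) t a = fall_at n l t a"
proof -
  have "Upw a (int n - 1 - int t - a) \<in> trapezoid n" using assms by (simp add: Upw_trapezoid)
  from up_labels_labelling[OF assms(1) this] show ?thesis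
    by (simp add: fall_at_def up_labels_def del: labelling.simps)
qed

theorem proposition9p5:
  fixes n d :: nat and lam mu nu :: "nat list"
  assumes "1 \<le> d" and "d \<le> n"
    and "lam \<in> partitions d n" and "mu \<in> partitions d n" and "nu \<in> partitions d n"
  shows "\<exists>\<Psi> :: placed set \<Rightarrow> filling.
    bij_betw \<Psi> (LP n lam mu nu) (LR d lam mu nu) \<and>
    (\<forall>P \<in> LP_plus n lam mu nu. strip_embed n P \<in> LP n lam mu nu \<and> \<Psi> (strip_embed n P) = Phi d n lam P) \<and>
    (\<forall>P \<in> LP n lam mu nu.
       puzzle_c n P = tableau_c d (\<Psi> P) \<and>
       puzzle_C n P = tableau_C d n (\<Psi> P) \<and>
       (\<forall>y :: int \<Rightarrow> 'a::comm_ring_1.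
          expr_value y (puzzle_c n P) = expr_value y (tableau_c d (\<Psi> P)) \<and>
          expr_value y (puzzle_C n P) = expr_value y (tableau_C d n (\<Psi> P))))"
proof -
  note d = assms(1,2) and lam = assms(3) and mu = assms(4) and nu = assms(5)
  let ?LP = "LP n lam mu nu" and ?R = "corresponds n d lam mu nu"
  have LP: "tiling (trapezoid n) P" "boundary_labels n d lam mu nu (labelling P)" "proper (trapezoid n) (labelling P)"
    "pieces (trapezoid n) (labelling P) = P" if "P \<in> ?LP" for P
    using that LP_iff[OF d(2) lam mu nu] labelling_proper pieces_labelling by blast+
  have lmu: "length mu = d" using mu by (simp add: partitions_def)
  have ex: "\<exists>B. ?R P B" if P: "P \<in> ?LP" for P
  proof -
    obtain u x where p: "pattern n d lam mu nu u x" "realizes n d (labelling P) u x"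
      by (rule puzzle_pattern[OF d lam mu nu LP(3,2)[OF P]]) (rule that)
    moreover obtain B where "fills d mu u x B" using pattern_fills[OF p(1) mu d(2)] by blast
    ultimately show ?thesis unfolding corresponds_def by blast
  qed
  have uniq: "B = B'" if R: "?R P B" "?R P B'" for P B B'
  proof -
    obtain u x where 1: "pattern n d lam mu nu u x" "realizes n d (labelling P) u x" "fills d mu u x B"
      using R(1) unfolding corresponds_def by blast
    obtain u' x' where 2: "pattern n d lam mu nu u' x'" "realizes n d (labelling P) u' x'" "fills d mu u' x' B'"
      using R(2) unfolding corresponds_def by blast
    note U = realizes_unique[OF 1(1) 2(1) 1(2) 2(2) d(2) lam nu]
    show ?thesis
      by (rule fills_unique[OF 1(3) 2(3) lmu _ _ mu d(2)]) (use U in auto)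
  qed
  have inj: "P = P'" if P: "P \<in> ?LP" "P' \<in> ?LP" and R: "?R P B" "?R P' B" for P P' B
  proof -
    obtain u x where 1: "pattern n d lam mu nu u x" "realizes n d (labelling P) u x" "fills d mu u x B"
      using R(1) unfolding corresponds_def by blast
    obtain u' x' where 2: "pattern n d lam mu nu u' x'" "realizes n d (labelling P') u' x'" "fills d mu u' x' B"
      using R(2) unfolding corresponds_def by blast
    note U = fills_pattern_unique[OF 2(1) 1(1) mu d(2) 2(3) 1(3)]
    have "realizes n d (labelling P') u x"
    proof (rule realizes_cong[OF refl 2(2)])
      show "0 \<le> x' i t \<and> x' i t < int n" if "i \<in> {1..d}" "t \<le> n" for i t
        using pattern_bounds[OF 2(1) d(2) lam nu that] by simp
      show "u' (d + 1) t = 0 \<and> u (d + 1) t = 0" if "t \<le> n" for t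
        using patternD(1)[OF 1(1) that] patternD(1)[OF 2(1) that] by simp
    qed (use U in auto)
    from pattern_puzzle_unique[OF 1(1) LP(3,2)[OF P(1)] 1(2) LP(3,2)[OF P(2)] this d(2) mu]
    show ?thesis using LP(4) P by simp
  qed
  have into: "(lam_rows d lam, B) \<in> LR d lam mu nu" if "?R P B" for P B
    using that fills_LR[OF _ lam mu nu d(2)] unfolding corresponds_def by blast
  have onto: "A = lam_rows d lam \<and> (\<exists>P \<in> ?LP. ?R P B)" if L: "(A, B) \<in> LR d lam mu nu" for A B
  proof -
    obtain u x where p: "pattern n d lam mu nu u x" and B: "fills d mu u x B"
      using tableau_pattern[OF lam mu nu d(2) L] by blast
    obtain l where l: "proper (trapezoid n) l" "boundary_labels n d lam mu nu l" "realizes n d l u x"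
      using pattern_puzzle[OF p d lam mu nu] by blast
    have "realizes n d (labelling (pieces (trapezoid n) l)) u x"
      by (rule realizes_cong[OF _ l(3)])
        (use fall_at_labelling_pieces[OF l(1)] pattern_bounds[OF p d(2) lam nu] patternD(1)[OF p] in auto)
    then have "?R (pieces (trapezoid n) l) B" using p B unfolding corresponds_def by blast
    moreover have "pieces (trapezoid n) l \<in> ?LP" by (rule pieces_in_LP[OF d(2) lam mu nu l(1,2)])
    moreover have "A = lam_rows d lam" using L LR_iff[OF lam mu nu d(2)] by blast
    ultimately show ?thesis by blast
  qed
  \<comment> \<open>By \<open>ex\<close> and \<open>uniq\<close> there is exactly one choice for
    each trapezoid puzzle.\<close>
  define \<Psi> where "\<Psi> P = (lam_rows d lam, SOME B. ?R P B)" for P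
  have R\<Psi>: "?R P (snd (\<Psi> P))" if "P \<in> ?LP" for P
    unfolding \<Psi>_def using ex[OF that] by (simp add: someI_ex)
  have \<Psi>I: "\<Psi> P = (lam_rows d lam, B)" if "P \<in> ?LP" "?R P B" for P B
    using uniq[OF R\<Psi>[OF that(1)] that(2)] by (simp add: \<Psi>_def)
  have "bij_betw \<Psi> ?LP (LR d lam mu nu)"
  proof (rule bij_betw_imageI)
    show "inj_on \<Psi> ?LP"
      using inj R\<Psi> by (metis inj_onI)
    show "\<Psi> ` ?LP = LR d lam mu nu"
    proof (intro equalityI subsetI)
      fix L assume "L \<in> \<Psi> ` ?LP"
      then obtain P where P: "P \<in> ?LP" "L = \<Psi> P" by blast
      then show "L \<in> LR d lam mu nu" using into[OF R\<Psi>[OF P(1)]] by (simp add: \<Psi>_def)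
    next
      fix L assume L: "L \<in> LR d lam mu nu"
      obtain A B where AB: "L = (A, B)" by (cases L)
      then obtain P where "P \<in> ?LP" "?R P B" "A = lam_rows d lam" using onto L by blast
      then show "L \<in> \<Psi> ` ?LP" using \<Psi>I[of P B] AB by (metis image_eqI)
    qed
  qed
  moreover have "strip_embed n P \<in> ?LP \<and> \<Psi> (strip_embed n P) = Phi d n lam P" if P: "P \<in> LP_plus n lam mu nu" for P
  proof -
    let ?l = "extend_labels (labelling P)"
    have T: "tiling (triangle n) P" using P by (simp add: LP_plus_def)
    note l = proper_extend_labels[OF labelling_proper[OF T]]
    note bd = LP_plus_boundary[OF d(2) lam mu nu P]
    have Q: "strip_embed n P = pieces (trapezoid n) ?l" by (rule strip_embed_pieces[OF T])
    then have LP: "strip_embed n P \<in> ?LP" using pieces_in_LP[OF d(2) lam mu nu l bd] by simp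
    \<comment> \<open>One pattern serves both sides: for the labels \<open>?l\<close> it computes
      \<open>Phi\<close> along the paths, and moved to the labelling of the extended puzzle it
      computes \<open>\<Psi>\<close>.\<close>
    obtain u x where p: "pattern n d lam mu nu u x" and r: "realizes n d ?l u x"
      by (rule puzzle_pattern[OF d lam mu nu l bd]) (rule that)
    obtain B where B: "fills d mu u x B" using pattern_fills[OF p mu d(2)] by blast
    have "realizes n d (labelling (strip_embed n P)) u x"
      unfolding Q
      by (rule realizes_cong[OF _ r])
        (use fall_at_labelling_pieces[OF l] pattern_bounds[OF p d(2) lam nu] patternD(1)[OF p] in auto)
    then have "\<Psi> (strip_embed n P) = (lam_rows d lam, B)"
      using p B by (intro \<Psi>I[OF LP]) (auto simp: corresponds_def)
    then show ?thesis using LP Phi_eq[OF d lam mu nu P p r B] by simp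
  qed
  moreover have "puzzle_c n P = tableau_c d (\<Psi> P) \<and> puzzle_C n P = tableau_C d n (\<Psi> P)" if P: "P \<in> ?LP" for P
  proof -
    obtain u x where 1: "pattern n d lam mu nu u x" "realizes n d (labelling P) u x" "fills d mu u x (snd (\<Psi> P))"
      using R\<Psi>[OF P] unfolding corresponds_def by blast
    have "\<Psi> P = (lam_rows d lam, snd (\<Psi> P))" by (simp add: \<Psi>_def)
    then show ?thesis
      using weights_eq[OF d lam mu nu LP(3,2)[OF P] 1] LP(4)[OF P] by metis
  qed
  ultimately show ?thesis by (intro exI[of _ \<Psi>]) simp
qed

end
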